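(* Let $P\in\mathbb{C}[x,y]$ have no zeros in $\mathbb{H}^2$, satisfy $P(0,0)=0$, and have no common factors with $\bar P$. Let $[P]$ be as described in the context. Then $$\dim\bigl(\mathcal{I}^2_P/([P],\overline{[P]})\bigr)=\tfrac12\dim\bigl(\mathbb{C}\{x,y\}/(P,\bar P)\bigr).$$
   Context: $\mathbb{H}=\{z\in\mathbb{C}:\operatorname{Im} z>0\}$, $\mathbb{H}^2=\mathbb{H}\times\mathbb{H}$. For a polynomial or power series $P$, $\bar P(x,y)=\overline{P(\bar x,\bar y)}$. $\mathbb{C}\{x,y\}$ is the ring of convergent power series at $(0,0)$; $(F,G)$ denotes the ideal generated by $F,G$ in $\mathbb{C}\{x,y\}$. $f\in L^{\mathfrak{p}}_{loc}$ means $f$ is in $L^{\mathfrak{p}}(U)$ (Lebesgue measure) for some neighborhood $U$ of $(0,0)$ in $\mathbb{R}^2$; $\mathcal{I}^{\mathfrak{p}}_P=\{Q\in\mathbb{C}\{x,y\}:Q/P\in L^{\mathfrak{p}}_{loc}\}$. By a theorem of Bickel–Knese–Pascoe–Sola, for such $P$ vanishing to order $M$ at $(0,0)$ there exist $L_1,\dots,L_M\in\mathbb{N}$ and $q_1,\dots,q_M\in\mathbb{R}[x]$ with $q_j(0)=0$, $q_j'(0)>0$, $\deg q_j<2L_j$, such that $[P](x,y)=\prod_{j=1}^M(y+q_j(x)+ix^{2L_j})$ satisfies: $P/[P]$ and $[P]/P$ are bounded on a punctured neighborhood of $(0,0)$ in $\mathbb{R}^2$. *)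

theory Defs
  imports "HOL-Analysis.Analysis" "HOL-Computational_Algebra.Polynomial"
begin

text \<open>Formal power series in two variables x, y, represented by their coefficient
  function: c (i,j) is the coefficient of x^i y^j.\<close>
type_synonym ps2 = "nat \<times> nat \<Rightarrow> complex"

definition ps_conv :: "ps2 \<Rightarrow> bool" where
  "ps_conv c \<longleftrightarrow> (\<exists>r>0. (\<lambda>(i,j). norm (c (i,j)) * r ^ (i + j)) summable_on UNIV)"

definition poly2 :: "ps2 \<Rightarrow> bool" where
  "poly2 c \<longleftrightarrow> finite {ij. c ij \<noteq> 0}"

definition ps_add :: "ps2 \<Rightarrow> ps2 \<Rightarrow> ps2" where
  "ps_add a b = (\<lambda>ij. a ij + b ij)"

definition ps_mult :: "ps2 \<Rightarrow> ps2 \<Rightarrow> ps2" where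
  "ps_mult a b = (\<lambda>(i,j). \<Sum>k\<le>i. \<Sum>l\<le>j. a (k,l) * b (i - k, j - l))"

text \<open>Evaluation (meaningful inside the domain of convergence).\<close>
definition ps_eval :: "ps2 \<Rightarrow> complex \<Rightarrow> complex \<Rightarrow> complex" where
  "ps_eval c x y = (\<Sum>\<^sub>\<infinity>(i,j)\<in>UNIV. c (i,j) * x ^ i * y ^ j)"

text \<open>\<open>\<bar>P\<close>(x,y) = conj (P(conj x, conj y)): conjugate all coefficients.\<close>
definition ps_bar :: "ps2 \<Rightarrow> ps2" where
  "ps_bar c = (\<lambda>ij. cnj (c ij))"

definition ideal2 :: "ps2 \<Rightarrow> ps2 \<Rightarrow> ps2 set" where
  "ideal2 F G = {ps_add (ps_mult A F) (ps_mult B G) | A B. ps_conv A \<and> ps_conv B}"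

definition vorder :: "ps2 \<Rightarrow> nat" where
  "vorder c = (LEAST n. \<exists>i j. i + j = n \<and> c (i,j) \<noteq> 0)"

definition poly2_dvd :: "ps2 \<Rightarrow> ps2 \<Rightarrow> bool" where
  "poly2_dvd D P \<longleftrightarrow> (\<exists>Q. poly2 Q \<and> P = ps_mult D Q)"

definition no_common_factor :: "ps2 \<Rightarrow> ps2 \<Rightarrow> bool" where
  "no_common_factor P Q \<longleftrightarrow>
     (\<forall>D. poly2 D \<and> poly2_dvd D P \<and> poly2_dvd D Q \<longrightarrow> (\<forall>ij. ij \<noteq> (0,0) \<longrightarrow> D ij = 0))"

definition Lp_loc :: "real \<Rightarrow> (real \<times> real \<Rightarrow> complex) \<Rightarrow> bool" where
  "Lp_loc p f \<longleftrightarrow> (\<exists>U. open U \<and> (0,0) \<in> U \<and> set_borel_measurable lborel U f \<and>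
      (\<integral>\<^sup>+ z \<in> U. ennreal (norm (f z) powr p) \<partial>lborel) < \<infinity>)"

definition Ip :: "real \<Rightarrow> ps2 \<Rightarrow> ps2 set" where
  "Ip p P = {Q. ps_conv Q \<and>
      Lp_loc p (\<lambda>(x,y). ps_eval Q (of_real x) (of_real y) / ps_eval P (of_real x) (of_real y))}"

definition indep_mod :: "ps2 set \<Rightarrow> ps2 set \<Rightarrow> bool" where
  "indep_mod S W \<longleftrightarrow> (\<forall>a. (\<lambda>ij. \<Sum>s\<in>S. a s * s ij) \<in> W \<longrightarrow> (\<forall>s\<in>S. a s = 0))"

definition quot_dim :: "ps2 set \<Rightarrow> ps2 set \<Rightarrow> enat" where
  "quot_dim V W = (SUP S \<in> {S. finite S \<and> S \<subseteq> V \<and> indep_mod S W}. enat (card S))"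

end

theory Submission
  imports Defs "HOL-Complex_Analysis.Complex_Analysis"
    "HOL-Computational_Algebra.Fundamental_Theorem_Algebra" "Jordan_Normal_Form.Determinant"
begin

text \<open>
  Write \<open>A\<close> for the ring of convergent series, \<open>b_j = - q_j - i x^(2 L_j)\<close>, so that
  \<open>[P] = \<Prod> (y - b_j)\<close>, and \<open>N\<close> for the sum over all j, k of the order at 0 of \<open>conj b_j - b_k\<close>.
  The theorem follows from \<open>dim A/(P, bar P) = dim A/([P], bar [P]) = N\<close> and \<open>dim A/I\<^sup>2 = N/2\<close>.

  For the first two equalities let W be a Weierstrass polynomial in y, comparable to \<open>[P]\<close> on the real
  plane, whose roots \<open>a_k(x)\<close> lie in the lower half plane for real x. Multiplication by \<open>bar W\<close> on the free
  \<open>C{x}\<close>-module \<open>A/(W)\<close> has a determinant of modulus \<open>\<Prod> |W(x, conj a_k)|\<close> at real x, and its order is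
  the dimension of \<open>A/(W, bar W)\<close>. By the maximum principle W and \<open>[P]\<close> are comparable on a half disc in
  the upper half plane, so this product is comparable to \<open>\<Prod> |[P](x, conj a_k)| = \<Prod> |W(x, conj b_j)|\<close>,
  hence to \<open>\<Prod> |[P](x, conj b_j)|\<close>, which has order N.

  For the last equality one removes the factors of \<open>[P] = (y - b) B'\<close> one at a time:
  \<open>I\<^sup>2\<close> of \<open>[P]\<close> consists of the series \<open>x^L e(x) B' + (y - conj b) G\<close> with G in \<open>I\<^sup>2\<close> of \<open>B'\<close>. The inclusion that
  needs an argument is the Hardy space bound for the value of \<open>F/[P]\<close> at the point \<open>y = conj b(x)\<close> of the
  upper half plane by its square integral over the real line.
\<close>

text \<open>Comparability of P and \<open>[P]\<close> on the real plane does not make the ideals (P,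
  bar P) and ([P], bar [P]) equal; only their codimensions are compared. The roots
  \<open>a_k(x)\<close> need not be power series in x, so the comparison is made for one real x at a
  time. The determinant, however, is a convergent series in x whose modulus at each such x is
  symmetric in the roots, and its order can be read off from its growth as x tends to 0 from the
  right. Taking W = \<open>[P]\<close> in the same argument gives the second codimension.

  Where the half comes from: the diagonal orders in N are 2 \<open>L_j\<close>, and the order for
  (j, k) equals that for (k, j). So N is twice the sum over j of \<open>L_j\<close> plus the orders
  with k < j, and removing the factor j costs exactly this summand. Of 2 \<open>L_j\<close> only one
  half counts, because conj \<open>b_j(x)\<close> lies at height \<open>x^(2 L_j)\<close> above the
  real axis and point evaluation in the Hardy space costs the square root of the height. An excess
  of one order would leave a multiple of 1/x below an integrable function of x.\<close>

hide_const (open) Determinants.det Finite_Cartesian_Product.mat Finite_Cartesian_Product.row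
  Finite_Cartesian_Product.column Finite_Cartesian_Product.vec

no_notation vec_nth (infixl \<open>$\<close> 90)

subsection \<open>Convergent power series in two variables\<close>

text \<open>A series in x, y is a power series in y over the power series in x,
  so that ring structure comes for free.\<close>
type_synonym ser = "complex fps fps"

abbreviation cf :: "ser \<Rightarrow> nat \<Rightarrow> nat \<Rightarrow> complex" where
  "cf f i j \<equiv> fps_nth (fps_nth f j) i"

abbreviation xser :: "complex fps \<Rightarrow> ser" where
  "xser \<equiv> fps_const"

abbreviation yvar :: ser where
  "yvar \<equiv> fps_X"

text \<open>The weighted l1 norm cut off at a square of indices: bounds uniform in m express
  absolute convergence on a polydisc through finite sums alone. The radii r and s are separate
  because Weierstrass division needs r small compared with a power of s.\<close>

definition sqsum :: "real \<Rightarrow> real \<Rightarrow> ser \<Rightarrow> nat \<Rightarrow> real" where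
  "sqsum r s f m = (\<Sum>j\<le>m. \<Sum>i\<le>m. norm (cf f i j) * r ^ i * s ^ j)"

definition bnd :: "real \<Rightarrow> real \<Rightarrow> ser \<Rightarrow> real \<Rightarrow> bool" where
  "bnd r s f C \<longleftrightarrow> (\<forall>m. sqsum r s f m \<le> C)"

definition conv_on :: "real \<Rightarrow> ser \<Rightarrow> bool" where
  "conv_on \<rho> f \<longleftrightarrow> \<rho> > 0 \<and> (\<exists>C. bnd \<rho> \<rho> f C)"

definition cser :: "ser set" where
  "cser = {f. \<exists>\<rho>. conv_on \<rho> f}"

lemma sqsum_nonneg: "r \<ge> 0 \<Longrightarrow> s \<ge> 0 \<Longrightarrow> sqsum r s f m \<ge> 0"
  unfolding sqsum_def by (intro sum_nonneg) simp

lemma bnd_nonneg: "bnd r s f C \<Longrightarrow> r \<ge> 0 \<Longrightarrow> s \<ge> 0 \<Longrightarrow> C \<ge> 0"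
  using sqsum_nonneg[of r s f 0] unfolding bnd_def by (meson order_trans)

lemma bnd_mono:
  assumes "bnd r s f C" "0 \<le> r'" "r' \<le> r" "0 \<le> s'" "s' \<le> s" "C \<le> C'"
  shows "bnd r' s' f C'"
proof -
  have "sqsum r' s' f m \<le> sqsum r s f m" for m
    unfolding sqsum_def using assms
    by (intro sum_mono mult_mono power_mono mult_left_mono) auto
  thus ?thesis using assms unfolding bnd_def by (meson order_trans)
qed

lemma bnd_add:
  assumes "bnd r s f C" "bnd r s g D" "r \<ge> 0" "s \<ge> 0"
  shows "bnd r s (f + g) (C + D)"
proof -
  have "sqsum r s (f + g) m \<le> sqsum r s f m + sqsum r s g m" for m
    unfolding sqsum_def sum.distrib[symmetric] using assms(3,4)
    by (intro sum_mono) (simp add: norm_triangle_ineq mult_right_mono flip: distrib_right)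
  thus ?thesis using assms unfolding bnd_def by (meson add_mono order_trans)
qed

lemma bnd_uminus: "bnd r s f C \<Longrightarrow> bnd r s (- f) C"
  unfolding bnd_def sqsum_def by simp

text \<open>The pairs (l, p) with l + p \<le> m form a triangle inside the square, and all terms are
  nonnegative.\<close>

lemma sum_convolution_le:
  fixes h :: "nat \<Rightarrow> nat \<Rightarrow> real"
  assumes "\<And>l p. h l p \<ge> 0"
  shows "(\<Sum>j\<le>m. \<Sum>l\<le>j. h l (j - l)) \<le> (\<Sum>l\<le>m. \<Sum>p\<le>m. h l p)"
proof -
  have "(\<Sum>j\<le>m. \<Sum>l\<le>j. h l (j - l)) = (\<Sum>(l,p)\<in>{(l,p). l + p \<le> m}. h l p)"
    by (rule sum.triangle_reindex_eq[symmetric])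
  also have "\<dots> \<le> (\<Sum>(l,p)\<in>{..m} \<times> {..m}. h l p)"
    by (intro sum_mono2) (auto simp: assms)
  also have "\<dots> = (\<Sum>l\<le>m. \<Sum>p\<le>m. h l p)"
    by (rule sum.cartesian_product[symmetric])
  finally show ?thesis .
qed

lemma cf_mult: "cf (f * g) i j = (\<Sum>l\<le>j. \<Sum>k\<le>i. cf f k l * cf g (i - k) (j - l))"
  by (simp add: fps_mult_nth fps_sum_nth atLeast0AtMost)

text \<open>The triangle inequality for the coefficients of a product, followed by
  \<open>sum_convolution_le\<close> in the y-index and then in the x-index. This is the Banach
  algebra inequality for the weighted l1 norm.\<close>

lemma sqsum_mult:
  assumes "r \<ge> 0" "s \<ge> 0"
  shows "sqsum r s (f * g) m \<le> sqsum r s f m * sqsum r s g m"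
proof -
  define F where "F k l = norm (cf f k l) * r ^ k * s ^ l" for k l
  define G where "G k l = norm (cf g k l) * r ^ k * s ^ l" for k l
  have nn: "F k l \<ge> 0" "G k l \<ge> 0" for k l using assms by (auto simp: F_def G_def)
  have "norm (cf (f * g) i j) * r ^ i * s ^ j \<le> (\<Sum>l\<le>j. \<Sum>k\<le>i. F k l * G (i - k) (j - l))" for i j
  proof -
    have "norm (cf (f * g) i j) * r ^ i * s ^ j
        \<le> (\<Sum>l\<le>j. \<Sum>k\<le>i. norm (cf f k l) * norm (cf g (i - k) (j - l))) * r ^ i * s ^ j"
      unfolding cf_mult using assms
      by (intro mult_right_mono) (auto intro!: sum_norm_le simp: norm_mult)
    also have "\<dots> = (\<Sum>l\<le>j. \<Sum>k\<le>i. norm (cf f k l) * norm (cf g (i - k) (j - l)) * r ^ i * s ^ j)"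
      by (simp add: sum_distrib_right)
    also have "\<dots> = (\<Sum>l\<le>j. \<Sum>k\<le>i. F k l * G (i - k) (j - l))"
    proof (intro sum.cong refl)
      fix l k assume "l \<in> {..j}" "k \<in> {..i}"
      hence "r ^ i = r ^ k * r ^ (i - k)" "s ^ j = s ^ l * s ^ (j - l)"
        by (simp_all flip: power_add)
      thus "norm (cf f k l) * norm (cf g (i - k) (j - l)) * r ^ i * s ^ j = F k l * G (i - k) (j - l)"
        by (simp add: F_def G_def)
    qed
    finally show ?thesis .
  qed
  hence "sqsum r s (f * g) m \<le> (\<Sum>j\<le>m. \<Sum>i\<le>m. \<Sum>l\<le>j. \<Sum>k\<le>i. F k l * G (i - k) (j - l))"
    unfolding sqsum_def by (intro sum_mono)
  also have "\<dots> = (\<Sum>j\<le>m. \<Sum>l\<le>j. \<Sum>i\<le>m. \<Sum>k\<le>i. F k l * G (i - k) (j - l))"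
    by (intro sum.cong refl sum.swap)
  also have "\<dots> \<le> (\<Sum>l\<le>m. \<Sum>p\<le>m. \<Sum>i\<le>m. \<Sum>k\<le>i. F k l * G (i - k) p)"
    by (rule sum_convolution_le) (intro sum_nonneg mult_nonneg_nonneg nn)
  also have "\<dots> \<le> (\<Sum>l\<le>m. \<Sum>p\<le>m. \<Sum>k\<le>m. \<Sum>i\<le>m. F k l * G i p)"
    by (intro sum_mono sum_convolution_le) (auto simp: nn)
  also have "\<dots> = (\<Sum>l\<le>m. \<Sum>k\<le>m. F k l) * (\<Sum>p\<le>m. \<Sum>i\<le>m. G i p)"
  proof -
    have "(\<Sum>p\<le>m. \<Sum>k\<le>m. \<Sum>i\<le>m. F k l * G i p) = (\<Sum>k\<le>m. F k l) * (\<Sum>p\<le>m. \<Sum>i\<le>m. G i p)" for l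
      by (subst sum.swap) (simp only: sum_distrib_left sum_distrib_right)
    thus ?thesis by (simp only: sum_distrib_right)
  qed
  finally show ?thesis by (simp add: sqsum_def F_def G_def)
qed

lemma bnd_mult:
  assumes "bnd r s f C" "bnd r s g D" "r \<ge> 0" "s \<ge> 0"
  shows "bnd r s (f * g) (C * D)"
  unfolding bnd_def
proof
  fix m
  have "sqsum r s (f * g) m \<le> sqsum r s f m * sqsum r s g m" by (rule sqsum_mult) fact+
  also have "\<dots> \<le> C * D"
    using assms by (intro mult_mono) (auto simp: bnd_def sqsum_nonneg intro: bnd_nonneg)
  finally show "sqsum r s (f * g) m \<le> C * D" .
qed

lemma conv_on_pos: "conv_on \<rho> f \<Longrightarrow> \<rho> > 0" by (simp add: conv_on_def)

lemma conv_on_mono: "conv_on \<rho> f \<Longrightarrow> 0 < \<rho>' \<Longrightarrow> \<rho>' \<le> \<rho> \<Longrightarrow> conv_on \<rho>' f"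
  unfolding conv_on_def by (meson bnd_mono less_imp_le order_refl)

lemma conv_on_add: "conv_on \<rho> f \<Longrightarrow> conv_on \<rho> g \<Longrightarrow> conv_on \<rho> (f + g)"
  unfolding conv_on_def by (meson bnd_add less_imp_le)

lemma conv_on_uminus: "conv_on \<rho> f \<Longrightarrow> conv_on \<rho> (- f)"
  unfolding conv_on_def by (meson bnd_uminus)

lemma conv_on_diff: "conv_on \<rho> f \<Longrightarrow> conv_on \<rho> g \<Longrightarrow> conv_on \<rho> (f - g)"
  using conv_on_add[of \<rho> f "- g"] conv_on_uminus by simp

lemma conv_on_mult: "conv_on \<rho> f \<Longrightarrow> conv_on \<rho> g \<Longrightarrow> conv_on \<rho> (f * g)"
  unfolding conv_on_def by (meson bnd_mult less_imp_le)

lemma norm_partial_sums_fps_bounded: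
  assumes "r > 0" "ereal r < fps_conv_radius (f :: complex fps)"
  shows "(\<Sum>i\<le>m. norm (fps_nth f i) * r ^ i) \<le> (\<Sum>i. norm (fps_nth f i) * r ^ i)"
proof -
  have "summable (\<lambda>i. norm (fps_nth f i * of_real r ^ i))"
    using assms by (intro norm_summable_fps) auto
  hence "summable (\<lambda>i. norm (fps_nth f i) * r ^ i)"
    using assms by (simp add: norm_mult norm_power)
  thus ?thesis using assms by (intro sum_le_suminf) auto
qed

lemma conv_on_xser:
  assumes "\<rho> > 0" "ereal \<rho> < fps_conv_radius f"
  shows "conv_on \<rho> (xser f)"
proof -
  have "sqsum \<rho> \<rho> (xser f) m \<le> (\<Sum>i. norm (fps_nth f i) * \<rho> ^ i)" for m
  proof -
    have "sqsum \<rho> \<rho> (xser f) m = (\<Sum>j\<le>m. if j = 0 then (\<Sum>i\<le>m. norm (fps_nth f i) * \<rho> ^ i) else 0)"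
      unfolding sqsum_def by (intro sum.cong refl) auto
    also have "\<dots> = (\<Sum>i\<le>m. norm (fps_nth f i) * \<rho> ^ i)" by simp
    also have "\<dots> \<le> (\<Sum>i. norm (fps_nth f i) * \<rho> ^ i)"
      using assms by (rule norm_partial_sums_fps_bounded)
    finally show ?thesis .
  qed
  thus ?thesis using assms unfolding conv_on_def bnd_def by blast
qed

lemma conv_on_yvar: assumes "\<rho> > 0" shows "conv_on \<rho> yvar"
proof -
  have "sqsum \<rho> \<rho> yvar m \<le> \<rho>" for m
  proof -
    have "sqsum \<rho> \<rho> yvar m = (\<Sum>j\<le>m. if j = 1 then (\<Sum>i\<le>m. if i = 0 then \<rho> else 0) else 0)"
      unfolding sqsum_def
      by (intro sum.cong refl) (auto simp: if_distrib[of norm] if_distrib[of "\<lambda>t. t * _"] cong: if_cong)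
    also have "\<dots> = (\<Sum>j\<le>m. if j = 1 then \<rho> else 0)" by simp
    also have "\<dots> \<le> \<rho>" using assms by (subst sum.delta) auto
    finally show ?thesis .
  qed
  thus ?thesis using assms unfolding conv_on_def bnd_def by blast
qed

lemma conv_on_1: "\<rho> > 0 \<Longrightarrow> conv_on \<rho> 1"
  using conv_on_xser[of \<rho> 1] by simp

lemma conv_on_0: "\<rho> > 0 \<Longrightarrow> conv_on \<rho> 0"
  using conv_on_xser[of \<rho> 0] by simp

lemma conv_on_power: "conv_on \<rho> f \<Longrightarrow> conv_on \<rho> (f ^ n)"
  by (induction n) (auto intro: conv_on_1 conv_on_mult conv_on_pos)

lemma conv_on_prod: "\<rho> > 0 \<Longrightarrow> (\<And>i. i \<in> I \<Longrightarrow> conv_on \<rho> (f i)) \<Longrightarrow> conv_on \<rho> (\<Prod>i\<in>I. f i)"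
  by (induction I rule: infinite_finite_induct) (auto intro: conv_on_1 conv_on_mult)

lemma cser_conv_on2:
  assumes "f \<in> cser" "g \<in> cser"
  obtains \<rho> where "conv_on \<rho> f" "conv_on \<rho> g"
proof -
  from assms obtain a b where ab: "conv_on a f" "conv_on b g" by (auto simp: cser_def)
  hence "conv_on (min a b) f" "conv_on (min a b) g"
    using conv_on_pos[OF ab(1)] conv_on_pos[OF ab(2)] by (auto intro: conv_on_mono)
  thus ?thesis by (rule that)
qed

lemma cser_add: "f \<in> cser \<Longrightarrow> g \<in> cser \<Longrightarrow> f + g \<in> cser"
  by (metis cser_conv_on2 cser_def conv_on_add mem_Collect_eq)

lemma cser_mult: "f \<in> cser \<Longrightarrow> g \<in> cser \<Longrightarrow> f * g \<in> cser"
  by (metis cser_conv_on2 cser_def conv_on_mult mem_Collect_eq)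

lemma cser_uminus: "f \<in> cser \<Longrightarrow> - f \<in> cser"
  unfolding cser_def using conv_on_uminus by blast

lemma cser_diff: "f \<in> cser \<Longrightarrow> g \<in> cser \<Longrightarrow> f - g \<in> cser"
  using cser_add[of f "- g"] cser_uminus by simp

lemma cser_1 [simp]: "1 \<in> cser" and cser_0 [simp]: "0 \<in> cser" and cser_yvar [simp]: "yvar \<in> cser"
  unfolding cser_def using conv_on_1[of 1] conv_on_0[of 1] conv_on_yvar[of 1] by auto

lemma cser_xser: assumes "fps_conv_radius f > 0" shows "xser f \<in> cser"
proof -
  obtain r where "0 < ereal r" "ereal r < fps_conv_radius f"
    using assms ereal_dense2 by (metis zero_ereal_def ereal_less(2))
  hence "conv_on r (xser f)" by (intro conv_on_xser) auto
  thus ?thesis unfolding cser_def by blast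
qed

lemma cser_power: "f \<in> cser \<Longrightarrow> f ^ n \<in> cser"
  by (induction n) (auto intro: cser_mult)

lemma cser_sum: "(\<And>i. i \<in> I \<Longrightarrow> f i \<in> cser) \<Longrightarrow> (\<Sum>i\<in>I. f i) \<in> cser"
  by (induction I rule: infinite_finite_induct) (auto intro: cser_add)

subsection \<open>Evaluation\<close>

abbreviation evaluable :: "complex \<Rightarrow> complex fps \<Rightarrow> bool" where
  "evaluable x f \<equiv> ereal (norm x) < fps_conv_radius f"

lemma evaluable_add: "evaluable x f \<Longrightarrow> evaluable x g \<Longrightarrow> evaluable x (f + g)"
  using fps_conv_radius_add[of f g] by (meson less_le_trans min_less_iff_conj)

lemma evaluable_diff: "evaluable x f \<Longrightarrow> evaluable x g \<Longrightarrow> evaluable x (f - g)"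
  using fps_conv_radius_diff[of f g] by (meson less_le_trans min_less_iff_conj)

lemma evaluable_mult: "evaluable x f \<Longrightarrow> evaluable x g \<Longrightarrow> evaluable x (f * g)"
  using fps_conv_radius_mult[of f g] by (meson less_le_trans min_less_iff_conj)

lemma eval_fps_sum_evaluable:
  assumes "\<And>i. i \<in> I \<Longrightarrow> evaluable x (f i)"
  shows "evaluable x (\<Sum>i\<in>I. f i) \<and> eval_fps (\<Sum>i\<in>I. f i) x = (\<Sum>i\<in>I. eval_fps (f i) x)"
  using assms
  by (induction I rule: infinite_finite_induct) (auto simp: eval_fps_add evaluable_add)

lemma eval_fps_prod_evaluable:
  assumes "\<And>i. i \<in> I \<Longrightarrow> evaluable x (f i)"
  shows "evaluable x (\<Prod>i\<in>I. f i) \<and> eval_fps (\<Prod>i\<in>I. f i) x = (\<Prod>i\<in>I. eval_fps (f i) x)"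
  using assms
  by (induction I rule: infinite_finite_induct) (auto simp: eval_fps_mult evaluable_mult)

text \<open>Evaluation is split into two one-variable stages, x first, so that the theory of
  \<open>eval_fps\<close> serves for each of them.\<close>

definition slice :: "ser \<Rightarrow> complex \<Rightarrow> complex fps" where
  "slice f x = Abs_fps (\<lambda>j. eval_fps (fps_nth f j) x)"

definition ev :: "ser \<Rightarrow> complex \<Rightarrow> complex \<Rightarrow> complex" where
  "ev f x y = eval_fps (slice f x) y"

lemma slice_nth [simp]: "fps_nth (slice f x) j = eval_fps (fps_nth f j) x"
  by (simp add: slice_def)

section \<open>Convergence of the iterated sums\<close>

lemma bnd_rect:
  assumes "bnd r s f C" "r \<ge> 0" "s \<ge> 0"
  shows "(\<Sum>j\<le>m. \<Sum>i<n. norm (cf f i j) * r ^ i * s ^ j) \<le> C"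
proof -
  have "(\<Sum>j\<le>m. \<Sum>i<n. norm (cf f i j) * r ^ i * s ^ j)
      \<le> (\<Sum>j\<le>max m n. \<Sum>i<n. norm (cf f i j) * r ^ i * s ^ j)"
    using assms by (intro sum_mono2) (auto intro!: sum_nonneg)
  also have "\<dots> \<le> (\<Sum>j\<le>max m n. \<Sum>i\<le>max m n. norm (cf f i j) * r ^ i * s ^ j)"
    using assms by (intro sum_mono sum_mono2) auto
  also have "\<dots> \<le> C" using assms(1) unfolding bnd_def sqsum_def by blast
  finally show ?thesis .
qed

lemma bnd_row_summable:
  assumes "bnd r s f C" "r > 0" "s > 0"
  shows "summable (\<lambda>i. norm (cf f i j) * r ^ i)"
proof (rule summableI_nonneg_bounded)
  fix n
  have "(\<Sum>i<n. norm (cf f i j) * r ^ i) * s ^ j = (\<Sum>i<n. norm (cf f i j) * r ^ i * s ^ j)"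
    by (simp add: sum_distrib_right)
  also have "\<dots> \<le> (\<Sum>j\<le>j. \<Sum>i<n. norm (cf f i j) * r ^ i * s ^ j)"
    using assms by (intro member_le_sum) (auto intro!: sum_nonneg)
  also have "\<dots> \<le> C" using assms by (intro bnd_rect) auto
  finally show "(\<Sum>i<n. norm (cf f i j) * r ^ i) \<le> C / s ^ j"
    using assms by (simp add: field_simps)
qed (use assms in auto)

lemma bnd_radius:
  assumes "bnd r s f C" "r > 0" "s > 0"
  shows "fps_conv_radius (fps_nth f j) \<ge> ereal r"
proof -
  have "summable (\<lambda>i. norm (cf f i j * of_real r ^ i))"
    using bnd_row_summable[OF assms, of j] assms by (simp add: norm_mult norm_power)
  hence "summable (\<lambda>i. cf f i j * of_real r ^ i)" by (rule summable_norm_cancel)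
  from conv_radius_geI[OF this] show ?thesis using assms by (simp add: fps_conv_radius_def)
qed

text \<open>The finite sum over j may be exchanged with the series in i, which reduces the bound to
  partial sums over rectangles of indices.\<close>

lemma bnd_slice:
  assumes "bnd r s f C" "r > 0" "s > 0" "norm x \<le> r"
  shows "(\<Sum>j\<le>m. norm (eval_fps (fps_nth f j) x) * s ^ j) \<le> C"
proof -
  have nrm: "norm (eval_fps (fps_nth f j) x) \<le> (\<Sum>i. norm (cf f i j) * r ^ i)" for j
  proof -
    have le: "norm (cf f i j * x ^ i) \<le> norm (cf f i j) * r ^ i" for i
      using assms by (simp add: norm_mult norm_power mult_left_mono power_mono)
    have "summable (\<lambda>i. norm (cf f i j * x ^ i))"
      by (rule summable_comparison_test'[OF bnd_row_summable[OF assms(1-3), of j]]) (use le in auto)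
    thus ?thesis unfolding eval_fps_def
      by (intro order_trans[OF summable_norm suminf_le[OF le _ bnd_row_summable[OF assms(1-3)]]])
  qed
  have "(\<Sum>j\<le>m. norm (eval_fps (fps_nth f j) x) * s ^ j)
      \<le> (\<Sum>j\<le>m. (\<Sum>i. norm (cf f i j) * r ^ i) * s ^ j)"
    using assms by (intro sum_mono mult_right_mono nrm) auto
  also have "\<dots> = (\<Sum>j\<le>m. \<Sum>i. norm (cf f i j) * r ^ i * s ^ j)"
    by (intro sum.cong refl suminf_mult2 bnd_row_summable[OF assms(1-3)])
  also have "\<dots> = (\<Sum>i. \<Sum>j\<le>m. norm (cf f i j) * r ^ i * s ^ j)"
    by (intro suminf_sum[symmetric] summable_mult2 bnd_row_summable[OF assms(1-3)])
  also have "\<dots> \<le> C"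
  proof (rule suminf_le_const)
    show "summable (\<lambda>i. \<Sum>j\<le>m. norm (cf f i j) * r ^ i * s ^ j)"
      by (intro summable_sum summable_mult2 bnd_row_summable[OF assms(1-3)])
    fix n
    show "(\<Sum>i<n. \<Sum>j\<le>m. norm (cf f i j) * r ^ i * s ^ j) \<le> C"
      using bnd_rect[OF assms(1), where m=m and n=n] assms by (subst sum.swap) auto
  qed
  finally show ?thesis .
qed

lemma bnd_slice_summable:
  assumes "bnd r s f C" "r > 0" "s > 0" "norm x \<le> r"
  shows "summable (\<lambda>j. norm (eval_fps (fps_nth f j) x) * s ^ j)"
proof (rule summableI_nonneg_bounded)
  fix n
  show "(\<Sum>j<n. norm (eval_fps (fps_nth f j) x) * s ^ j) \<le> C"
    by (rule order_trans[OF sum_mono2 bnd_slice[OF assms, of n]]) (use assms in auto)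
qed (use assms in auto)

lemma bnd_slice_radius:
  assumes "bnd r s f C" "r > 0" "s > 0" "norm x \<le> r"
  shows "fps_conv_radius (slice f x) \<ge> ereal s"
proof -
  have "summable (\<lambda>j. norm (eval_fps (fps_nth f j) x * of_real s ^ j))"
    using bnd_slice_summable[OF assms] assms by (simp add: norm_mult norm_power)
  hence "summable (\<lambda>j. eval_fps (fps_nth f j) x * of_real s ^ j)" by (rule summable_norm_cancel)
  hence "conv_radius (\<lambda>j. eval_fps (fps_nth f j) x) \<ge> norm (of_real s :: complex)"
    by (rule conv_radius_geI)
  thus ?thesis using assms by (simp add: fps_conv_radius_def)
qed

lemma bnd_ev:
  assumes "bnd r s f C" "r > 0" "s > 0" "norm x \<le> r" "norm y \<le> s"
  shows "norm (ev f x y) \<le> C"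
proof -
  have le: "norm (eval_fps (fps_nth f j) x * y ^ j) \<le> norm (eval_fps (fps_nth f j) x) * s ^ j" for j
    using assms by (simp add: norm_mult norm_power mult_left_mono power_mono)
  note sm = bnd_slice_summable[OF assms(1-4)]
  have "summable (\<lambda>j. norm (eval_fps (fps_nth f j) x * y ^ j))"
    by (rule summable_comparison_test'[OF sm]) (use le in auto)
  hence "norm (ev f x y) \<le> (\<Sum>j. norm (eval_fps (fps_nth f j) x) * s ^ j)"
    unfolding ev_def eval_fps_def[of "slice f x"] slice_nth
    by (intro order_trans[OF summable_norm suminf_le[OF le _ sm]])
  also have "\<dots> \<le> C"
  proof (rule suminf_le_const[OF sm])
    fix n
    show "(\<Sum>j<n. norm (eval_fps (fps_nth f j) x) * s ^ j) \<le> C"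
      by (rule order_trans[OF sum_mono2 bnd_slice[OF assms(1-4), of n]]) (use assms in auto)
  qed
  finally show ?thesis .
qed

lemma conv_on_evaluable: "conv_on \<rho> f \<Longrightarrow> norm x < \<rho> \<Longrightarrow> evaluable x (fps_nth f j)"
  unfolding conv_on_def by (meson bnd_radius less_le_trans ereal_less(4) less_ereal.simps(1))

lemma conv_on_slice_evaluable: "conv_on \<rho> f \<Longrightarrow> norm x < \<rho> \<Longrightarrow> norm y < \<rho> \<Longrightarrow> evaluable y (slice f x)"
  unfolding conv_on_def
  by (meson bnd_slice_radius less_le_trans less_imp_le less_ereal.simps(1))

lemma cser_radius: "f \<in> cser \<Longrightarrow> fps_conv_radius (fps_nth f j) > 0"
  unfolding cser_def conv_on_def
  by (auto dest!: bnd_radius simp: less_le_trans[rotated] intro: less_le_trans[of 0 "ereal _"])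

lemma slice_add:
  assumes "conv_on \<rho> f" "conv_on \<rho> g" "norm x < \<rho>"
  shows "slice (f + g) x = slice f x + slice g x"
  by (rule fps_ext) (simp add: eval_fps_add conv_on_evaluable[OF _ assms(3)] assms)

lemma slice_diff:
  assumes "conv_on \<rho> f" "conv_on \<rho> g" "norm x < \<rho>"
  shows "slice (f - g) x = slice f x - slice g x"
  by (rule fps_ext) (simp add: eval_fps_diff conv_on_evaluable[OF _ assms(3)] assms)

lemma slice_mult:
  assumes "conv_on \<rho> f" "conv_on \<rho> g" "norm x < \<rho>"
  shows "slice (f * g) x = slice f x * slice g x"
proof (rule fps_ext)
  fix j
  have "eval_fps (\<Sum>i=0..j. fps_nth f i * fps_nth g (j - i)) x
      = (\<Sum>i=0..j. eval_fps (fps_nth f i * fps_nth g (j - i)) x)"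
    by (intro conjunct2[OF eval_fps_sum_evaluable] evaluable_mult conv_on_evaluable[OF _ assms(3)] assms)
  thus "fps_nth (slice (f * g) x) j = fps_nth (slice f x * slice g x) j"
    by (simp add: fps_mult_nth eval_fps_mult conv_on_evaluable[OF _ assms(3)] assms)
qed

lemma ev_add:
  assumes "conv_on \<rho> f" "conv_on \<rho> g" "norm x < \<rho>" "norm y < \<rho>"
  shows "ev (f + g) x y = ev f x y + ev g x y"
  unfolding ev_def by (simp add: slice_add[OF assms(1-3)] eval_fps_add conv_on_slice_evaluable[OF _ assms(3,4)] assms)

lemma ev_diff:
  assumes "conv_on \<rho> f" "conv_on \<rho> g" "norm x < \<rho>" "norm y < \<rho>"
  shows "ev (f - g) x y = ev f x y - ev g x y"
  unfolding ev_def by (simp add: slice_diff[OF assms(1-3)] eval_fps_diff conv_on_slice_evaluable[OF _ assms(3,4)] assms)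

lemma ev_mult:
  assumes "conv_on \<rho> f" "conv_on \<rho> g" "norm x < \<rho>" "norm y < \<rho>"
  shows "ev (f * g) x y = ev f x y * ev g x y"
  unfolding ev_def by (simp add: slice_mult[OF assms(1-3)] eval_fps_mult conv_on_slice_evaluable[OF _ assms(3,4)] assms)

lemma slice_xser [simp]: "slice (xser f) x = fps_const (eval_fps f x)"
  by (rule fps_ext) (auto simp: fps_const_def eval_fps_def)

lemma ev_xser [simp]: "ev (xser f) x y = eval_fps f x"
  by (simp add: ev_def)

lemma slice_1 [simp]: "slice 1 x = 1"
  using slice_xser[of 1 x] by simp

lemma ev_1 [simp]: "ev 1 x y = 1"
  by (simp add: ev_def)

lemma slice_yvar [simp]: "slice yvar x = fps_X"
  by (rule fps_ext) auto

lemma ev_yvar [simp]: "ev yvar x y = y"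
  by (simp add: ev_def)

lemma ev_holomorphic_y: "conv_on \<rho> f \<Longrightarrow> norm x < \<rho> \<Longrightarrow> ev f x holomorphic_on ball 0 \<rho>"
  unfolding ev_def
  by (rule holomorphic_on_eval_fps[THEN holomorphic_on_subset])
     (auto simp: conv_on_slice_evaluable dist_norm)

text \<open>The identity theorem in one variable is used twice: in y for each fixed x, which
  identifies the slices, and then in x for each coefficient of a power of y.\<close>

lemma ev_eqD:
  assumes "conv_on \<rho> f" "conv_on \<rho> g"
    and "\<And>x y. norm x < \<rho> \<Longrightarrow> norm y < \<rho> \<Longrightarrow> ev f x y = ev g x y"
  shows "f = g"
proof -
  note pos = conv_on_pos[OF assms(1)]
  have near: "eventually (\<lambda>z::complex. norm z < \<rho>) (nhds 0)"
    using eventually_nhds_in_open[of "ball 0 \<rho>" "0::complex"] pos by (simp add: dist_norm)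
  have sl: "slice f x = slice g x" if "norm x < \<rho>" for x
  proof (rule eval_fps_eqD)
    show "fps_conv_radius (slice f x) > 0" "fps_conv_radius (slice g x) > 0"
      using conv_on_slice_evaluable[OF _ that, of _ 0] assms pos by (auto simp: zero_ereal_def)
    show "\<forall>\<^sub>F z in nhds 0. eval_fps (slice f x) z = eval_fps (slice g x) z"
      using near by eventually_elim (use assms(3)[OF that] in \<open>simp add: ev_def\<close>)
  qed
  show ?thesis
  proof (rule fps_ext, rule eval_fps_eqD)
    fix j
    show "fps_conv_radius (fps_nth f j) > 0" "fps_conv_radius (fps_nth g j) > 0"
      using conv_on_evaluable[of \<rho> _ 0] assms pos by (auto simp: zero_ereal_def)
    show "\<forall>\<^sub>F z in nhds 0. eval_fps (fps_nth f j) z = eval_fps (fps_nth g j) z"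
      using near by eventually_elim (metis sl slice_nth)
  qed
qed

subsection \<open>Relation to coefficient functions\<close>

definition to_ser :: "ps2 \<Rightarrow> ser" where
  "to_ser c = Abs_fps (\<lambda>j. Abs_fps (\<lambda>i. c (i,j)))"

lemma cf_to_ser [simp]: "cf (to_ser c) i j = c (i,j)"
  by (simp add: to_ser_def)

lemma ser_eqI: "(\<And>i j. cf f i j = cf g i j) \<Longrightarrow> f = g"
  by (intro fps_ext) auto

lemma to_ser_inject [simp]: "to_ser a = to_ser b \<longleftrightarrow> a = b"
  by (metis cf_to_ser ext surj_pair)

lemma to_ser_surj: "to_ser (\<lambda>(i,j). cf f i j) = f"
  by (rule ser_eqI) simp

lemma to_ser_add: "to_ser (ps_add a b) = to_ser a + to_ser b"
  by (rule ser_eqI) (simp add: ps_add_def)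

lemma to_ser_mult: "to_ser (ps_mult a b) = to_ser a * to_ser b"
proof (rule ser_eqI)
  fix i j
  have "(\<Sum>k\<le>i. \<Sum>l\<le>j. a (k,l) * b (i - k, j - l)) = (\<Sum>l\<le>j. \<Sum>k\<le>i. a (k,l) * b (i - k, j - l))"
    by (rule sum.swap)
  thus "cf (to_ser (ps_mult a b)) i j = cf (to_ser a * to_ser b) i j"
    by (simp add: ps_mult_def cf_mult)
qed

lemma sqsum_eq_sum: "sqsum r s (to_ser c) m = (\<Sum>(i,j)\<in>{..m}\<times>{..m}. norm (c (i,j)) * r ^ i * s ^ j)"
  unfolding sqsum_def by (subst sum.swap) (simp add: sum.cartesian_product)

text \<open>Every finite set of index pairs lies in a square, so bounded square sums and summability
  of the nonnegative terms are the same condition.\<close>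

lemma bnd_iff_summable_on:
  assumes "r > 0" "s > 0"
  shows "(\<exists>C. bnd r s (to_ser c) C) \<longleftrightarrow> (\<lambda>(i,j). norm (c (i,j)) * r ^ i * s ^ j) summable_on UNIV"
proof
  let ?f = "\<lambda>(i,j). norm (c (i,j)) * r ^ i * s ^ j"
  assume "\<exists>C. bnd r s (to_ser c) C"
  then obtain C where C: "bnd r s (to_ser c) C" ..
  have "sum ?f F \<le> C" if fin: "finite F" for F
  proof -
    obtain m where m: "\<forall>k \<in> fst ` F \<union> snd ` F. k \<le> m"
      using fin finite_nat_set_iff_bounded_le[THEN iffD1, of "fst ` F \<union> snd ` F"] by auto
    have "sum ?f F \<le> sum ?f ({..m} \<times> {..m})"
      using m assms by (intro sum_mono2) force+
    also have "\<dots> \<le> C" using C by (simp add: bnd_def sqsum_eq_sum)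
    finally show ?thesis .
  qed
  thus "?f summable_on UNIV"
    using assms by (intro nonneg_bdd_above_summable_on) (auto intro!: bdd_aboveI2[where M=C])
next
  let ?f = "\<lambda>(i,j). norm (c (i,j)) * r ^ i * s ^ j"
  assume sm: "?f summable_on UNIV"
  have "sqsum r s (to_ser c) m \<le> infsum ?f UNIV" for m
    unfolding sqsum_eq_sum using assms by (intro finite_sum_le_infsum sm) auto
  thus "\<exists>C. bnd r s (to_ser c) C" unfolding bnd_def by blast
qed

lemma conv_on_iff_summable_on:
  "conv_on \<rho> (to_ser c) \<longleftrightarrow> \<rho> > 0 \<and> (\<lambda>(i,j). norm (c (i,j)) * \<rho> ^ (i + j)) summable_on UNIV"
  using bnd_iff_summable_on[of \<rho> \<rho> c] unfolding conv_on_def by (auto simp: power_add mult.assoc)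

lemma ps_conv_iff: "ps_conv c \<longleftrightarrow> to_ser c \<in> cser"
  unfolding ps_conv_def cser_def by (auto simp: conv_on_iff_summable_on)

lemma ps_terms_bound:
  assumes "norm x \<le> \<rho>" "norm y \<le> \<rho>"
  shows "norm (c (i,j) * x ^ i * y ^ j :: complex) \<le> norm (c (i,j)) * \<rho> ^ (i + j)"
proof -
  have "norm (c (i,j) * x ^ i * y ^ j) = norm (c (i,j)) * (norm x ^ i * norm y ^ j)"
    by (simp add: norm_mult norm_power)
  also have "\<dots> \<le> norm (c (i,j)) * (\<rho> ^ i * \<rho> ^ j)"
    using assms order_trans[OF norm_ge_zero assms(1)] by (intro mult_left_mono mult_mono power_mono) auto
  finally show ?thesis by (simp add: power_add)
qed

text \<open>Absolute summability on the bidisc of radius \<rho> allows the unordered double sum to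
  be taken as an iterated one, with the powers of x inside.\<close>

lemma ps_eval_eq_ev:
  assumes "conv_on \<rho> (to_ser c)" "norm x < \<rho>" "norm y < \<rho>"
  shows "ps_eval c x y = ev (to_ser c) x y"
proof -
  let ?t = "\<lambda>(i,j). c (i,j) * x ^ i * y ^ j"
  have "(\<lambda>(i,j). norm (c (i,j)) * \<rho> ^ (i + j)) summable_on UNIV"
    using assms by (simp add: conv_on_iff_summable_on)
  hence "(\<lambda>ij. norm (?t ij)) summable_on UNIV"
    by (rule Infinite_Sum.abs_summable_on_comparison_test') (use assms ps_terms_bound[of x \<rho> y c] in \<open>auto\<close>)
  hence sm: "?t summable_on UNIV" by (rule abs_summable_summable)
  hence sm': "(\<lambda>(j,i). c (i,j) * x ^ i * y ^ j) summable_on UNIV \<times> UNIV"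
    using summable_on_swap[of ?t UNIV UNIV] by simp
  have row: "(\<Sum>\<^sub>\<infinity>i. c (i,j) * x ^ i * y ^ j) = eval_fps (fps_nth (to_ser c) j) x * y ^ j" for j
  proof -
    have "summable (\<lambda>i. norm (cf (to_ser c) i j * x ^ i))"
      by (intro norm_summable_fps conv_on_evaluable[OF assms(1,2)])
    from norm_summable_imp_has_sum[OF this summable_sums[OF summable_norm_cancel[OF this]]]
    have "((\<lambda>i. c (i,j) * x ^ i) has_sum eval_fps (fps_nth (to_ser c) j) x) UNIV"
      by (simp add: eval_fps_def)
    thus ?thesis by (intro infsumI has_sum_cmult_left)
  qed
  have "ps_eval c x y = infsum ?t (UNIV \<times> UNIV)" by (simp add: ps_eval_def)
  also have "\<dots> = infsum (\<lambda>(j,i). c (i,j) * x ^ i * y ^ j) (UNIV \<times> UNIV)"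
    by (rule infsum_reindex_bij_witness[of _ prod.swap prod.swap]) auto
  also have "\<dots> = (\<Sum>\<^sub>\<infinity>j. \<Sum>\<^sub>\<infinity>i. c (i,j) * x ^ i * y ^ j)"
    using infsum_Sigma'_banach[OF sm'] by simp
  also have "\<dots> = (\<Sum>\<^sub>\<infinity>j. eval_fps (fps_nth (to_ser c) j) x * y ^ j)" by (simp add: row)
  also have "\<dots> = ev (to_ser c) x y"
  proof -
    have "summable (\<lambda>j. norm (fps_nth (slice (to_ser c) x) j * y ^ j))"
      by (intro norm_summable_fps conv_on_slice_evaluable[OF assms])
    from norm_summable_imp_has_sum[OF this summable_sums[OF summable_norm_cancel[OF this]]]
    show ?thesis by (simp add: infsumI ev_def eval_fps_def[of "slice _ _"])
  qed
  finally show ?thesis .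
qed

text \<open>The Weierstrass M-test along the net of finite index sets makes the double series a
  uniform limit of polynomials, hence jointly continuous.\<close>

lemma continuous_on_ps_eval:
  assumes "conv_on \<rho> (to_ser c)"
  shows "continuous_on (cball 0 \<rho> \<times> cball 0 \<rho>) (\<lambda>(x,y). ps_eval c x y)"
proof -
  let ?Y = "cball 0 \<rho> \<times> cball 0 \<rho> :: (complex \<times> complex) set"
  have "uniform_limit ?Y (\<lambda>X z. \<Sum>ij\<in>X. (case ij of (i,j) \<Rightarrow> c (i,j) * fst z ^ i * snd z ^ j))
      (\<lambda>z. \<Sum>\<^sub>\<infinity>ij. (case ij of (i,j) \<Rightarrow> c (i,j) * fst z ^ i * snd z ^ j)) (finite_subsets_at_top UNIV)"
    by (rule Weierstrass_m_test_general[where M="\<lambda>(i,j). norm (c (i,j)) * \<rho> ^ (i + j)"])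
       (use assms ps_terms_bound[of _ \<rho> _ c] in \<open>auto simp: conv_on_iff_summable_on\<close>)
  hence "continuous_on ?Y (\<lambda>z. \<Sum>\<^sub>\<infinity>ij. (case ij of (i,j) \<Rightarrow> c (i,j) * fst z ^ i * snd z ^ j))"
    by (rule uniform_limit_theorem[rotated])
       (auto intro!: always_eventually continuous_intros simp: case_prod_unfold)
  thus ?thesis by (simp add: ps_eval_def case_prod_unfold)
qed

lemma continuous_on_ev:
  assumes "conv_on \<rho> f"
  shows "continuous_on (ball 0 \<rho> \<times> ball 0 \<rho>) (\<lambda>(x,y). ev f x y)"
proof -
  let ?c = "\<lambda>(i,j). cf f i j"
  have c: "conv_on \<rho> (to_ser ?c)" using assms by (simp add: to_ser_surj)
  have "continuous_on (ball 0 \<rho> \<times> ball 0 \<rho>) (\<lambda>(x,y). ps_eval ?c x y)"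
    by (rule continuous_on_subset[OF continuous_on_ps_eval[OF c]]) auto
  thus ?thesis
    by (rule continuous_on_cong[THEN iffD1, rotated -1])
       (use ps_eval_eq_ev[OF c] in \<open>auto simp: to_ser_surj\<close>)
qed

subsection \<open>Weierstrass division\<close>

text \<open>Weierstrass regularity in y: the series \<open>P(0, y)\<close> has a zero of order
  exactly M at 0.\<close>

definition regular :: "nat \<Rightarrow> ser \<Rightarrow> bool" where
  "regular M P \<longleftrightarrow> (\<forall>j<M. cf P 0 j = 0) \<and> cf P 0 M \<noteq> 0"

text \<open>Congruence modulo weight n, the topology in which the fixed point iteration for
  Weierstrass division converges. The weight is chosen so that one power of x counts more than M
  powers of y.\<close>

definition agree :: "nat \<Rightarrow> nat \<Rightarrow> ser \<Rightarrow> ser \<Rightarrow> bool" where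
  "agree M n f g \<longleftrightarrow> (\<forall>i j. (M + 1) * i + j < n \<longrightarrow> cf f i j = cf g i j)"

lemma agree_all_imp_eq: "(\<And>n. agree M n f g) \<Longrightarrow> f = g"
  unfolding agree_def by (rule ser_eqI) blast

lemma cf_shift: "cf (fps_shift M f) i j = cf f i (j + M)"
  by (simp add: fps_shift_def)

text \<open>With the weight \<open>(M+1) i + j\<close> on \<open>x^i y^j\<close>, multiplication by a series without
  the monomials \<open>y^j\<close>, \<open>j \<le> M\<close>, followed by division by \<open>y^M\<close> raises weights.\<close>
lemma agree_shift_mult:
  assumes E: "\<And>j. j \<le> M \<Longrightarrow> cf E 0 j = 0" and fg: "agree M n f g"
  shows "agree M (Suc n) (fps_shift M (f * E)) (fps_shift M (g * E))"
  unfolding agree_def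
proof (intro allI impI)
  fix i j assume ij: "(M + 1) * i + j < Suc n"
  show "cf (fps_shift M (f * E)) i j = cf (fps_shift M (g * E)) i j"
    unfolding cf_shift cf_mult
  proof (intro sum.cong refl)
    fix l k assume lk: "l \<in> {..j + M}" "k \<in> {..i}"
    show "cf f k l * cf E (i - k) (j + M - l) = cf g k l * cf E (i - k) (j + M - l)"
    proof (cases "k = i \<and> l \<ge> j")
      case True
      hence "j + M - l \<le> M" by linarith
      hence "cf E (i - k) (j + M - l) = 0" using E True by simp
      thus ?thesis by simp
    next
      case False
      \<comment> \<open>For k < i the drop in the x-index is worth at least M + 1, more than the M
        by which l may exceed j; for k = i the index l is below j.\<close>
      have "(M + 1) * k + l < n"
      proof (cases "k = i")
        case True thus ?thesis using False ij by auto
      next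
        case False
        hence "(M + 1) * (k + 1) \<le> (M + 1) * i" using lk by (intro mult_left_mono) auto
        thus ?thesis using ij lk by auto
      qed
      thus ?thesis using fg by (simp add: agree_def)
    qed
  qed
qed

lemma bnd_shift:
  assumes "bnd r s f C" "r > 0" "s > 0"
  shows "bnd r s (fps_shift M f) (C / s ^ M)"
  unfolding bnd_def
proof
  fix m
  have "sqsum r s (fps_shift M f) m * s ^ M = (\<Sum>j\<le>m. \<Sum>i\<le>m. norm (cf f i (j + M)) * r ^ i * s ^ (j + M))"
    unfolding sqsum_def by (simp add: sum_distrib_right power_add mult.assoc)
  also have "\<dots> = (\<Sum>j\<in>{M..m+M}. \<Sum>i\<le>m. norm (cf f i j) * r ^ i * s ^ j)"
    by (rule sum.reindex_bij_witness[of _ "\<lambda>j. j - M" "\<lambda>j. j + M"]) auto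
  also have "\<dots> \<le> (\<Sum>j\<in>{..m+M}. \<Sum>i\<le>m. norm (cf f i j) * r ^ i * s ^ j)"
    using assms by (intro sum_mono2) (auto intro!: sum_nonneg)
  also have "\<dots> \<le> sqsum r s f (m + M)"
    unfolding sqsum_def using assms by (intro sum_mono sum_mono2) auto
  also have "\<dots> \<le> C" using assms by (simp add: bnd_def)
  finally show "sqsum r s (fps_shift M f) m \<le> C / s ^ M"
    using assms by (simp add: field_simps)
qed

text \<open>Pure powers of y in E have degree at least M + 1, so they are o(s^M) for small s. Every
  other term contains x and is made small by r, chosen after s.\<close>

lemma bnd_small:
  assumes E: "\<And>j. j \<le> M \<Longrightarrow> cf E 0 j = 0" and b: "bnd \<rho> \<rho> E K" and "\<rho> > 0"
  obtains r s where "0 < r" "r \<le> \<rho>" "0 < s" "s \<le> \<rho>" "bnd r s E (s ^ M / 2)"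
proof -
  define K' where "K' = K + 1"
  have K': "K' > 0" "bnd \<rho> \<rho> E K'"
    using bnd_nonneg[OF b] \<open>\<rho> > 0\<close> bnd_mono[OF b, of \<rho> \<rho> K'] by (auto simp: K'_def)
  \<comment> \<open>The two choices give each kind of term a share of at most
    \<open>s ^ M / 4\<close>.\<close>
  define s where "s = min \<rho> (\<rho> ^ (M + 1) / (4 * K'))"
  define r where "r = min \<rho> (\<rho> * s ^ M / (4 * K'))"
  have s: "0 < s" "s \<le> \<rho>" "s \<le> \<rho> ^ (M + 1) / (4 * K')" using \<open>\<rho> > 0\<close> K' by (auto simp: s_def)
  have r: "0 < r" "r \<le> \<rho>" "r \<le> \<rho> * s ^ M / (4 * K')" using \<open>\<rho> > 0\<close> K' s by (auto simp: r_def)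
  define t where "t = (s / \<rho>) ^ (M + 1) + r / \<rho>"
  have term_le: "norm (cf E i j) * r ^ i * s ^ j \<le> t * (norm (cf E i j) * \<rho> ^ i * \<rho> ^ j)" for i j
  proof -
    have "r ^ i * s ^ j \<le> t * (\<rho> ^ i * \<rho> ^ j)" if nz: "cf E i j \<noteq> 0"
    proof (cases "i = 0")
      case True
      hence "j \<ge> M + 1" using E[of j] nz by (cases "j \<le> M") auto
      hence "(s / \<rho>) ^ j \<le> (s / \<rho>) ^ (M + 1)"
        using s \<open>\<rho> > 0\<close> by (intro power_decreasing) auto
      also have "\<dots> \<le> t" using r \<open>\<rho> > 0\<close> by (simp add: t_def)
      finally show ?thesis using True \<open>\<rho> > 0\<close> by (simp add: power_divide field_simps)
    next
      case False
      have "(r / \<rho>) ^ i \<le> (r / \<rho>) ^ 1"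
        using r \<open>\<rho> > 0\<close> False by (intro power_decreasing) auto
      moreover have "(s / \<rho>) ^ j \<le> 1"
        using s \<open>\<rho> > 0\<close> by (intro power_le_one) auto
      ultimately have "(r / \<rho>) ^ i * (s / \<rho>) ^ j \<le> r / \<rho> * 1"
        using r s \<open>\<rho> > 0\<close> by (intro mult_mono) auto
      also have "\<dots> \<le> t" using s \<open>\<rho> > 0\<close> by (simp add: t_def)
      finally show ?thesis using \<open>\<rho> > 0\<close> by (simp add: power_divide field_simps)
    qed
    from mult_left_mono[OF this, of "norm (cf E i j)"] show ?thesis
      by (cases "cf E i j = 0") (auto simp: algebra_simps)
  qed
  have tK: "t * K' \<le> s ^ M / 2"
  proof -
    have "(s / \<rho>) ^ (M + 1) * K' = s ^ M * (s * K' / \<rho> ^ (M + 1))"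
      by (simp add: power_divide)
    also have "\<dots> \<le> s ^ M * (1 / 4)"
      using s \<open>\<rho> > 0\<close> K' by (intro mult_left_mono) (auto simp: field_simps)
    finally have "(s / \<rho>) ^ (M + 1) * K' \<le> s ^ M / 4" by simp
    moreover have "r / \<rho> * K' \<le> s ^ M / 4"
      using r \<open>\<rho> > 0\<close> K' by (auto simp: field_simps)
    ultimately show ?thesis unfolding t_def distrib_right by linarith
  qed
  have "bnd r s E (s ^ M / 2)"
    unfolding bnd_def
  proof
    fix m
    have "sqsum r s E m \<le> t * sqsum \<rho> \<rho> E m"
      unfolding sqsum_def sum_distrib_left by (intro sum_mono term_le)
    also have "\<dots> \<le> t * K'"
      using K' r s \<open>\<rho> > 0\<close> by (intro mult_left_mono) (auto simp: bnd_def t_def)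
    finally show "sqsum r s E m \<le> s ^ M / 2" using tK by simp
  qed
  with r s show ?thesis by (intro that) auto
qed

text \<open>The quotient is the Neumann series of \<open>Q \<mapsto> (Q E)/y^M\<close>; its partial sums
  stabilise coefficientwise and stay bounded on a thin enough polydisc.\<close>
lemma shift_fixpoint_exists:
  assumes E: "E \<in> cser" "\<And>j. j \<le> M \<Longrightarrow> cf E 0 j = 0" and G: "G \<in> cser"
  obtains Q where "Q \<in> cser" "Q = G - fps_shift M (Q * E)"
proof -
  obtain \<rho> where \<rho>: "conv_on \<rho> E" "conv_on \<rho> G" using cser_conv_on2 E G by blast
  then obtain K where K: "bnd \<rho> \<rho> E K" "\<rho> > 0" by (auto simp: conv_on_def)
  obtain r s where rs: "0 < r" "r \<le> \<rho>" "0 < s" "s \<le> \<rho>" "bnd r s E (s ^ M / 2)"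
    using bnd_small[OF E(2) K] by blast
  obtain D0 where "bnd \<rho> \<rho> G D0" using \<rho> by (auto simp: conv_on_def)
  then obtain D where D: "bnd r s G D" using rs bnd_mono[of \<rho> \<rho> G D0 r s] by force
  have D0: "D \<ge> 0" using bnd_nonneg[OF D] rs by simp
  define T where "T Q = fps_shift M (Q * E)" for Q
  define S where "S n = ((\<lambda>Q. G - T Q) ^^ n) 0" for n
  have S: "S 0 = 0" "S (Suc n) = G - T (S n)" for n by (simp_all add: S_def)
  \<comment> \<open>The bound \<open>2 * D\<close> reproduces itself: multiplication by E and
    division by \<open>y ^ M\<close> halve it, and adding G contributes D.\<close>
  have bS: "bnd r s (S n) (2 * D)" for n
  proof (induction n)
    case 0 thus ?case using D0 by (simp add: S bnd_def sqsum_def)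
  next
    case (Suc n)
    have "bnd r s (S n * E) (2 * D * (s ^ M / 2))"
      using rs by (intro bnd_mult Suc) auto
    hence "bnd r s (T (S n)) (2 * D * (s ^ M / 2) / s ^ M)"
      unfolding T_def using rs by (intro bnd_shift) auto
    hence "bnd r s (G + - T (S n)) (D + 2 * D * (s ^ M / 2) / s ^ M)"
      using rs by (intro bnd_add bnd_uminus D) auto
    thus ?case using rs by (simp add: S)
  qed
  have T_agree: "agree M n f g \<Longrightarrow> agree M (Suc n) (T f) (T g)" for n f g
    unfolding T_def using E by (intro agree_shift_mult)
  have step: "agree M n (S n) (S (Suc n))" for n
  proof (induction n)
    case 0 thus ?case by (simp add: agree_def)
  next
    case (Suc n)
    thus ?case using T_agree[OF Suc] by (simp add: S(2) agree_def)
  qed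
  have later: "agree M n (S n) (S (n + k))" for n k
  proof (induction k)
    case 0 thus ?case by (simp add: agree_def)
  next
    case (Suc k)
    thus ?case using step[of "n + k"] by (simp add: agree_def)
  qed
  \<comment> \<open>A coefficient of weight n no longer changes from the iterate
    \<open>n + 1\<close> on, hence the \<open>Suc\<close>.\<close>
  define Q where "Q = to_ser (\<lambda>(i,j). cf (S (Suc ((M + 1) * i + j))) i j)"
  have Q: "agree M n Q (S n)" for n
    unfolding agree_def
  proof (intro allI impI)
    fix i j assume "(M + 1) * i + j < n"
    then obtain k where "n = Suc ((M + 1) * i + j) + k" using less_iff_Suc_add by auto
    thus "cf Q i j = cf (S n) i j"
      using later[of "Suc ((M + 1) * i + j)" k] by (simp add: Q_def agree_def)
  qed
  have "Q = G - T Q"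
  proof (rule agree_all_imp_eq)
    fix n
    have "agree M (Suc n) (G - T Q) (S (Suc n))"
      using T_agree[OF Q[of n]] by (simp add: S(2) agree_def)
    thus "agree M n Q (G - T Q)" using Q[of "Suc n"] by (simp add: agree_def)
  qed
  moreover have "bnd r s Q (2 * D)"
    unfolding bnd_def
  proof
    fix m
    \<comment> \<open>The corner (m, m) has the largest weight in the square, so a single iterate
      agrees with Q on all of it.\<close>
    have "sqsum r s Q m = sqsum r s (S (Suc ((M + 1) * m + m))) m"
    proof -
      have "cf Q i j = cf (S (Suc ((M + 1) * m + m))) i j" if "i \<le> m" "j \<le> m" for i j
      proof -
        have "(M + 1) * i + j < Suc ((M + 1) * m + m)"
          using that by (simp add: less_Suc_eq_le add_mono mult_le_mono)
        thus ?thesis using Q[of "Suc ((M + 1) * m + m)"] unfolding agree_def by blast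
      qed
      thus ?thesis unfolding sqsum_def by (intro sum.cong refl) auto
    qed
    thus "sqsum r s Q m \<le> 2 * D" using bS unfolding bnd_def by metis
  qed
  hence "conv_on (min r s) Q"
    unfolding conv_on_def using rs bnd_mono[of r s Q "2 * D" "min r s" "min r s" "2 * D"]
    by (intro conjI exI[of _ "2 * D"]) auto
  ultimately show ?thesis using that unfolding T_def cser_def by blast
qed

abbreviation cc :: "complex \<Rightarrow> ser" where
  "cc c \<equiv> xser (fps_const c)"

lemma cser_cc [simp]: "cc c \<in> cser"
  by (rule cser_xser) simp

lemma fps_shift_cser: "f \<in> cser \<Longrightarrow> fps_shift M f \<in> cser"
  unfolding cser_def conv_on_def using bnd_shift by blast

text \<open>Up to the constant u the series P is \<open>y ^ M + E\<close>, and division by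
  \<open>y ^ M\<close> returns Q itself from the first summand. Thus an equation for the part of
  \<open>Q * P\<close> of y-degree at least M becomes a fixed point equation for Q.\<close>

lemma shift_mult_regular:
  fixes P Q :: ser
  assumes "regular M P"
  defines "u \<equiv> cf P 0 M"
  defines "E \<equiv> cc (1 / u) * P - yvar ^ M"
  shows "fps_shift M (Q * P) = cc u * (Q + fps_shift M (Q * E))"
    and "j \<le> M \<Longrightarrow> cf E 0 j = 0"
proof -
  have u: "u \<noteq> 0" using assms by (simp add: regular_def)
  hence uu: "cc u * cc (1 / u) = 1"
    by simp
  have "Q * P = cc u * (Q * E) + cc u * (Q * yvar ^ M)"
  proof -
    have "cc u * (Q * E) + cc u * (Q * yvar ^ M) = (cc u * cc (1 / u)) * (Q * P)"
      unfolding E_def by (simp add: algebra_simps del: fps_const_mult)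
    thus ?thesis by (simp only: uu mult_1)
  qed
  hence "fps_shift M (Q * P) = fps_shift M (cc u * (Q * E)) + fps_shift M (cc u * (Q * yvar ^ M))"
    by (simp add: fps_shift_add)
  also have "fps_shift M (cc u * (Q * yvar ^ M)) = cc u * Q"
    by (rule fps_ext) (simp add: mult.assoc[symmetric] fps_X_power_mult_right_nth)
  also have "fps_shift M (cc u * (Q * E)) = cc u * fps_shift M (Q * E)"
    by (rule fps_ext) simp
  finally show "fps_shift M (Q * P) = cc u * (Q + fps_shift M (Q * E))"
    by (simp add: algebra_simps)
  show "cf E 0 j = 0" if "j \<le> M"
    using that assms(1) u by (cases "j = M") (auto simp: E_def regular_def u_def)
qed

text \<open>The remainder has y-degree below M exactly when F and \<open>Q * P\<close> agree after
  \<open>fps_shift M\<close>; solved for Q this is the fixed point equation of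
  \<open>shift_fixpoint_exists\<close>.\<close>

theorem weierstrass_division:
  assumes P: "P \<in> cser" "regular M P" and F: "F \<in> cser"
  obtains Q where "Q \<in> cser" "\<And>j. j \<ge> M \<Longrightarrow> fps_nth (F - Q * P) j = 0"
proof -
  define u where "u = cf P 0 M"
  define E where "E = cc (1 / u) * P - yvar ^ M"
  have u: "u \<noteq> 0" using P by (simp add: regular_def u_def)
  have Ec: "E \<in> cser" unfolding E_def using P by (intro cser_diff cser_mult cser_power) auto
  obtain Q where Q: "Q \<in> cser" "Q = cc (1 / u) * fps_shift M F - fps_shift M (Q * E)"
  proof (rule shift_fixpoint_exists[OF Ec])
    show "cf E 0 j = 0" if "j \<le> M" for j
      unfolding E_def u_def by (rule shift_mult_regular(2)[OF P(2) that])
    show "cc (1 / u) * fps_shift M F \<in> cser" using F by (intro cser_mult fps_shift_cser) auto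
  qed
  have "fps_shift M (Q * P) = cc u * (Q + fps_shift M (Q * E))"
    unfolding E_def u_def by (rule shift_mult_regular(1)[OF P(2)])
  also have "Q + fps_shift M (Q * E) = cc (1 / u) * fps_shift M F"
    using Q(2) by (simp add: algebra_simps)
  also have "cc u * \<dots> = fps_shift M F"
    using u by (simp add: mult.assoc[symmetric])
  finally have eq: "fps_shift M (Q * P) = fps_shift M F" .
  have "fps_nth (F - Q * P) j = 0" if "j \<ge> M" for j
    using arg_cong[OF eq, of "\<lambda>f. fps_nth f (j - M)"] that by simp
  thus ?thesis using Q that by blast
qed

text \<open>Q satisfies the homogeneous fixed point equation, whose right-hand side raises weights;
  so Q agrees with 0 up to every weight.\<close>

theorem weierstrass_division_unique:
  assumes P: "regular M P" and Q: "\<And>j. j \<ge> M \<Longrightarrow> fps_nth (Q * P) j = 0"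
  shows "Q = 0"
proof -
  define u where "u = cf P 0 M"
  define E where "E = cc (1 / u) * P - yvar ^ M"
  have u: "u \<noteq> 0" using P by (simp add: regular_def u_def)
  have "cc u * (Q + fps_shift M (Q * E)) = fps_shift M (Q * P)"
    unfolding E_def u_def by (rule shift_mult_regular(1)[OF P, symmetric])
  also have "\<dots> = 0" by (rule fps_ext) (simp add: Q)
  finally have "Q + fps_shift M (Q * E) = 0" using u by (simp add: fps_const_eq_0_iff)
  hence eq: "Q = - fps_shift M (Q * E)" by (simp add: eq_neg_iff_add_eq_0)
  have "agree M n Q 0" for n
  proof (induction n)
    case 0 thus ?case by (simp add: agree_def)
  next
    case (Suc n)
    have "agree M (Suc n) (fps_shift M (Q * E)) (fps_shift M (0 * E))"
      unfolding E_def u_def using Suc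
      by (intro agree_shift_mult shift_mult_regular(2)[OF P]) auto
    hence "cf (- fps_shift M (Q * E)) i j = 0" if "(M + 1) * i + j < Suc n" for i j
      using that by (simp add: agree_def)
    thus ?case by (subst eq) (simp add: agree_def)
  qed
  thus ?thesis by (rule agree_all_imp_eq)
qed

text \<open>A series with nonzero constant term is regular of order 0, and division of 1 by it
  leaves no remainder.\<close>

lemma cser_unit:
  assumes "U \<in> cser" "cf U 0 0 \<noteq> 0"
  obtains V where "V \<in> cser" "V * U = 1"
proof -
  obtain V where "V \<in> cser" "\<And>j. j \<ge> 0 \<Longrightarrow> fps_nth (1 - V * U) j = 0"
    using weierstrass_division[of U 0 1] assms by (auto simp: regular_def)
  moreover from this(2) have "1 - V * U = 0" by (intro fps_ext) simp
  ultimately show ?thesis using that by simp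
qed

definition weierstrass_poly :: "nat \<Rightarrow> ser \<Rightarrow> bool" where
  "weierstrass_poly M W \<longleftrightarrow> W \<in> cser \<and> fps_nth W M = 1 \<and> (\<forall>j>M. fps_nth W j = 0) \<and> (\<forall>j<M. cf W 0 j = 0)"

lemma weierstrass_poly_regular: "weierstrass_poly M W \<Longrightarrow> regular M W"
  by (simp add: weierstrass_poly_def regular_def)

text \<open>The quotient U of \<open>y ^ M\<close> by P works: \<open>U * P\<close> is
  \<open>y ^ M\<close> minus a remainder of smaller degree, and comparing the coefficients of
  \<open>y ^ M\<close> at x = 0 shows that U is a unit.\<close>

theorem weierstrass_preparation:
  assumes P: "P \<in> cser" "regular M P"
  obtains U where "U \<in> cser" "cf U 0 0 \<noteq> 0" "weierstrass_poly M (U * P)"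
proof -
  obtain U where U: "U \<in> cser" "\<And>j. j \<ge> M \<Longrightarrow> fps_nth (yvar ^ M - U * P) j = 0"
    using weierstrass_division[OF P cser_power[OF cser_yvar]] by blast
  have one: "fps_nth (U * P) M = 1" using U(2)[of M] by simp
  have conv: "cf (U * P) 0 j = (\<Sum>l\<le>j. cf U 0 l * cf P 0 (j - l))" for j
    by (simp add: cf_mult)
  have "cf (U * P) 0 M = (\<Sum>l\<le>M. if l = 0 then cf U 0 0 * cf P 0 M else 0)"
    unfolding conv using P(2) by (intro sum.cong refl) (auto simp: regular_def)
  hence "cf U 0 0 \<noteq> 0" using one by auto
  moreover have "weierstrass_poly M (U * P)"
    unfolding weierstrass_poly_def
  proof (intro conjI allI impI)
    show "U * P \<in> cser" using U P by (intro cser_mult)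
    show "fps_nth (U * P) j = 0" if "j > M" for j using U(2)[of j] that by simp
    show "cf (U * P) 0 j = 0" if "j < M" for j
      unfolding conv using that P(2) by (intro sum.neutral) (auto simp: regular_def)
  qed (fact one)
  ultimately show ?thesis using that U by blast
qed

subsection \<open>Codimension\<close>

definition subsp :: "ser set \<Rightarrow> bool" where
  "subsp V \<longleftrightarrow> 0 \<in> V \<and> (\<forall>a\<in>V. \<forall>b\<in>V. a + b \<in> V) \<and> (\<forall>c. \<forall>a\<in>V. cc c * a \<in> V)"

definition lc :: "nat \<Rightarrow> (nat \<Rightarrow> complex) \<Rightarrow> (nat \<Rightarrow> ser) \<Rightarrow> ser" where
  "lc n a e = (\<Sum>i<n. cc (a i) * e i)"

definition indep_seq :: "nat \<Rightarrow> (nat \<Rightarrow> ser) \<Rightarrow> ser set \<Rightarrow> bool" where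
  "indep_seq n e W \<longleftrightarrow> (\<forall>a. lc n a e \<in> W \<longrightarrow> (\<forall>i<n. a i = 0))"

text \<open>The dimension of V/W, witnessed by representatives of a basis. As a relation with a
  natural number it includes the finiteness of the quotient.\<close>

definition codim :: "ser set \<Rightarrow> ser set \<Rightarrow> nat \<Rightarrow> bool" where
  "codim V W n \<longleftrightarrow> (\<exists>e. (\<forall>i<n. e i \<in> V) \<and> (\<forall>v\<in>V. \<exists>a. v - lc n a e \<in> W) \<and> indep_seq n e W)"

lemma cc_cancel:
  assumes "a \<noteq> 0"
  shows "cc (1 / a) * (cc a * e) = e"
proof -
  have "cc (1 / a) * cc a = 1" using assms by simp
  thus ?thesis by (metis mult.assoc mult_1)
qed

lemma cc_uminus: "cc (- a) * e = - (cc a * e)"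
proof -
  have "cc (- a) = - cc a" by simp
  thus ?thesis by (simp only: mult_minus_left)
qed

lemma subsp_uminus: "subsp V \<Longrightarrow> a \<in> V \<Longrightarrow> - a \<in> V"
proof -
  assume "subsp V" "a \<in> V"
  hence "cc (-1) * a \<in> V" unfolding subsp_def by blast
  moreover have "cc (-1) * a = - a" unfolding cc_uminus by simp
  ultimately show ?thesis by simp
qed

lemma subsp_add: "subsp V \<Longrightarrow> a \<in> V \<Longrightarrow> b \<in> V \<Longrightarrow> a + b \<in> V"
  by (simp add: subsp_def)

lemma subsp_diff: "subsp V \<Longrightarrow> a \<in> V \<Longrightarrow> b \<in> V \<Longrightarrow> a - b \<in> V"
  using subsp_add[of V a "- b"] subsp_uminus[of V b] by simp

lemma subsp_scale: "subsp V \<Longrightarrow> a \<in> V \<Longrightarrow> cc c * a \<in> V"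
  by (simp add: subsp_def)

lemma subsp_sum: "subsp V \<Longrightarrow> (\<And>i. i \<in> I \<Longrightarrow> f i \<in> V) \<Longrightarrow> (\<Sum>i\<in>I. f i) \<in> V"
  by (induction I rule: infinite_finite_induct) (auto simp: subsp_def)

lemma subsp_lc: "subsp V \<Longrightarrow> (\<And>i. i < n \<Longrightarrow> e i \<in> V) \<Longrightarrow> lc n a e \<in> V"
  unfolding lc_def by (intro subsp_sum subsp_scale) auto

lemma subsp_cser: "subsp cser"
  by (auto simp: subsp_def intro: cser_add cser_mult)

lemma lc_mult: "lc n a (\<lambda>i. D * e i) = D * lc n a e"
  by (simp add: lc_def sum_distrib_left algebra_simps)

lemma lc_scale: "cc c * lc n a e = lc n (\<lambda>i. c * a i) e"
  unfolding lc_def sum_distrib_left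
proof (intro sum.cong refl)
  fix i
  have "cc c * cc (a i) = cc (c * a i)" by simp
  thus "cc c * (cc (a i) * e i) = cc (c * a i) * e i" by (metis mult.assoc)
qed

lemma lc_uminus: "lc n (\<lambda>i. - a i) e = - lc n a e"
  unfolding lc_def cc_uminus sum_negf ..

lemma codim_0: "V \<subseteq> W \<Longrightarrow> codim V W 0"
  by (auto simp: codim_def indep_seq_def lc_def)

lemma codim_1:
  assumes "subsp W" "e \<in> V" "e \<notin> W" "\<And>v. v \<in> V \<Longrightarrow> \<exists>c. v - cc c * e \<in> W"
  shows "codim V W 1"
  unfolding codim_def
proof (intro exI[of _ "\<lambda>_. e"] conjI ballI)
  show "\<exists>a. v - lc 1 a (\<lambda>_. e) \<in> W" if v: "v \<in> V" for v
  proof -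
    obtain c where "v - cc c * e \<in> W" using assms(4)[OF v] by blast
    thus ?thesis by (intro exI[of _ "\<lambda>_. c"]) (simp add: lc_def)
  qed
  have "a = 0" if a: "cc a * e \<in> W" for a
  proof (rule ccontr)
    assume "a \<noteq> 0"
    from cc_cancel[OF this, of e] show False using subsp_scale[OF assms(1) a, of "1 / a"] assms(3) by metis
  qed
  thus "indep_seq 1 (\<lambda>_. e) W" by (simp add: indep_seq_def lc_def)
qed (use assms in auto)

lemma lc_append:
  "lc (m + n) a (\<lambda>i. if i < m then u i else v (i - m)) = lc m a u + lc n (\<lambda>i. a (m + i)) v"
proof (induction n)
  case 0 thus ?case by (simp add: lc_def)
next
  case (Suc n) thus ?case by (simp add: lc_def add.assoc)
qed

text \<open>A basis of U modulo V followed by a basis of V modulo W is a basis of U modulo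
  W.\<close>

lemma codim_trans:
  assumes UV: "codim U V m" and VW: "codim V W n"
    and sub: "subsp V" "subsp W" "W \<subseteq> V" "V \<subseteq> U"
  shows "codim U W (m + n)"
proof -
  obtain u where u: "\<And>i. i < m \<Longrightarrow> u i \<in> U" "\<And>x. x \<in> U \<Longrightarrow> \<exists>a. x - lc m a u \<in> V" "indep_seq m u V"
    using UV unfolding codim_def by blast
  obtain v where v: "\<And>i. i < n \<Longrightarrow> v i \<in> V" "\<And>x. x \<in> V \<Longrightarrow> \<exists>a. x - lc n a v \<in> W" "indep_seq n v W"
    using VW unfolding codim_def by blast
  let ?e = "\<lambda>i. if i < m then u i else v (i - m)"
  show ?thesis unfolding codim_def
  proof (intro exI[of _ ?e] conjI ballI allI impI)
    show "?e i \<in> U" if "i < m + n" for i using that u v sub by auto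
    show "\<exists>a. x - lc (m + n) a ?e \<in> W" if x: "x \<in> U" for x
    proof -
      obtain a where a: "x - lc m a u \<in> V" using u(2)[OF x] by blast
      obtain b where b: "x - lc m a u - lc n b v \<in> W" using v(2)[OF a] by blast
      let ?c = "\<lambda>i. if i < m then a i else b (i - m)"
      have "lc m ?c u = lc m a u" "lc n (\<lambda>i. ?c (m + i)) v = lc n b v" by (simp_all add: lc_def)
      thus ?thesis using b by (intro exI[of _ ?c]) (simp add: lc_append diff_diff_eq)
    qed
    show "indep_seq (m + n) ?e W"
      unfolding indep_seq_def
    proof (intro allI impI)
      fix a i assume a: "lc (m + n) a ?e \<in> W" and i: "i < m + n"
      have V2: "lc n (\<lambda>i. a (m + i)) v \<in> V" using v sub by (intro subsp_lc) auto
      have "lc m a u + lc n (\<lambda>i. a (m + i)) v \<in> V" using a sub by (auto simp: lc_append)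
      from subsp_diff[OF sub(1) this V2] have "lc m a u \<in> V" by simp
      hence z: "\<And>i. i < m \<Longrightarrow> a i = 0" using u(3) by (auto simp: indep_seq_def)
      hence "lc m a u = 0" by (simp add: lc_def)
      hence "lc n (\<lambda>i. a (m + i)) v \<in> W" using a by (simp add: lc_append)
      hence z2: "\<And>i. i < n \<Longrightarrow> a (m + i) = 0" using v(3) unfolding indep_seq_def by blast
      show "a i = 0" using z z2[of "i - m"] i by (cases "i < m") auto
    qed
  qed
qed

text \<open>Multiplication by D induces an isomorphism from V/W onto V'/W': of the last three
  assumptions the first is surjectivity, the second injectivity, and the third says that the map is
  well defined. It serves with D = 1 to pass to remainders and with \<open>D = y - cb n\<close> to
  remove a factor.\<close>

lemma codim_map:
  assumes "codim V W n" "subsp V" "subsp W'"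
    and "\<And>v. v \<in> V \<Longrightarrow> D * v \<in> V'"
    and "\<And>v'. v' \<in> V' \<Longrightarrow> \<exists>v\<in>V. v' - D * v \<in> W'"
    and "\<And>v. v \<in> V \<Longrightarrow> D * v \<in> W' \<Longrightarrow> v \<in> W"
    and "\<And>w. w \<in> W \<Longrightarrow> D * w \<in> W'"
  shows "codim V' W' n"
proof -
  obtain e where e: "\<And>i. i < n \<Longrightarrow> e i \<in> V" "\<And>x. x \<in> V \<Longrightarrow> \<exists>a. x - lc n a e \<in> W" "indep_seq n e W"
    using assms(1) unfolding codim_def by blast
  show ?thesis unfolding codim_def
  proof (intro exI[of _ "\<lambda>i. D * e i"] conjI ballI allI impI)
    show "D * e i \<in> V'" if "i < n" for i using that e assms by blast
    show "\<exists>a. x - lc n a (\<lambda>i. D * e i) \<in> W'" if x: "x \<in> V'" for x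
    proof -
      obtain v where v: "v \<in> V" "x - D * v \<in> W'" using assms(5)[OF x] by blast
      obtain a where "v - lc n a e \<in> W" using e(2)[OF v(1)] by blast
      from subsp_add[OF assms(3) v(2) assms(7)[OF this]]
      have "x - lc n a (\<lambda>i. D * e i) \<in> W'" by (simp add: lc_mult algebra_simps)
      thus ?thesis by blast
    qed
    have "lc n a e \<in> W" if "lc n a (\<lambda>i. D * e i) \<in> W'" for a
      using assms(6)[OF subsp_lc[OF assms(2) e(1)]] that by (simp add: lc_mult)
    thus "indep_seq n (\<lambda>i. D * e i) W'" using e(3) unfolding indep_seq_def by blast
  qed
qed

text \<open>Gaussian elimination, by induction on the number of equations: a pivot p of the last
  equation removes one equation and one unknown.\<close>

lemma homogeneous_system_nontrivial:
  fixes \<alpha> :: "nat \<Rightarrow> nat \<Rightarrow> complex"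
  assumes "finite I" "card I > N"
  shows "\<exists>c. (\<exists>i\<in>I. c i \<noteq> 0) \<and> (\<forall>k<N. (\<Sum>i\<in>I. c i * \<alpha> i k) = 0)"
  using assms
proof (induction N arbitrary: I \<alpha>)
  case 0
  hence "I \<noteq> {}" by auto
  thus ?case by (intro exI[of _ "\<lambda>_. 1"]) auto
next
  case (Suc N)
  show ?case
  proof (cases "\<forall>i\<in>I. \<alpha> i N = 0")
    case True
    obtain c where "\<exists>i\<in>I. c i \<noteq> 0" "\<forall>k<N. (\<Sum>i\<in>I. c i * \<alpha> i k) = 0"
      using Suc.IH[of I \<alpha>] Suc.prems by auto
    thus ?thesis using True by (intro exI[of _ c]) (auto simp: less_Suc_eq)
  next
    case False
    then obtain p where p: "p \<in> I" "\<alpha> p N \<noteq> 0" by blast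
    define \<beta> where "\<beta> i k = \<alpha> i k - \<alpha> i N / \<alpha> p N * \<alpha> p k" for i k
    have "card (I - {p}) > N" using Suc.prems p by simp
    then obtain c where c: "\<exists>i\<in>I - {p}. c i \<noteq> 0" "\<And>k. k < N \<Longrightarrow> (\<Sum>i\<in>I - {p}. c i * \<beta> i k) = 0"
      using Suc.IH[of "I - {p}" \<beta>] Suc.prems by auto
    \<comment> \<open>The value at p is forced by equation N; inserting it into the other equations
      turns \<alpha> into \<beta>.\<close>
    define d where "d i = (if i = p then - (\<Sum>i\<in>I - {p}. c i * \<alpha> i N) / \<alpha> p N else c i)" for i
    have "(\<Sum>i\<in>I. d i * \<alpha> i k) = 0" if "k < Suc N" for k
    proof -
      have "(\<Sum>i\<in>I. d i * \<alpha> i k) = d p * \<alpha> p k + (\<Sum>i\<in>I - {p}. c i * \<alpha> i k)"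
        using p Suc.prems by (subst sum.remove[of _ p]) (auto simp: d_def intro!: sum.cong)
      also have "d p * \<alpha> p k = - (\<Sum>i\<in>I - {p}. c i * (\<alpha> i N / \<alpha> p N * \<alpha> p k))"
        by (simp add: d_def sum_distrib_right sum_divide_distrib mult.assoc)
      also have "\<dots> + (\<Sum>i\<in>I - {p}. c i * \<alpha> i k) = (\<Sum>i\<in>I - {p}. c i * \<beta> i k)"
        by (simp add: \<beta>_def algebra_simps sum_subtractf)
      also have "\<dots> = 0"
      proof (cases "k = N")
        case True
        hence "\<beta> i k = 0" for i using p by (simp add: \<beta>_def)
        thus ?thesis by simp
      qed (use c that in auto)
      finally show ?thesis .
    qed
    moreover have "\<exists>i\<in>I. d i \<noteq> 0" using c(1) by (auto simp: d_def)
    ultimately show ?thesis by blast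
  qed
qed

text \<open>Expanding each \<open>f i\<close> in the N basis elements gives N equations in n
  unknowns; for n > N a nontrivial solution would be a relation modulo W.\<close>

lemma indep_seq_bound:
  assumes "codim U W N" "subsp W" "indep_seq n f W" "\<And>i. i < n \<Longrightarrow> f i \<in> U"
  shows "n \<le> N"
proof (rule ccontr)
  assume "\<not> n \<le> N"
  obtain e where e: "\<And>x. x \<in> U \<Longrightarrow> \<exists>a. x - lc N a e \<in> W"
    using assms(1) unfolding codim_def by blast
  have "\<forall>i. \<exists>a. i < n \<longrightarrow> f i - lc N a e \<in> W" using e assms(4) by blast
  then obtain \<alpha> where \<alpha>: "\<And>i. i < n \<Longrightarrow> f i - lc N (\<alpha> i) e \<in> W" by metis
  obtain c where c: "\<exists>i\<in>{..<n}. c i \<noteq> 0" "\<And>k. k < N \<Longrightarrow> (\<Sum>i<n. c i * \<alpha> i k) = 0"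
    using homogeneous_system_nontrivial[of "{..<n}" N \<alpha>] \<open>\<not> n \<le> N\<close> by auto
  have "(\<Sum>i<n. cc (c i) * (f i - lc N (\<alpha> i) e)) \<in> W"
    using \<alpha> assms(2) by (intro subsp_sum subsp_scale) auto
  also have "(\<Sum>i<n. cc (c i) * (f i - lc N (\<alpha> i) e)) = lc n c f - (\<Sum>i<n. cc (c i) * lc N (\<alpha> i) e)"
    by (simp add: lc_def right_diff_distrib sum_subtractf)
  also have "(\<Sum>i<n. cc (c i) * lc N (\<alpha> i) e) = (\<Sum>k<N. \<Sum>i<n. cc (c i * \<alpha> i k) * e k)"
    unfolding lc_scale unfolding lc_def by (rule sum.swap)
  also have "\<dots> = (\<Sum>k<N. cc (\<Sum>i<n. c i * \<alpha> i k) * e k)"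
  proof -
    have cs: "(\<Sum>i\<in>I. cc (g i)) = cc (\<Sum>i\<in>I. g i)" for g :: "nat \<Rightarrow> complex" and I
      by (induction I rule: infinite_finite_induct) auto
    show ?thesis by (simp only: sum_distrib_right[symmetric] cs)
  qed
  also have "\<dots> = 0" using c(2) by (intro sum.neutral) simp
  finally have "lc n c f \<in> W" by simp
  thus False using c(1) assms(3) unfolding indep_seq_def by auto
qed

lemma codim_unique:
  assumes "codim V W m" "codim V W n" "subsp W"
  shows "m = n"
proof (rule antisym)
  show "m \<le> n" using assms(1) indep_seq_bound[OF assms(2,3), of m] unfolding codim_def by blast
  show "n \<le> m" using assms(2) indep_seq_bound[OF assms(1,3), of n] unfolding codim_def by blast
qed

text \<open>The lengths of families in V that are independent modulo W are bounded by N, and a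
  family of maximal length spans V modulo W.\<close>

lemma codim_subspace_exists:
  assumes "codim U W N" "subsp V" "subsp W" "V \<subseteq> U"
  obtains n where "codim V W n"
proof -
  define P where "P n \<longleftrightarrow> (\<exists>e. (\<forall>i<n. e i \<in> V) \<and> indep_seq n e W)" for n
  have P0: "P 0" by (simp add: P_def indep_seq_def)
  have bd: "n \<le> N" if "P n" for n
    using that indep_seq_bound[OF assms(1,3)] assms(4) unfolding P_def by blast
  obtain n where n: "P n" "\<And>k. P k \<Longrightarrow> k \<le> n"
    using GreatestI_nat[of P 0 N] Greatest_le_nat[of P _ N] P0 bd by metis
  obtain e where e: "\<forall>i<n. e i \<in> V" "indep_seq n e W" using n(1) unfolding P_def by blast
  have "\<exists>a. v - lc n a e \<in> W" if v: "v \<in> V" for v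
  proof -
    let ?e = "\<lambda>i. if i < n then e i else v"
    have eV: "\<forall>i<Suc n. ?e i \<in> V" using e v by auto
    have "\<not> indep_seq (Suc n) ?e W"
    proof
      assume "indep_seq (Suc n) ?e W"
      hence "P (Suc n)" unfolding P_def by (intro exI[of _ ?e] conjI eV)
      thus False using n(2)[of "Suc n"] by simp
    qed
    then obtain a k where a: "lc (Suc n) a ?e \<in> W" "k < Suc n" "a k \<noteq> 0"
      unfolding indep_seq_def not_all not_imp by (elim exE conjE) (rule that)
    have eq: "lc (Suc n) a ?e = lc n a e + cc (a n) * v" by (simp add: lc_def)
    have "a n \<noteq> 0"
    proof
      assume "a n = 0"
      hence "lc n a e \<in> W" using a(1) eq by simp
      hence "\<forall>i<n. a i = 0" using e(2) by (simp add: indep_seq_def)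
      thus False using a(2,3) \<open>a n = 0\<close> by (auto simp: less_Suc_eq)
    qed
    have "cc (1 / a n) * (lc n a e + cc (a n) * v) \<in> W"
      using a(1) eq assms(3) by (simp add: subsp_scale)
    also have "cc (1 / a n) * (lc n a e + cc (a n) * v) = v - lc n (\<lambda>i. - (1 / a n * a i)) e"
      unfolding distrib_left cc_cancel[OF \<open>a n \<noteq> 0\<close>] lc_scale lc_uminus by (simp only: diff_minus_eq_add add.commute)
    finally show ?thesis by blast
  qed
  hence "codim V W n" unfolding codim_def using e by blast
  thus ?thesis by (rule that)
qed

section \<open>From sequences of series to finite sets of coefficient functions\<close>

lemma to_ser_lincomb:
  assumes "bij_betw f {..<n} S"
  shows "to_ser (\<lambda>ij. \<Sum>s\<in>S. a s * s ij) = lc n (\<lambda>i. a (f i)) (\<lambda>i. to_ser (f i))"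
proof (rule ser_eqI)
  fix i j
  have "(\<Sum>s\<in>S. a s * s (i,j)) = (\<Sum>k<n. a (f k) * f k (i,j))"
    by (rule sum.reindex_bij_betw[OF assms, symmetric])
  thus "cf (to_ser (\<lambda>ij. \<Sum>s\<in>S. a s * s ij)) i j = cf (lc n (\<lambda>i. a (f i)) (\<lambda>i. to_ser (f i))) i j"
    by (simp add: lc_def fps_sum_nth)
qed

text \<open>The supremum over independent finite sets is bounded by n through
  \<open>indep_seq_bound\<close> and attained at the set of basis representatives.\<close>

theorem quot_dim_eq_codim:
  assumes "codim (to_ser ` V) (to_ser ` W) n" "subsp (to_ser ` W)"
  shows "quot_dim V W = enat n"
proof -
  have mem: "to_ser c \<in> to_ser ` X \<longleftrightarrow> c \<in> X" for c X by (auto simp: image_iff)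
  have ub: "card S \<le> n" if S: "finite S" "S \<subseteq> V" "indep_mod S W" for S
  proof -
    obtain f where f: "bij_betw f {..<card S} S"
      using ex_bij_betw_nat_finite[OF S(1)] by (auto simp: atLeast0LessThan)
    have "indep_seq (card S) (\<lambda>i. to_ser (f i)) (to_ser ` W)"
      unfolding indep_seq_def
    proof (intro allI impI)
      fix a i assume a: "lc (card S) a (\<lambda>i. to_ser (f i)) \<in> to_ser ` W" and i: "i < card S"
      define b where "b s = a (the_inv_into {..<card S} f s)" for s
      have b: "b (f i) = a i" if "i < card S" for i
        using f that by (simp add: b_def the_inv_into_f_f bij_betw_def)
      have "to_ser (\<lambda>ij. \<Sum>s\<in>S. b s * s ij) \<in> to_ser ` W"
        using a b by (subst to_ser_lincomb[OF f]) (simp add: lc_def)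
      hence "\<forall>s\<in>S. b s = 0" using S(3) by (simp add: mem indep_mod_def)
      moreover have "f i \<in> S" using f i by (auto simp: bij_betw_def)
      ultimately show "a i = 0" using b[OF i] by metis
    qed
    thus ?thesis
    proof (rule indep_seq_bound[OF assms])
      show "to_ser (f i) \<in> to_ser ` V" if "i < card S" for i
        using f that S(2) by (auto simp: bij_betw_def)
    qed
  qed
  obtain e where e: "\<And>i. i < n \<Longrightarrow> e i \<in> to_ser ` V" "indep_seq n e (to_ser ` W)"
    using assms(1) unfolding codim_def by blast
  have "\<forall>i. \<exists>c. i < n \<longrightarrow> c \<in> V \<and> e i = to_ser c" using e by blast
  then obtain g where g: "\<And>i. i < n \<Longrightarrow> g i \<in> V \<and> e i = to_ser (g i)" by metis
  have zero: "0 \<in> to_ser ` W" using assms(2) by (simp add: subsp_def)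
  \<comment> \<open>Two equal basis elements would satisfy a relation with coefficients 1 and -1;
    injectivity ensures that the set built from the sequence still has n elements.\<close>
  have inj: "inj_on g {..<n}"
  proof (rule inj_onI, rule ccontr)
    fix i j assume ij: "i \<in> {..<n}" "j \<in> {..<n}" "g i = g j" "i \<noteq> j"
    let ?a = "\<lambda>k. if k = i then 1 else if k = j then -1 else (0::complex)"
    have "lc n ?a e = (\<Sum>k\<in>{i,j}. cc (?a k) * e k)"
      unfolding lc_def using ij by (intro sum.mono_neutral_right) auto
    also have "\<dots> = cc 1 * e i + cc (-1) * e j" using ij by simp
    also have "\<dots> = 0" using ij g[of i] g[of j] unfolding cc_uminus by simp
    finally have "lc n ?a e \<in> to_ser ` W" using zero by simp
    with e(2) have "\<forall>k<n. ?a k = 0" unfolding indep_seq_def by (elim allE[of _ ?a] impE)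
    hence "?a i = 0" using ij(1) by (elim allE[of _ i]) simp
    thus False by simp
  qed
  define S where "S = g ` {..<n}"
  have bij: "bij_betw g {..<n} S" using inj by (simp add: S_def bij_betw_def)
  have "indep_mod S W"
    unfolding indep_mod_def
  proof (intro allI impI ballI)
    fix a s assume a: "(\<lambda>ij. \<Sum>s\<in>S. a s * s ij) \<in> W" and s: "s \<in> S"
    have "lc n (\<lambda>i. a (g i)) e = lc n (\<lambda>i. a (g i)) (\<lambda>i. to_ser (g i))"
      unfolding lc_def using g by (intro sum.cong refl) auto
    also have "\<dots> \<in> to_ser ` W" using a by (subst to_ser_lincomb[OF bij, symmetric]) simp
    finally show "a s = 0" using e(2) s unfolding indep_seq_def S_def by auto
  qed
  moreover have "finite S" "S \<subseteq> V" "card S = n" using g inj by (auto simp: S_def card_image)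
  ultimately have "enat n \<le> quot_dim V W"
    unfolding quot_dim_def by (intro SUP_upper2[of S]) auto
  moreover have "quot_dim V W \<le> enat n"
    unfolding quot_dim_def using ub by (intro SUP_least) auto
  ultimately show ?thesis by (rule antisym[rotated])
qed

subsection \<open>Lattices over convergent series in one variable\<close>

definition conv1 :: "complex fps set" where
  "conv1 = {f. fps_conv_radius f > 0}"

lemma conv1_0 [simp]: "0 \<in> conv1" and conv1_1 [simp]: "1 \<in> conv1"
  and conv1_X [simp]: "fps_X \<in> conv1" and conv1_const [simp]: "fps_const c \<in> conv1"
  by (simp_all add: conv1_def)

lemma conv1_add: "f \<in> conv1 \<Longrightarrow> g \<in> conv1 \<Longrightarrow> f + g \<in> conv1"
  using fps_conv_radius_add[of f g] unfolding conv1_def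
  by (auto intro: less_le_trans[of 0 "min _ _"])

lemma conv1_mult: "f \<in> conv1 \<Longrightarrow> g \<in> conv1 \<Longrightarrow> f * g \<in> conv1"
  using fps_conv_radius_mult[of f g] unfolding conv1_def
  by (auto intro: less_le_trans[of 0 "min _ _"])

lemma conv1_uminus: "f \<in> conv1 \<Longrightarrow> - f \<in> conv1"
  by (simp add: conv1_def)

lemma conv1_diff: "f \<in> conv1 \<Longrightarrow> g \<in> conv1 \<Longrightarrow> f - g \<in> conv1"
  using conv1_add[of f "- g"] conv1_uminus by simp

lemma conv1_sum: "(\<And>i. i \<in> I \<Longrightarrow> f i \<in> conv1) \<Longrightarrow> (\<Sum>i\<in>I. f i) \<in> conv1"
  by (induction I rule: infinite_finite_induct) (auto intro: conv1_add)

lemma conv1_prod: "(\<And>i. i \<in> I \<Longrightarrow> f i \<in> conv1) \<Longrightarrow> (\<Prod>i\<in>I. f i) \<in> conv1"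
  by (induction I rule: infinite_finite_induct) (auto intro: conv1_mult)

lemma conv1_power: "f \<in> conv1 \<Longrightarrow> f ^ n \<in> conv1"
  by (induction n) (auto intro: conv1_mult)

lemma conv1_shift: "f \<in> conv1 \<Longrightarrow> fps_shift n f \<in> conv1"
  by (simp add: conv1_def)

lemma conv1_inverse: "f \<in> conv1 \<Longrightarrow> fps_nth f 0 \<noteq> 0 \<Longrightarrow> inverse f \<in> conv1"
  by (simp add: conv1_def fps_conv_radius_inverse_pos)

lemma xser_cser: "f \<in> conv1 \<Longrightarrow> xser f \<in> cser"
  by (simp add: conv1_def cser_xser)

lemma cser_nth: "f \<in> cser \<Longrightarrow> fps_nth f j \<in> conv1"
  by (simp add: conv1_def cser_radius)

lemma conv1_det:
  assumes "A \<in> carrier_mat n n" "\<And>i j. i < n \<Longrightarrow> j < n \<Longrightarrow> A $$ (i,j) \<in> conv1"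
  shows "det A \<in> conv1"
proof -
  have "signof p \<in> conv1" for p :: "nat \<Rightarrow> nat" by (simp add: sign_def conv1_uminus)
  moreover have "p i < n" if "p permutes {0..<n}" "i < n" for p i
    using permutes_in_image[OF that(1), of i] that(2) by simp
  ultimately show ?thesis
    unfolding det_def'[OF assms(1)] using assms(2)
    by (intro conv1_sum conv1_mult conv1_prod) auto
qed

definition xmod :: "ser set \<Rightarrow> bool" where
  "xmod N \<longleftrightarrow> 0 \<in> N \<and> (\<forall>a\<in>N. \<forall>b\<in>N. a + b \<in> N) \<and> (\<forall>f\<in>conv1. \<forall>a\<in>N. xser f * a \<in> N)"

definition xspan :: "nat \<Rightarrow> (nat \<Rightarrow> ser) \<Rightarrow> ser set" where
  "xspan n t = {\<Sum>i<n. xser (v i) * t i | v. \<forall>i. v i \<in> conv1}"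

text \<open>Independence is asked over all formal coefficients, which spares convergence checks for
  the coefficients of a relation.\<close>

definition xindep :: "nat \<Rightarrow> (nat \<Rightarrow> ser) \<Rightarrow> bool" where
  "xindep n t \<longleftrightarrow> (\<forall>v. (\<Sum>i<n. xser (v i) * t i) = 0 \<longrightarrow> (\<forall>i<n. v i = 0))"

lemma xmod_subsp: "xmod N \<Longrightarrow> subsp N"
  by (auto simp: xmod_def subsp_def)

lemma xmod_sum: "xmod N \<Longrightarrow> (\<And>i. i \<in> I \<Longrightarrow> f i \<in> N) \<Longrightarrow> (\<Sum>i\<in>I. f i) \<in> N"
  by (induction I rule: infinite_finite_induct) (auto simp: xmod_def)

lemma xmod_scale: "xmod N \<Longrightarrow> a \<in> N \<Longrightarrow> f \<in> conv1 \<Longrightarrow> xser f * a \<in> N"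
  by (auto simp: xmod_def)

lemma xmod_xspan: "xmod (xspan n t)"
  unfolding xmod_def
proof (intro conjI ballI)
  show "0 \<in> xspan n t" unfolding xspan_def by (rule CollectI, rule exI[of _ "\<lambda>_. 0"]) simp
  fix a assume "a \<in> xspan n t"
  then obtain v where v: "a = (\<Sum>i<n. xser (v i) * t i)" "\<forall>i. v i \<in> conv1" by (auto simp: xspan_def)
  show "a + b \<in> xspan n t" if b: "b \<in> xspan n t" for b
  proof -
    obtain w where w: "b = (\<Sum>i<n. xser (w i) * t i)" "\<forall>i. w i \<in> conv1" using b by (auto simp: xspan_def)
    have "a + b = (\<Sum>i<n. xser (v i + w i) * t i)"
      unfolding v w fps_const_add[symmetric] distrib_right sum.distrib ..
    moreover have "\<forall>i. v i + w i \<in> conv1" using v w by (auto intro: conv1_add)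
    ultimately show ?thesis unfolding xspan_def by (intro CollectI exI[of _ "\<lambda>i. v i + w i"] conjI)
  qed
  show "xser f * a \<in> xspan n t" if f: "f \<in> conv1" for f
  proof -
    have "xser f * a = (\<Sum>i<n. xser (f * v i) * t i)"
      unfolding v fps_const_mult[symmetric] sum_distrib_left mult.assoc ..
    moreover have "\<forall>i. f * v i \<in> conv1" using v f by (auto intro: conv1_mult)
    ultimately show ?thesis unfolding xspan_def by (intro CollectI exI[of _ "\<lambda>i. f * v i"] conjI)
  qed
qed

lemma xspan_subset: "xmod N \<Longrightarrow> (\<And>i. i < n \<Longrightarrow> t i \<in> N) \<Longrightarrow> xspan n t \<subseteq> N"
  unfolding xspan_def by (auto intro!: xmod_sum xmod_scale)

lemma xspan_base: "i < n \<Longrightarrow> t i \<in> xspan n t"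
proof -
  assume "i < n"
  have "t i = (\<Sum>j<n. if j = i then t j else 0)" using \<open>i < n\<close> by simp
  also have "\<dots> = (\<Sum>j<n. xser (if j = i then 1 else 0) * t j)"
    by (intro sum.cong refl) simp
  finally show ?thesis unfolding xspan_def by (intro CollectI exI[of _ "\<lambda>j. if j = i then 1 else 0"]) simp
qed

definition rowcomb :: "nat \<Rightarrow> complex fps mat \<Rightarrow> (nat \<Rightarrow> ser) \<Rightarrow> nat \<Rightarrow> ser" where
  "rowcomb n T e i = (\<Sum>j<n. xser (T $$ (i,j)) * e j)"

lemma sum_rowcomb:
  "(\<Sum>i<n. xser (w i) * rowcomb n T e i) = (\<Sum>j<n. xser (\<Sum>i<n. w i * T $$ (i,j)) * e j)"
proof -
  have xs: "xser (\<Sum>i\<in>I. g i) = (\<Sum>i\<in>I. xser (g i))" for g :: "nat \<Rightarrow> complex fps" and I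
    by (induction I rule: infinite_finite_induct) (simp_all flip: fps_const_add)
  show ?thesis
    unfolding rowcomb_def sum_distrib_left xs sum_distrib_right
    unfolding fps_const_mult[symmetric] mult.assoc by (rule sum.swap)
qed

text \<open>A relation among the rows is a kernel vector of the transposed matrix, and over a domain
  a nonzero determinant leaves only the zero vector.\<close>

lemma xindep_rowcomb:
  assumes "xindep n e" "T \<in> carrier_mat n n" "det T \<noteq> 0"
  shows "xindep n (rowcomb n T e)"
  unfolding xindep_def
proof (intro allI impI)
  fix w i assume w: "(\<Sum>i<n. xser (w i) * rowcomb n T e i) = 0" and i: "i < n"
  have z: "(\<Sum>i<n. w i * T $$ (i,j)) = 0" if "j < n" for j
  proof -
    have "(\<Sum>j<n. xser (\<Sum>i<n. w i * T $$ (i,j)) * e j) = 0"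
      using w by (simp only: sum_rowcomb)
    hence "\<forall>j<n. (\<lambda>j. \<Sum>i<n. w i * T $$ (i,j)) j = 0"
      using assms(1)[unfolded xindep_def, THEN spec, of "\<lambda>j. \<Sum>i<n. w i * T $$ (i,j)"] by blast
    thus ?thesis using that by blast
  qed
  have "transpose_mat T *\<^sub>v vec n w = 0\<^sub>v n"
    using assms(2) z by (intro eq_vecI) (auto simp: scalar_prod_def atLeast0LessThan mult.commute)
  moreover have "det (transpose_mat T) \<noteq> 0" using assms by (simp add: det_transpose)
  ultimately have "vec n w = 0\<^sub>v n"
    using det_0_iff_vec_prod_zero[of "transpose_mat T" n] assms(2) vec_carrier[of n w]
    by (metis transpose_carrier_mat)
  thus "w i = 0" using i by (metis index_vec index_zero_vec(1))
qed

text \<open>The determinant is a unit of C{x}, so the adjugate divided by it is an inverse matrix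
  with convergent entries.\<close>

lemma xspan_rowcomb_unimodular:
  assumes T: "T \<in> carrier_mat n n" "\<And>i j. i < n \<Longrightarrow> j < n \<Longrightarrow> T $$ (i,j) \<in> conv1"
    and d: "fps_nth (det T) 0 \<noteq> 0"
  shows "xspan n e \<subseteq> xspan n (rowcomb n T e)"
proof (rule xspan_subset[OF xmod_xspan])
  fix k assume k: "k < n"
  note adj = adj_mat[OF T(1)]
  define u where "u = inverse (det T)"
  have u: "u \<in> conv1" "u * det T = 1"
    using conv1_det[OF T] d by (auto simp: u_def conv1_inverse inverse_mult_eq_1)
  have adjc: "adj_mat T $$ (k,i) \<in> conv1" if "i < n" for i
  proof -
    have md: "mat_delete T i k \<in> carrier_mat (n - 1) (n - 1)" using T(1) by (rule mat_delete_carrier)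
    have "det (mat_delete T i k) \<in> conv1"
      using T k that by (intro conv1_det[OF md]) (auto simp: mat_delete_def)
    thus ?thesis using T(1) k that
      by (auto simp: adj_mat_def cofactor_def intro!: conv1_mult conv1_power conv1_uminus)
  qed
  define w where "w i = (if i < n then u * adj_mat T $$ (k,i) else 0)" for i
  have row: "(\<Sum>i<n. w i * T $$ (i,j)) = (if j = k then 1 else 0)" if "j < n" for j
  proof -
    have "(adj_mat T * T) $$ (k,j) = (\<Sum>i<n. adj_mat T $$ (k,i) * T $$ (i,j))"
      using adj(1) T(1) k that by (simp add: scalar_prod_def atLeast0LessThan)
    hence "(\<Sum>i<n. adj_mat T $$ (k,i) * T $$ (i,j)) = det T * (if j = k then 1 else 0)"
      using adj(3) k that by auto
    thus ?thesis using u(2) by (simp add: w_def mult.assoc sum_distrib_left[symmetric])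
  qed
  have "(\<Sum>i<n. xser (w i) * rowcomb n T e i) = (\<Sum>j<n. if j = k then e j else 0)"
    unfolding sum_rowcomb using row by (intro sum.cong refl) auto
  hence "e k = (\<Sum>i<n. xser (w i) * rowcomb n T e i)" using k by simp
  thus "e k \<in> xspan n (rowcomb n T e)"
    unfolding xspan_def using adjc u by (auto simp: w_def intro!: exI[of _ w] conv1_mult)
qed

lemma const_coeff_hom: "comm_ring_hom (\<lambda>f :: complex fps. fps_nth f 0)"
  by unfold_locales auto

text \<open>Modulo x the rows satisfy a relation c over the complex numbers, so the corresponding
  combination of rows is divisible by x. Dividing it by x and putting it in place of a row k with
  \<open>c k\<close> nonzero takes one factor x out of the determinant.\<close>

lemma det_singular_mod_x:
  assumes T: "T \<in> carrier_mat n n" "\<And>i j. i < n \<Longrightarrow> j < n \<Longrightarrow> T $$ (i,j) \<in> conv1"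
    and d: "fps_nth (det T) 0 = 0"
  obtains k c T' where "k < n" "c k \<noteq> 0" "\<And>i. i > k \<Longrightarrow> c i = 0"
    "T' \<in> carrier_mat n n" "\<And>i j. i < n \<Longrightarrow> j < n \<Longrightarrow> T' $$ (i,j) \<in> conv1"
    "\<And>i j. i < n \<Longrightarrow> j < n \<Longrightarrow> i \<noteq> k \<Longrightarrow> T' $$ (i,j) = T $$ (i,j)"
    "\<And>j. j < n \<Longrightarrow> fps_X * T' $$ (k,j) = (\<Sum>i<n. fps_const (c i) * T $$ (i,j))"
    "fps_const (c k) * det T = fps_X * det T'"
proof -
  interpret h: comm_ring_hom "\<lambda>f :: complex fps. fps_nth f 0" by (rule const_coeff_hom)
  define T0 where "T0 = map_mat (\<lambda>f. fps_nth f 0) T"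
  have T0: "T0 \<in> carrier_mat n n" using T by (simp add: T0_def)
  have "det (transpose_mat T0) = 0" using d T0 by (simp add: det_transpose) (simp add: T0_def)
  then obtain v where v: "v \<in> carrier_vec n" "v \<noteq> 0\<^sub>v n" "transpose_mat T0 *\<^sub>v v = 0\<^sub>v n"
    using det_0_iff_vec_prod_zero[of "transpose_mat T0" n] T0 by auto
  define c where "c i = (if i < n then v $ i else 0)" for i
  define I where "I = {i. c i \<noteq> 0}"
  have fin: "finite I" by (rule finite_subset[of _ "{..<n}"]) (auto simp: I_def c_def)
  have "I \<noteq> {}"
  proof
    assume "I = {}"
    hence "v $ i = 0" if "i < n" for i using that by (auto simp: I_def c_def split: if_splits)
    hence "v = 0\<^sub>v n" using v(1) by (intro eq_vecI) auto
    thus False using v(2) by simp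
  qed
  \<comment> \<open>The last index of the support makes the row operation E below lower triangular,
    with \<open>c k\<close> on the diagonal.\<close>
  define k where "k = Max I"
  have kI: "k \<in> I" and kmax: "\<And>i. i \<in> I \<Longrightarrow> i \<le> k"
    using fin \<open>I \<noteq> {}\<close> by (auto simp: k_def)
  have k: "k < n" "c k \<noteq> 0" "\<And>i. i > k \<Longrightarrow> c i = 0"
    using kI kmax by (force simp: I_def c_def split: if_splits)+
  define \<rho> where "\<rho> j = (\<Sum>i<n. fps_const (c i) * T $$ (i,j))" for j
  have \<rho>0: "fps_nth (\<rho> j) 0 = 0" if "j < n" for j
  proof -
    have "(transpose_mat T0 *\<^sub>v v) $ j = (\<Sum>i<n. fps_nth (T $$ (i,j)) 0 * v $ i)"
      using T v(1) that by (simp add: T0_def scalar_prod_def atLeast0LessThan)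
    also have "\<dots> = fps_nth (\<rho> j) 0" by (simp add: \<rho>_def fps_sum_nth c_def mult.commute)
    finally show ?thesis using v(3) that by simp
  qed
  have \<rho>X: "fps_X * fps_shift 1 (\<rho> j) = \<rho> j" if "j < n" for j
    using \<rho>0[OF that] by (intro fps_ext) (simp add: fps_X_mult_nth)
  define T' where "T' = mat n n (\<lambda>(i,j). if i = k then fps_shift 1 (\<rho> j) else T $$ (i,j))"
  define E where "E = mat n n (\<lambda>(i,j). if i = k then fps_const (c j) else if i = j then 1 else 0)"
  define D where "D = mat n n (\<lambda>(i,j). if i = j then (if i = k then fps_X else 1) else (0 :: complex fps))"
  have ED: "E \<in> carrier_mat n n" "D \<in> carrier_mat n n" "T' \<in> carrier_mat n n"
    by (simp_all add: E_def D_def T'_def)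
  have "E * T = D * T'"
  proof (rule eq_matI)
    fix i j assume "i < dim_row (D * T')" "j < dim_col (D * T')"
    hence ij: "i < n" "j < n" by (simp_all add: D_def T'_def)
    have L: "(E * T) $$ (i,j) = (\<Sum>l<n. E $$ (i,l) * T $$ (l,j))"
      using ED(1) T ij by (simp add: scalar_prod_def atLeast0LessThan)
    have "(D * T') $$ (i,j) = (\<Sum>l<n. D $$ (i,l) * T' $$ (l,j))"
      using ED ij by (simp add: scalar_prod_def atLeast0LessThan)
    also have "\<dots> = (\<Sum>l<n. if l = i then (if i = k then fps_X else 1) * T' $$ (i,j) else 0)"
      using ij by (intro sum.cong refl) (auto simp: D_def)
    also have "\<dots> = (if i = k then fps_X else 1) * T' $$ (i,j)" using ij by simp
    also have "\<dots> = (if i = k then \<rho> j else T $$ (i,j))" using ij \<rho>X by (simp add: T'_def)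
    also have "\<dots> = (\<Sum>l<n. E $$ (i,l) * T $$ (l,j))"
    proof (cases "i = k")
      case True thus ?thesis using ij by (simp add: E_def \<rho>_def)
    next
      case False
      have "(\<Sum>l<n. E $$ (i,l) * T $$ (l,j)) = (\<Sum>l<n. if l = i then T $$ (i,j) else 0)"
        using ij False by (intro sum.cong refl) (auto simp: E_def)
      thus ?thesis using ij False by simp
    qed
    finally show "(E * T) $$ (i,j) = (D * T') $$ (i,j)" using L by simp
  qed (use ED T in auto)
  hence eq: "det E * det T = det D * det T'"
    using ED T det_mult[of E n T] det_mult[of D n T'] by simp
  have dg: "prod_list (diag_mat A) = (\<Prod>i<n. A $$ (i,i))" if "A \<in> carrier_mat n n" for A :: "complex fps mat"
    using that by (simp add: diag_mat_def prod.list_conv_set_nth atLeast0LessThan)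
  have "det E = (\<Prod>i<n. E $$ (i,i))"
    unfolding dg[OF ED(1), symmetric] using ED k by (intro det_lower_triangular[where n=n]) (auto simp: E_def)
  also have "\<dots> = (\<Prod>i<n. if i = k then fps_const (c k) else 1)"
    by (intro prod.cong refl) (auto simp: E_def)
  also have "\<dots> = fps_const (c k)" using k by simp
  finally have dE: "det E = fps_const (c k)" .
  have "det D = (\<Prod>i<n. D $$ (i,i))"
    unfolding dg[OF ED(2), symmetric] using ED k by (intro det_lower_triangular[where n=n]) (auto simp: D_def)
  also have "\<dots> = (\<Prod>i<n. if i = k then fps_X else 1)"
    by (intro prod.cong refl) (auto simp: D_def)
  also have "\<dots> = fps_X" using k by simp
  finally have dD: "det D = fps_X" .
  show ?thesis
  proof (rule that[of k c T'])
    show "T' $$ (i,j) \<in> conv1" if "i < n" "j < n" for i j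
      using that T by (auto simp: T'_def \<rho>_def intro!: conv1_shift conv1_sum conv1_mult)
    show "fps_X * T' $$ (k,j) = (\<Sum>i<n. fps_const (c i) * T $$ (i,j))" if "j < n" for j
      using \<rho>X[OF that] that k by (simp add: T'_def \<rho>_def)
    show "fps_const (c k) * det T = fps_X * det T'" using eq dE dD by simp
  qed (use k ED in \<open>auto simp: T'_def\<close>)
qed

text \<open>The length of the cokernel of T over the discrete valuation ring C{x} is the order of
  det T. By induction on this order: the step of \<open>det_singular_mod_x\<close> enlarges the
  lattice by one dimension and lowers the order by one.\<close>

theorem codim_xspan_rowcomb:
  assumes e: "xindep n e"
    and T: "T \<in> carrier_mat n n" "\<And>i j. i < n \<Longrightarrow> j < n \<Longrightarrow> T $$ (i,j) \<in> conv1"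
    and d: "det T \<noteq> 0"
  shows "xspan n (rowcomb n T e) \<subseteq> xspan n e \<and> codim (xspan n e) (xspan n (rowcomb n T e)) (subdegree (det T))"
  using T d
proof (induction "subdegree (det T)" arbitrary: T)
  case 0
  have "rowcomb n T e i \<in> xspan n e" if "i < n" for i
    unfolding rowcomb_def using 0 that by (intro xmod_sum[OF xmod_xspan] xmod_scale[OF xmod_xspan] xspan_base) auto
  hence "xspan n (rowcomb n T e) \<subseteq> xspan n e" by (intro xspan_subset xmod_xspan)
  moreover have "fps_nth (det T) 0 \<noteq> 0"
    using nth_subdegree_nonzero[OF 0(4)] 0(1) by simp
  hence "codim (xspan n e) (xspan n (rowcomb n T e)) 0"
    using xspan_rowcomb_unimodular[OF 0(2,3)] by (intro codim_0) blast
  ultimately show ?case using 0(1) by simp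
next
  case (Suc m)
  have d0: "fps_nth (det T) 0 = 0" using Suc(2) by (metis nth_less_subdegree_zero zero_less_Suc)
  obtain k c T' where
    k: "k < n" "c k \<noteq> 0" "\<And>i. i > k \<Longrightarrow> c i = 0" and T': "T' \<in> carrier_mat n n" "\<And>i j. i < n \<Longrightarrow> j < n \<Longrightarrow> T' $$ (i,j) \<in> conv1"
    and same: "\<And>i j. i < n \<Longrightarrow> j < n \<Longrightarrow> i \<noteq> k \<Longrightarrow> T' $$ (i,j) = T $$ (i,j)"
    and row: "\<And>j. j < n \<Longrightarrow> fps_X * T' $$ (k,j) = (\<Sum>i<n. fps_const (c i) * T $$ (i,j))"
    and dets: "fps_const (c k) * det T = fps_X * det T'"
    by (rule det_singular_mod_x[OF Suc(3) _ d0]) (use Suc(4) in \<open>blast+\<close>)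
  have d': "det T' \<noteq> 0" using dets k Suc(5) by auto
  have "subdegree (fps_const (c k) * det T) = subdegree (fps_X * det T')" by (simp only: dets)
  hence "m = subdegree (det T')" using Suc(2,5) d' k by (simp add: subdegree_mult)
  from Suc(1)[OF this T' d'] this
  have IH: "xspan n (rowcomb n T' e) \<subseteq> xspan n e" "codim (xspan n e) (xspan n (rowcomb n T' e)) m" by auto
  define t where "t = rowcomb n T e"
  define t' where "t' = rowcomb n T' e"
  have tt': "t' i = t i" if "i < n" "i \<noteq> k" for i
    using that same by (simp add: t_def t'_def rowcomb_def)
  have "xser fps_X * t' k = (\<Sum>j<n. xser (fps_X * T' $$ (k,j)) * e j)"
    unfolding t'_def rowcomb_def sum_distrib_left fps_const_mult[symmetric] mult.assoc ..
  also have "\<dots> = (\<Sum>j<n. xser (\<Sum>i<n. fps_const (c i) * T $$ (i,j)) * e j)"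
    by (simp add: row)
  also have "\<dots> = (\<Sum>i<n. cc (c i) * t i)" unfolding t_def sum_rowcomb ..
  finally have Xt: "xser fps_X * t' k = (\<Sum>i<n. cc (c i) * t i)" .
  have ind: "xindep n t" unfolding t_def by (rule xindep_rowcomb[OF e Suc(3,5)])
  have sub: "xspan n t \<subseteq> xspan n t'"
  proof (rule xspan_subset[OF xmod_xspan])
    fix i assume i: "i < n"
    show "t i \<in> xspan n t'"
    proof (cases "i = k")
      case False thus ?thesis using tt'[OF i] xspan_base[OF i, of t'] by simp
    next
      case True
      have "xser fps_X * t' k = cc (c k) * t k + (\<Sum>i\<in>{..<n} - {k}. cc (c i) * t i)"
        unfolding Xt using k by (subst sum.remove[of _ k]) auto
      also have "(\<Sum>i\<in>{..<n} - {k}. cc (c i) * t i) = (\<Sum>i\<in>{..<n} - {k}. cc (c i) * t' i)"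
        using tt' by (intro sum.cong refl) auto
      finally have "cc (c k) * t k = xser fps_X * t' k - (\<Sum>i\<in>{..<n} - {k}. cc (c i) * t' i)" by simp
      also have "\<dots> \<in> xspan n t'"
        using k by (intro subsp_diff[OF xmod_subsp[OF xmod_xspan]] xmod_scale[OF xmod_xspan]
            xmod_sum[OF xmod_xspan] xspan_base) auto
      finally have "cc (1 / c k) * (cc (c k) * t k) \<in> xspan n t'"
        by (rule xmod_scale[OF xmod_xspan]) auto
      thus ?thesis using cc_cancel[OF k(2), of "t k"] True by simp
    qed
  qed
  \<comment> \<open>The element \<open>t' k\<close> spans the quotient over the complex numbers,
    because x times it already lies in \<open>xspan n t\<close>; so only the constant term of its
    coefficient matters.\<close>
  have "codim (xspan n t') (xspan n t) 1"
  proof (rule codim_1[where e="t' k"])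
    show "subsp (xspan n t)" by (intro xmod_subsp xmod_xspan)
    show "t' k \<in> xspan n t'" by (rule xspan_base) fact
    show "t' k \<notin> xspan n t"
    proof
      assume "t' k \<in> xspan n t"
      then obtain w where w: "t' k = (\<Sum>i<n. xser (w i) * t i)" by (auto simp: xspan_def)
      \<comment> \<open>Membership of \<open>t' k\<close> would produce this relation, whose
        coefficient at k has the nonzero constant term \<open>c k\<close>.\<close>
      have "(\<Sum>i<n. xser (fps_const (c i) - fps_X * w i) * t i)
          = (\<Sum>i<n. cc (c i) * t i) - xser fps_X * t' k"
        unfolding w fps_const_sub[symmetric] fps_const_mult[symmetric] left_diff_distrib sum_subtractf
          mult.assoc sum_distrib_left ..
      also have "\<dots> = 0" using Xt by simp
      finally have "fps_const (c k) - fps_X * w k = 0"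
        using ind[unfolded xindep_def, THEN spec, of "\<lambda>i. fps_const (c i) - fps_X * w i"] k by blast
      from arg_cong[OF this, of "\<lambda>f. fps_nth f 0"] show False using k by simp
    qed
    fix v assume "v \<in> xspan n t'"
    then obtain w where w: "v = (\<Sum>i<n. xser (w i) * t' i)" "\<forall>i. w i \<in> conv1" by (auto simp: xspan_def)
    have wk: "w k = fps_const (fps_nth (w k) 0) + fps_shift 1 (w k) * fps_X"
      by (rule fps_ext) (simp add: fps_X_mult_right_nth)
    have "v = xser (w k) * t' k + (\<Sum>i\<in>{..<n} - {k}. xser (w i) * t' i)"
      unfolding w using k by (subst sum.remove[of _ k]) auto
    also have "(\<Sum>i\<in>{..<n} - {k}. xser (w i) * t' i) = (\<Sum>i\<in>{..<n} - {k}. xser (w i) * t i)"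
      using tt' by (intro sum.cong refl) auto
    also have "xser (w k) * t' k = cc (fps_nth (w k) 0) * t' k + xser (fps_shift 1 (w k)) * (xser fps_X * t' k)"
      by (subst wk) (simp only: distrib_right mult.assoc fps_const_add[symmetric] fps_const_mult[symmetric])
    finally have "v - cc (fps_nth (w k) 0) * t' k
        = xser (fps_shift 1 (w k)) * (\<Sum>i<n. cc (c i) * t i) + (\<Sum>i\<in>{..<n} - {k}. xser (w i) * t i)"
      by (simp add: Xt)
    also have "\<dots> \<in> xspan n t"
      using w(2) by (intro subsp_add[OF xmod_subsp[OF xmod_xspan]] xmod_scale[OF xmod_xspan]
            xmod_sum[OF xmod_xspan] xspan_base conv1_shift) auto
    finally show "\<exists>c. v - cc c * t' k \<in> xspan n t" ..
  qed
  hence "codim (xspan n e) (xspan n t) (m + 1)"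
    using IH sub unfolding t'_def by (intro codim_trans[where V="xspan n (rowcomb n T' e)"] xmod_subsp xmod_xspan) auto
  thus ?case using sub IH(1) Suc(2) unfolding t_def t'_def by auto
qed

subsection \<open>Multiplication modulo a monic polynomial\<close>

lemma prod_list_const_1: "prod_list (map (\<lambda>_. 1) xs) = (1 :: 'a :: monoid_mult)"
  by (induction xs) auto

text \<open>The matrix of multiplication by g on C[y]/(w) in the basis of powers of y, with the
  images as rows. For monic w its determinant is, up to sign, the resultant of w and g.\<close>

definition mod_mat :: "complex poly \<Rightarrow> complex poly \<Rightarrow> complex mat" where
  "mod_mat w g = mat (degree w) (degree w) (\<lambda>(i,j). coeff ((g * monom 1 i) mod w) j)"

lemma mod_mat_carrier [simp]: "mod_mat w g \<in> carrier_mat (degree w) (degree w)"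
  by (simp add: mod_mat_def)

lemma poly_mod_sum: "(\<Sum>i\<in>I. f i :: complex poly) mod w = (\<Sum>i\<in>I. f i mod w)"
  by (induction I rule: infinite_finite_induct) (auto simp: poly_mod_add_left)

lemma poly_as_sum_lessThan:
  assumes "\<And>i. i \<ge> n \<Longrightarrow> coeff p i = 0"
  shows "p = (\<Sum>i<n. monom (coeff p i) i)"
  by (rule poly_eqI) (use assms in \<open>auto simp: coeff_sum sum.delta not_less\<close>)

lemma coeff_mod_zero:
  assumes "degree w > 0" "i \<ge> degree w"
  shows "coeff ((p :: complex poly) mod w) i = 0"
proof -
  have "w \<noteq> 0" using assms by auto
  hence "p mod w = 0 \<or> degree (p mod w) < degree w" by (rule degree_mod_less)
  thus ?thesis using assms by (auto intro: coeff_eq_0)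
qed

lemma mod_mat_mult:
  assumes "degree w > 0"
  shows "mod_mat w (g * h) = mod_mat w g * mod_mat w h"
proof (rule eq_matI)
  fix i j assume "i < dim_row (mod_mat w g * mod_mat w h)" "j < dim_col (mod_mat w g * mod_mat w h)"
  hence ij: "i < degree w" "j < degree w" by (simp_all add: mod_mat_def)
  define r where "r = (g * monom 1 i) mod w"
  have "(g * h * monom 1 i) mod w = (r * h) mod w"
  proof -
    have "(r * h) mod w = (g * monom 1 i * h) mod w" unfolding r_def by (rule mod_mult_left_eq)
    thus ?thesis by (simp only: ac_simps)
  qed
  also have "r = (\<Sum>l<degree w. monom (coeff r l) l)"
    unfolding r_def using assms by (intro poly_as_sum_lessThan coeff_mod_zero)
  also have "\<dots> * h = (\<Sum>l<degree w. Polynomial.smult (coeff r l) (h * monom 1 l))"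
    unfolding sum_distrib_right
    by (intro sum.cong refl) (metis mult.commute mult_smult_right mult_1_right smult_monom)
  finally have "(g * h * monom 1 i) mod w = (\<Sum>l<degree w. Polynomial.smult (coeff r l) ((h * monom 1 l) mod w))"
    by (simp add: poly_mod_sum mod_smult_left)
  hence "coeff ((g * h * monom 1 i) mod w) j = (\<Sum>l<degree w. coeff r l * coeff ((h * monom 1 l) mod w) j)"
    by (simp add: coeff_sum)
  thus "mod_mat w (g * h) $$ (i,j) = (mod_mat w g * mod_mat w h) $$ (i,j)"
    using ij by (simp add: mod_mat_def scalar_prod_def atLeast0LessThan r_def)
qed (simp_all add: mod_mat_def)

lemma mod_mat_1: "degree w > 0 \<Longrightarrow> mod_mat w 1 = 1\<^sub>m (degree w)"
  by (rule eq_matI) (auto simp: mod_mat_def mod_poly_less degree_monom_eq)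

text \<open>Only the last power of y reaches degree n and is reduced, by subtracting w once.\<close>

lemma mod_monic_linear:
  assumes "lead_coeff w = 1" "degree w = n" "i < n"
  shows "([:-\<beta>, 1:] * monom 1 i) mod w =
    (if Suc i < n then monom 1 (Suc i) - monom \<beta> i else monom 1 n - monom \<beta> i - (w :: complex poly))"
proof -
  have lin: "[:-\<beta>, 1:] * monom 1 i = monom 1 (Suc i) - monom \<beta> i"
    by (rule poly_eqI) (auto simp: coeff_pCons smult_monom split: nat.splits)
  show ?thesis
  proof (cases "Suc i < n")
    case True
    have "degree (monom 1 (Suc i) - monom \<beta> i) < n"
      using True assms by (intro degree_lessI) auto
    hence "(monom 1 (Suc i) - monom \<beta> i) mod w = monom 1 (Suc i) - monom \<beta> i"
      using assms by (simp add: mod_poly_less)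
    thus ?thesis unfolding lin using True by simp
  next
    case False
    hence i: "Suc i = n" using assms by simp
    have "degree (monom 1 n - monom \<beta> i - w) < n"
    proof (rule degree_lessI)
      show "\<forall>k\<ge>n. coeff (monom 1 n - monom \<beta> i - w) k = 0"
      proof (intro allI impI)
        fix k assume "k \<ge> n"
        thus "coeff (monom 1 n - monom \<beta> i - w) k = 0"
          using assms by (cases "k = n") (auto intro: coeff_eq_0)
      qed
    qed (use assms in auto)
    hence "(monom 1 n - monom \<beta> i - w) mod w = monom 1 n - monom \<beta> i - w"
      using assms(2) by (intro mod_poly_less) simp
    moreover have "(monom 1 n - monom \<beta> i - w) mod w = (monom 1 n - monom \<beta> i) mod w"
      by (simp add: poly_mod_diff_left)
    ultimately show ?thesis unfolding lin using i by simp
  qed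
qed

text \<open>Adding \<open>\<beta>^j\<close> times the j-th column to the first one turns the first column
  into the values at \<open>\<beta>\<close> of the remainders, which vanish except for the last one.\<close>
lemma norm_det_mod_mat_linear:
  assumes w: "lead_coeff w = 1" "degree w > 0"
  shows "norm (det (mod_mat w [:-\<beta>, 1:])) = norm (poly w \<beta>)"
proof -
  define n where "n = degree w"
  have n: "n > 0" "degree w = n" using w by (simp_all add: n_def)
  define K where "K = mod_mat w [:-\<beta>, 1:]"
  define r where "r i = ([:-\<beta>, 1:] * monom 1 i) mod w" for i
  have r: "r i = (if Suc i < n then monom 1 (Suc i) - monom \<beta> i else monom 1 n - monom \<beta> i - w)"
    if "i < n" for i
    unfolding r_def by (rule mod_monic_linear) (use w n that in auto)
  have K: "K \<in> carrier_mat n n" "\<And>i j. i < n \<Longrightarrow> j < n \<Longrightarrow> K $$ (i,j) = coeff (r i) j"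
    using n by (simp_all add: K_def mod_mat_def r_def)
  define U where "U = mat n n (\<lambda>(i,j). if j = 0 then \<beta> ^ i else if i = j then 1 else 0)"
  have U: "U \<in> carrier_mat n n" by (simp add: U_def)
  have "det U = prod_list (diag_mat U)"
    by (rule det_lower_triangular[OF _ U]) (auto simp: U_def)
  also have "diag_mat U = map (\<lambda>_. 1) [0..<n]"
    by (auto simp: diag_mat_def U_def)
  finally have dU: "det U = 1" by (simp add: prod_list_const_1)
  define A where "A = K * U"
  have A: "A \<in> carrier_mat n n" using K U by (simp add: A_def)
  have dA: "det A = det K" unfolding A_def using det_mult[OF K(1) U] dU by simp
  have col0: "A $$ (i,0) = poly (r i) \<beta>" if "i < n" for i
  proof -
    have "A $$ (i,0) = (\<Sum>j<n. coeff (r i) j * \<beta> ^ j)"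
      using K U n that by (simp add: A_def scalar_prod_def atLeast0LessThan U_def)
    also have "\<dots> = poly (r i) \<beta>"
    proof -
      have "r i = (\<Sum>j<n. monom (coeff (r i) j) j)"
        unfolding r_def using w n by (intro poly_as_sum_lessThan coeff_mod_zero) auto
      hence "poly (r i) \<beta> = poly (\<Sum>j<n. monom (coeff (r i) j) j) \<beta>" by simp
      thus ?thesis by (simp add: poly_sum poly_monom)
    qed
    finally show ?thesis .
  qed
  have colS: "A $$ (i, Suc j) = coeff (r i) (Suc j)" if "i < n" "Suc j < n" for i j
  proof -
    have "A $$ (i, Suc j) = (\<Sum>l<n. coeff (r i) l * U $$ (l, Suc j))"
      using K U that by (simp add: A_def scalar_prod_def atLeast0LessThan)
    also have "\<dots> = (\<Sum>l<n. if l = Suc j then coeff (r i) (Suc j) else 0)"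
      using that by (intro sum.cong refl) (auto simp: U_def)
    finally show ?thesis using that by simp
  qed
  have val: "A $$ (i,0) = (if Suc i < n then 0 else - poly w \<beta>)" if "i < n" for i
  proof (cases "Suc i < n")
    case True thus ?thesis using col0[OF that] r[OF that] by (simp add: poly_monom)
  next
    case False
    hence "n = Suc i" using that by simp
    thus ?thesis using col0[OF that] r[OF that] by (simp add: poly_monom)
  qed
  have "det A = (\<Sum>i<n. A $$ (i,0) * cofactor A i 0)"
    by (rule laplace_expansion_column[OF A n(1)])
  also have "\<dots> = (\<Sum>i<n. if i = n - 1 then - poly w \<beta> * cofactor A (n - 1) 0 else 0)"
    using val by (intro sum.cong refl) auto
  also have "\<dots> = - poly w \<beta> * cofactor A (n - 1) 0" using n by simp
  finally have "det A = - poly w \<beta> * cofactor A (n - 1) 0" .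
  \<comment> \<open>Without the last row and the first column, the remainders
    \<open>y^(i+1) - \<beta> y^i\<close> form a lower triangular matrix with ones on the
    diagonal.\<close>
  moreover have "norm (cofactor A (n - 1) 0) = 1"
  proof -
    let ?D = "mat_delete A (n - 1) 0"
    have D: "?D \<in> carrier_mat (n - 1) (n - 1)" by (rule mat_delete_carrier[OF A])
    have ent: "?D $$ (i,j) = coeff (r i) (Suc j)" if "i < n - 1" "j < n - 1" for i j
      using that A colS[of i j] by (simp add: mat_delete_def)
    have rr: "r i = monom 1 (Suc i) - monom \<beta> i" if "i < n - 1" for i
    proof -
      have "Suc i < n" using that by linarith
      thus ?thesis using r[of i] by simp
    qed
    have "det ?D = prod_list (diag_mat ?D)"
    proof (rule det_lower_triangular[OF _ D])
      fix i j assume "i < j" "j < n - 1"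
      thus "?D $$ (i,j) = 0" using ent[of i j] rr[of i] by simp
    qed
    also have "diag_mat ?D = map (\<lambda>_. 1) [0..<n - 1]"
    proof -
      have "?D $$ (i,i) = 1" if "i < n - 1" for i using ent[of i i] rr[of i] that by simp
      thus ?thesis using D unfolding diag_mat_def by (intro map_cong) auto
    qed
    finally have "det ?D = 1" by (simp add: prod_list_const_1)
    thus ?thesis by (simp add: cofactor_def norm_mult norm_power)
  qed
  ultimately show ?thesis using dA by (simp add: norm_mult K_def)
qed

text \<open>Multiplicativity in the second polynomial reduces to linear factors. A monic w of degree
  0 is 1, and then the matrix is empty with determinant 1.\<close>

lemma norm_det_mod_mat:
  assumes w: "lead_coeff w = 1"
  shows "norm (det (mod_mat w (\<Prod>\<beta>\<leftarrow>bs. [:-\<beta>, 1:]))) = (\<Prod>\<beta>\<leftarrow>bs. norm (poly w \<beta>))"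
proof (cases "degree w = 0")
  case True
  then obtain c where c: "w = [:c:]" by (rule degree_eq_zeroE)
  hence "w = 1" using w by (simp add: one_pCons)
  moreover have "det (mod_mat 1 g) = 1" for g by (rule det_dim_zero) (simp add: mod_mat_def)
  ultimately show ?thesis by (simp add: prod_list_const_1)
next
  case False
  show ?thesis
  proof (induction bs)
    case Nil thus ?case using False by (simp add: mod_mat_1)
  next
    case (Cons b bs)
    have "det (mod_mat w ([:-b, 1:] * (\<Prod>\<beta>\<leftarrow>bs. [:-\<beta>, 1:])))
        = det (mod_mat w [:-b, 1:]) * det (mod_mat w (\<Prod>\<beta>\<leftarrow>bs. [:-\<beta>, 1:]))"
      using False by (simp only: mod_mat_mult) (rule det_mult[OF mod_mat_carrier mod_mat_carrier])
    thus ?case using Cons norm_det_mod_mat_linear[OF w, of b] False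
      by (simp add: norm_mult)
  qed
qed

subsection \<open>The ideal generated by two polynomials in y\<close>

definition idl :: "ser \<Rightarrow> ser \<Rightarrow> ser set" where
  "idl F G = {a * F + b * G | a b. a \<in> cser \<and> b \<in> cser}"

lemma subsp_idl: "subsp (idl F G)"
  unfolding subsp_def
proof (intro conjI ballI allI)
  show "0 \<in> idl F G" unfolding idl_def by (rule CollectI, rule exI[of _ 0], rule exI[of _ 0]) simp
  fix p assume "p \<in> idl F G"
  then obtain a b where p: "p = a * F + b * G" "a \<in> cser" "b \<in> cser" by (auto simp: idl_def)
  show "p + q \<in> idl F G" if qi: "q \<in> idl F G" for q
  proof -
    obtain a' b' where q: "q = a' * F + b' * G" "a' \<in> cser" "b' \<in> cser"
      using qi by (auto simp: idl_def)
    have "p + q = (a + a') * F + (b + b') * G" unfolding p q by (simp add: algebra_simps)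
    thus ?thesis unfolding idl_def using p q by (blast intro: cser_add)
  qed
  show "cc c * p \<in> idl F G" for c
  proof -
    have "cc c * p = (cc c * a) * F + (cc c * b) * G" unfolding p by (simp add: algebra_simps)
    thus ?thesis unfolding idl_def using p by (blast intro: cser_mult cser_cc)
  qed
qed

text \<open>Long division, by induction on the degree bound. Unlike
  \<open>weierstrass_division\<close> it controls the y-degree of the quotient, so that at a fixed x
  quotient and remainder are both polynomials.\<close>

lemma monic_division:
  assumes W: "weierstrass_poly M W" and F: "F \<in> cser" "\<And>j. j \<ge> d \<Longrightarrow> fps_nth F j = 0"
  shows "\<exists>Q\<in>cser. (\<forall>j\<ge>d. fps_nth Q j = 0) \<and> (\<forall>j\<ge>M. fps_nth (F - Q * W) j = 0)"
  using F
proof (induction d arbitrary: F)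
  case 0
  hence "F = 0" by (intro fps_ext) simp
  thus ?case by (intro bexI[of _ 0]) auto
next
  case (Suc d)
  show ?case
  proof (cases "d < M")
    case True
    thus ?thesis using Suc.prems by (intro bexI[of _ 0]) auto
  next
    case False
    define H where "H = xser (fps_nth F d) * yvar ^ (d - M)"
    have H: "H \<in> cser" unfolding H_def
      by (intro cser_mult cser_power xser_cser cser_nth Suc.prems) auto
    have HW: "fps_nth (H * W) j = (if j < d - M then 0 else fps_nth F d * fps_nth W (j - (d - M)))" for j
      unfolding H_def by (simp add: mult.assoc fps_X_power_mult_nth)
    have Hz: "fps_nth H j = 0" if "j \<ge> Suc d" for j
      using that unfolding H_def by (simp add: fps_X_power_nth)
    have "F - H * W \<in> cser" using W H Suc.prems by (intro cser_diff cser_mult) (auto simp: weierstrass_poly_def)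
    moreover have "fps_nth (F - H * W) j = 0" if "j \<ge> d" for j
    proof (cases "j = d")
      case True
      thus ?thesis using False W HW[of d] by (simp add: weierstrass_poly_def)
    next
      case jd: False
      hence "j - (d - M) > M" using that False by linarith
      thus ?thesis using HW[of j] W Suc.prems(2)[of j] that jd by (simp add: weierstrass_poly_def)
    qed
    ultimately obtain Q where Q: "Q \<in> cser" "\<forall>j\<ge>d. fps_nth Q j = 0"
      "\<forall>j\<ge>M. fps_nth (F - H * W - Q * W) j = 0"
      using Suc.IH[of "F - H * W"] by blast
    have eq: "F - (H + Q) * W = F - H * W - Q * W" by (simp add: algebra_simps)
    show ?thesis
    proof (intro bexI[of _ "H + Q"] conjI)
      show "\<forall>j\<ge>M. fps_nth (F - (H + Q) * W) j = 0" unfolding eq by (rule Q(3))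
      show "\<forall>j\<ge>Suc d. fps_nth (H + Q) j = 0" using Q(2) Hz by simp
    qed (intro cser_add H Q)
  qed
qed

lemma fps_truncated_as_sum:
  fixes f :: ser
  assumes "\<And>j. j \<ge> M \<Longrightarrow> fps_nth f j = 0"
  shows "f = (\<Sum>j<M. xser (fps_nth f j) * yvar ^ j)"
proof (rule fps_ext)
  fix k
  have "fps_nth (\<Sum>j<M. xser (fps_nth f j) * yvar ^ j) k = (\<Sum>j<M. if j = k then fps_nth f k else 0)"
    unfolding fps_sum_nth by (intro sum.cong refl) (auto simp: fps_X_power_nth)
  also have "\<dots> = fps_nth f k" using assms[of k] by (simp add: not_less)
  finally show "fps_nth f k = fps_nth (\<Sum>j<M. xser (fps_nth f j) * yvar ^ j) k" ..
qed

lemma nth_sum_yvar: "fps_nth (\<Sum>j<M. xser (v j) * yvar ^ j) k = (if k < M then v k else 0)"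
proof -
  have "fps_nth (\<Sum>j<M. xser (v j) * yvar ^ j) k = (\<Sum>j<M. if j = k then v k else 0)"
    unfolding fps_sum_nth by (intro sum.cong refl) (auto simp: fps_X_power_nth)
  thus ?thesis by simp
qed

lemma xindep_yvar: "xindep M (\<lambda>j. yvar ^ j)"
  unfolding xindep_def
proof (intro allI impI)
  fix v i assume v: "(\<Sum>j<M. xser (v j) * yvar ^ j) = 0" and i: "i < M"
  from arg_cong[OF v, of "\<lambda>f. fps_nth f i"] show "v i = 0" using i by (simp add: nth_sum_yvar)
qed

lemma xspan_yvar: "xspan M (\<lambda>j. yvar ^ j) = {f \<in> cser. \<forall>j\<ge>M. fps_nth f j = 0}"
proof (intro equalityI subsetI)
  fix f assume "f \<in> xspan M (\<lambda>j. yvar ^ j)"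
  then obtain v where v: "f = (\<Sum>j<M. xser (v j) * yvar ^ j)" "\<forall>j. v j \<in> conv1" by (auto simp: xspan_def)
  have "f \<in> cser" unfolding v(1) using v(2) by (intro cser_sum cser_mult cser_power xser_cser) auto
  thus "f \<in> {f \<in> cser. \<forall>j\<ge>M. fps_nth f j = 0}" unfolding v(1) by (simp add: nth_sum_yvar)
next
  fix f assume f: "f \<in> {f \<in> cser. \<forall>j\<ge>M. fps_nth f j = 0}"
  hence "f = (\<Sum>j<M. xser (fps_nth f j) * yvar ^ j)" by (intro fps_truncated_as_sum) auto
  thus "f \<in> xspan M (\<lambda>j. yvar ^ j)" unfolding xspan_def using f cser_nth[of f] by blast
qed

text \<open>Meaningful only if finitely many powers of y occur, as \<open>Abs_poly\<close>
  requires.\<close>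

definition spoly :: "ser \<Rightarrow> complex \<Rightarrow> complex poly" where
  "spoly f x = Abs_poly (fps_nth (slice f x))"

lemma coeff_spoly:
  assumes "\<And>j. j \<ge> d \<Longrightarrow> fps_nth f j = 0"
  shows "coeff (spoly f x) j = eval_fps (fps_nth f j) x"
  unfolding spoly_def by (subst coeff_Abs_poly[of d]) (use assms in auto)

lemma fps_of_poly_spoly:
  assumes "\<And>j. j \<ge> d \<Longrightarrow> fps_nth f j = 0"
  shows "fps_of_poly (spoly f x) = slice f x"
  by (rule fps_ext) (simp add: coeff_spoly[OF assms])

lemma poly_spoly:
  assumes "\<And>j. j \<ge> d \<Longrightarrow> fps_nth f j = 0"
  shows "poly (spoly f x) y = ev f x y"
  using fps_of_poly_spoly[OF assms, where x=x] by (metis ev_def eval_fps_of_poly)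

lemma conv_on_finite:
  assumes "finite I" "\<And>i. i \<in> I \<Longrightarrow> f i \<in> cser"
  obtains \<rho> where "\<rho> > 0" "\<And>i. i \<in> I \<Longrightarrow> conv_on \<rho> (f i)"
proof -
  have "\<exists>\<rho>>0. \<forall>i\<in>I. conv_on \<rho> (f i)"
    using assms
  proof (induction I rule: finite_induct)
    case empty thus ?case by (intro exI[of _ 1]) auto
  next
    case (insert k I)
    then obtain \<rho> where \<rho>: "\<rho> > 0" "\<forall>i\<in>I. conv_on \<rho> (f i)" by auto
    obtain \<sigma> where \<sigma>: "conv_on \<sigma> (f k)" using insert.prems by (auto simp: cser_def)
    show ?case using \<rho> \<sigma> conv_on_pos[OF \<sigma>]
      by (intro exI[of _ "min \<rho> \<sigma>"]) (auto intro: conv_on_mono)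
  qed
  thus ?thesis using that by blast
qed

lemma spoly_weierstrass:
  assumes "weierstrass_poly M W"
  shows "degree (spoly W x) = M" "lead_coeff (spoly W x) = 1"
proof -
  have c: "coeff (spoly W x) j = eval_fps (fps_nth W j) x" for j
    by (rule coeff_spoly[of "Suc M"]) (use assms in \<open>auto simp: weierstrass_poly_def\<close>)
  show "degree (spoly W x) = M"
    using assms by (intro antisym degree_le le_degree) (auto simp: c weierstrass_poly_def)
  thus "lead_coeff (spoly W x) = 1" using assms by (simp add: c weierstrass_poly_def)
qed

text \<open>By Weierstrass division the quotient by W is free over C{x} with basis 1, ...,
  \<open>y^(M-1)\<close>. The remainders of \<open>G * y^i\<close> span the image of the ideal, and
  D is the determinant of their coordinates. The values of D are recorded because its order is later
  found from them.\<close>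

theorem codim_idl_det:
  assumes W: "weierstrass_poly M W" and G: "G \<in> cser" "\<And>j. j > M \<Longrightarrow> fps_nth G j = 0"
  obtains D \<rho> where "D \<in> conv1" "\<rho> > 0"
    "\<And>x. norm x < \<rho> \<Longrightarrow> eval_fps D x = det (mod_mat (spoly W x) (spoly G x))"
    "D \<noteq> 0 \<Longrightarrow> codim cser (idl W G) (subdegree D)"
proof -
  have Wc: "W \<in> cser" and W0: "\<And>j. j > M \<Longrightarrow> fps_nth W j = 0" using W by (auto simp: weierstrass_poly_def)
  have "\<exists>Q\<in>cser. (\<forall>j\<ge>Suc M + i. fps_nth Q j = 0) \<and> (\<forall>j\<ge>M. fps_nth (G * yvar ^ i - Q * W) j = 0)" for i
    using G by (intro monic_division[OF W] cser_mult cser_power) (auto simp: fps_X_power_mult_right_nth)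
  then obtain Q where Q: "\<And>i. Q i \<in> cser" "\<And>i j. j \<ge> Suc M + i \<Longrightarrow> fps_nth (Q i) j = 0"
    "\<And>i j. j \<ge> M \<Longrightarrow> fps_nth (G * yvar ^ i - Q i * W) j = 0" by metis
  define R where "R i = G * yvar ^ i - Q i * W" for i
  have R: "R i \<in> cser" "\<And>j. j \<ge> M \<Longrightarrow> fps_nth (R i) j = 0" for i
    using Q G Wc by (auto simp: R_def intro!: cser_diff cser_mult cser_power)
  define T where "T = mat M M (\<lambda>(i,j). fps_nth (R i) j)"
  have T: "T \<in> carrier_mat M M" "\<And>i j. i < M \<Longrightarrow> j < M \<Longrightarrow> T $$ (i,j) \<in> conv1"
    using R by (auto simp: T_def intro: cser_nth)
  let ?e = "\<lambda>j. yvar ^ j :: ser"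
  have rc: "rowcomb M T ?e i = R i" if "i < M" for i
    using fps_truncated_as_sum[of M "R i"] R that by (simp add: rowcomb_def T_def)
  obtain \<rho>0 where \<rho>0: "\<rho>0 > 0" "\<And>i. i \<in> {..<M} \<Longrightarrow> conv_on \<rho>0 (Q i)"
    using conv_on_finite[of "{..<M}" Q] Q by blast
  obtain \<rho>1 where \<rho>1: "\<rho>1 > 0" "\<And>i. i \<in> {..<M} \<Longrightarrow> conv_on \<rho>1 (R i)"
    using conv_on_finite[of "{..<M}" R] R by blast
  obtain \<rho>2 where \<rho>2: "conv_on \<rho>2 W" "conv_on \<rho>2 G" using cser_conv_on2[OF Wc G(1)] by blast
  define \<rho> where "\<rho> = min \<rho>0 (min \<rho>1 \<rho>2)"
  have pos: "\<rho> > 0" using \<rho>0 \<rho>1 conv_on_pos[OF \<rho>2(1)] by (simp add: \<rho>_def)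
  have con: "conv_on \<rho> W" "conv_on \<rho> G" "\<And>i. i < M \<Longrightarrow> conv_on \<rho> (Q i)" "\<And>i. i < M \<Longrightarrow> conv_on \<rho> (R i)"
    using conv_on_mono[OF \<rho>2(1) pos] conv_on_mono[OF \<rho>2(2) pos] conv_on_mono[OF \<rho>0(2) pos]
      conv_on_mono[OF \<rho>1(2) pos] by (auto simp: \<rho>_def)
  show ?thesis
  proof (rule that[of "det T" \<rho>])
    show "det T \<in> conv1" by (rule conv1_det[OF T])
    show "\<rho> > 0" by (rule pos)
    fix x :: complex assume x: "norm x < \<rho>"
    have rem: "spoly (R i) x = (spoly G x * monom 1 i) mod spoly W x" if i: "i < M" for i
    proof -
      have "slice (R i + Q i * W) x = slice (R i) x + slice (Q i) x * slice W x"
        using con i x by (simp add: slice_add[of \<rho>] slice_mult[of \<rho>] conv_on_mult)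
      moreover have "slice (G * yvar ^ i) x = slice G x * fps_X ^ i"
      proof (induction i)
        case (Suc i)
        have "slice ((G * yvar ^ i) * yvar) x = slice (G * yvar ^ i) x * slice yvar x"
          using con pos x by (intro slice_mult[of \<rho>] conv_on_mult conv_on_power conv_on_yvar)
        thus ?case using Suc by (simp add: mult.assoc mult.commute[of fps_X])
      qed simp
      ultimately have "slice G x * fps_X ^ i = slice (R i) x + slice (Q i) x * slice W x"
        by (simp add: R_def)
      hence "fps_of_poly (spoly G x) * fps_of_poly (monom 1 i)
          = fps_of_poly (spoly (R i) x) + fps_of_poly (spoly (Q i) x) * fps_of_poly (spoly W x)"
        using fps_of_poly_spoly[of "Suc M" G x] fps_of_poly_spoly[of M "R i" x]
          fps_of_poly_spoly[of "Suc M" W x] fps_of_poly_spoly[of "Suc M + i" "Q i" x] G R Q W0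
        by (simp add: fps_of_poly_monom)
      hence eq: "spoly G x * monom 1 i = spoly (R i) x + spoly (Q i) x * spoly W x"
        by (simp flip: fps_of_poly_mult fps_of_poly_add)
      have "spoly (R i) x mod spoly W x = spoly (R i) x"
      proof (rule mod_poly_less)
        show "degree (spoly (R i) x) < degree (spoly W x)"
          unfolding spoly_weierstrass(1)[OF W] using i R
          by (intro degree_lessI) (auto simp: coeff_spoly[of M])
      qed
      thus ?thesis by (simp add: eq)
    qed
    have "map_mat (\<lambda>f. eval_fps f x) T = mod_mat (spoly W x) (spoly G x)"
    proof (rule eq_matI)
      fix i j assume "i < dim_row (mod_mat (spoly W x) (spoly G x))" "j < dim_col (mod_mat (spoly W x) (spoly G x))"
      hence "i < M" "j < M" by (simp_all add: mod_mat_def spoly_weierstrass(1)[OF W])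
      thus "map_mat (\<lambda>f. eval_fps f x) T $$ (i,j) = mod_mat (spoly W x) (spoly G x) $$ (i,j)"
        using rem[of i] coeff_spoly[of M "R i" x j] R by (simp add: T_def mod_mat_def spoly_weierstrass(1)[OF W])
    qed (simp_all add: T_def mod_mat_def spoly_weierstrass(1)[OF W])
    moreover have "eval_fps (det T) x = det (map_mat (\<lambda>f. eval_fps f x) T)"
    proof -
      have ent: "evaluable x (T $$ (i,j))" if "i < M" "j < M" for i j
        using that conv_on_evaluable[OF con(4) x] by (simp add: T_def)
      have pin: "p i < M" if "p permutes {0..<M}" "i < M" for p i
        using permutes_in_image[OF that(1), of i] that(2) by simp
      have sg: "evaluable x (signof p)" "eval_fps (signof p) x = signof p" for p :: "nat \<Rightarrow> nat"
        by (simp_all add: sign_def eval_fps_minus)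
      have pr: "evaluable x (\<Prod>i=0..<M. T $$ (i, p i)) \<and>
          eval_fps (\<Prod>i=0..<M. T $$ (i, p i)) x = (\<Prod>i=0..<M. eval_fps (T $$ (i, p i)) x)"
        if "p permutes {0..<M}" for p
        by (rule eval_fps_prod_evaluable) (use ent pin[OF that] in auto)
      have "eval_fps (det T) x = (\<Sum>p | p permutes {0..<M}. eval_fps (signof p * (\<Prod>i=0..<M. T $$ (i, p i))) x)"
        unfolding det_def'[OF T(1)]
        by (intro conjunct2[OF eval_fps_sum_evaluable] evaluable_mult sg) (use pr in auto)
      also have "\<dots> = (\<Sum>p | p permutes {0..<M}. signof p * (\<Prod>i=0..<M. eval_fps (T $$ (i, p i)) x))"
        by (intro sum.cong refl) (use pr sg in \<open>auto simp: eval_fps_mult\<close>)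
      also have "\<dots> = det (map_mat (\<lambda>f. eval_fps f x) T)"
        using T(1) pin by (subst det_def'[where n=M]) (auto intro!: sum.cong prod.cong)
      finally show ?thesis .
    qed
    ultimately show "eval_fps (det T) x = det (mod_mat (spoly W x) (spoly G x))" by simp
  next
    assume d: "det T \<noteq> 0"
    have cod: "codim (xspan M ?e) (xspan M (rowcomb M T ?e)) (subdegree (det T))"
      using codim_xspan_rowcomb[OF xindep_yvar T d] by simp
    have Rspan: "xspan M (rowcomb M T ?e) = xspan M R"
      unfolding xspan_def using rc by simp
    show "codim cser (idl W G) (subdegree (det T))"
    proof (rule codim_map[OF cod, where D=1])
      show "subsp (xspan M ?e)" by (intro xmod_subsp xmod_xspan)
      show "subsp (idl W G)" by (rule subsp_idl)
      show "1 * v \<in> cser" if "v \<in> xspan M ?e" for v using that by (simp add: xspan_yvar)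
      show "\<exists>v\<in>xspan M ?e. v' - 1 * v \<in> idl W G" if v': "v' \<in> cser" for v'
      proof -
        obtain q where q: "q \<in> cser" "\<And>j. j \<ge> M \<Longrightarrow> fps_nth (v' - q * W) j = 0"
          using weierstrass_division[OF Wc weierstrass_poly_regular[OF W] v'] by blast
        have "v' - q * W \<in> xspan M ?e"
          using q v' Wc by (auto simp: xspan_yvar intro: cser_diff cser_mult)
        moreover have "v' - 1 * (v' - q * W) = q * W + 0 * G" by simp
        ultimately show ?thesis unfolding idl_def using q(1) cser_0 by blast
      qed
      show "1 * w \<in> idl W G" if w: "w \<in> xspan M (rowcomb M T ?e)" for w
      proof -
        obtain v where v: "w = (\<Sum>i<M. xser (v i) * R i)" "\<forall>i. v i \<in> conv1"
          using w unfolding Rspan by (auto simp: xspan_def)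
        have "w = (- (\<Sum>i<M. xser (v i) * Q i)) * W + (\<Sum>i<M. xser (v i) * yvar ^ i) * G"
          unfolding v R_def by (simp add: algebra_simps sum_subtractf sum_distrib_left)
        moreover have "- (\<Sum>i<M. xser (v i) * Q i) \<in> cser" "(\<Sum>i<M. xser (v i) * yvar ^ i) \<in> cser"
          using v Q by (auto intro!: cser_uminus cser_sum cser_mult xser_cser cser_power)
        ultimately show ?thesis unfolding idl_def by (auto simp del: mult_minus_left)
      qed
      \<comment> \<open>Reducing the coefficient b of G modulo W writes v as a combination s of the
        \<open>R i\<close> plus a multiple of W. As v - s has y-degree below M, uniqueness of
        division makes this multiple 0.\<close>
      show "v \<in> xspan M (rowcomb M T ?e)" if v: "v \<in> xspan M ?e" "1 * v \<in> idl W G" for v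
      proof -
        obtain a b where ab: "v = a * W + b * G" "a \<in> cser" "b \<in> cser" using v by (auto simp: idl_def)
        obtain q where q: "q \<in> cser" "\<And>j. j \<ge> M \<Longrightarrow> fps_nth (b - q * W) j = 0"
          using weierstrass_division[OF Wc weierstrass_poly_regular[OF W] ab(3)] by blast
        define b' where "b' = b - q * W"
        have b': "b' = (\<Sum>i<M. xser (fps_nth b' i) * yvar ^ i)"
          using q(2) unfolding b'_def by (rule fps_truncated_as_sum)
        have b'c: "b' \<in> cser" using ab q Wc by (auto simp: b'_def intro: cser_diff cser_mult)
        define s where "s = (\<Sum>i<M. xser (fps_nth b' i) * R i)"
        have "b' * G = s + (\<Sum>i<M. xser (fps_nth b' i) * Q i) * W"
          unfolding s_def R_def by (subst b') (simp add: algebra_simps sum_subtractf sum_distrib_left)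
        hence "v - s = (a + q * G + (\<Sum>i<M. xser (fps_nth b' i) * Q i)) * W"
          unfolding ab(1) by (simp add: b'_def algebra_simps)
        moreover have "fps_nth (v - s) j = 0" if "j \<ge> M" for j
          using v(1) R that by (auto simp: xspan_yvar s_def fps_sum_nth)
        ultimately have "a + q * G + (\<Sum>i<M. xser (fps_nth b' i) * Q i) = 0"
          by (intro weierstrass_division_unique[OF weierstrass_poly_regular[OF W]]) simp
        hence "v = s" using \<open>v - s = _ * W\<close> by simp
        also have "s \<in> xspan M R" unfolding s_def xspan_def using cser_nth[OF b'c] by blast
        finally show ?thesis by (simp add: Rspan)
      qed
    qed
  qed
qed

subsection \<open>Conjugation of coefficients\<close>

definition cnjf :: "complex fps \<Rightarrow> complex fps" where
  "cnjf f = Abs_fps (\<lambda>i. cnj (fps_nth f i))"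

definition bar :: "ser \<Rightarrow> ser" where
  "bar f = Abs_fps (\<lambda>j. cnjf (fps_nth f j))"

lemma cnjf_nth [simp]: "fps_nth (cnjf f) i = cnj (fps_nth f i)"
  by (simp add: cnjf_def)

lemma bar_nth [simp]: "fps_nth (bar f) j = cnjf (fps_nth f j)"
  by (simp add: bar_def)

lemma cnjf_simps [simp]: "cnjf 0 = 0" "cnjf 1 = 1"
  by (auto intro!: fps_ext)

lemma bar_mult: "bar (f * g) = bar f * bar g"
  by (rule ser_eqI) (simp add: cf_mult cnj_sum)

lemma conv_on_bar: "conv_on \<rho> f \<Longrightarrow> conv_on \<rho> (bar f)"
  by (simp add: conv_on_def bnd_def sqsum_def)

lemma cser_bar: "f \<in> cser \<Longrightarrow> bar f \<in> cser"
  unfolding cser_def using conv_on_bar by blast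

lemma radius_cnjf [simp]: "fps_conv_radius (cnjf f) = fps_conv_radius f"
proof -
  have "conv_radius (\<lambda>n. norm (fps_nth (cnjf f) n)) = conv_radius (\<lambda>n. norm (fps_nth f n))" by simp
  thus ?thesis by (simp only: conv_radius_norm fps_conv_radius_def)
qed

lemma conv1_cnjf: "f \<in> conv1 \<Longrightarrow> cnjf f \<in> conv1"
  by (simp add: conv1_def)

lemma eval_cnjf:
  assumes "evaluable x f"
  shows "eval_fps (cnjf f) (cnj x) = cnj (eval_fps f x)"
proof -
  have "cnj (\<Sum>n. fps_nth f n * x ^ n) = (\<Sum>n. cnj (fps_nth f n * x ^ n))"
    by (rule bounded_linear.suminf[OF bounded_linear_cnj summable_fps[OF assms]])
  thus ?thesis by (simp add: eval_fps_def)
qed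

lemma eval_cnjf_real:
  assumes "evaluable (of_real x) f"
  shows "eval_fps (cnjf f) (of_real x) = cnj (eval_fps f (of_real x))"
  using eval_cnjf[OF assms] by simp

lemma slice_bar_real:
  assumes "conv_on \<rho> f" "norm (complex_of_real x) < \<rho>"
  shows "slice (bar f) (of_real x) = cnjf (slice f (of_real x))"
  by (rule fps_ext) (simp only: slice_nth bar_nth cnjf_nth eval_cnjf_real[OF conv_on_evaluable[OF assms]])

lemma ev_bar_real:
  assumes "conv_on \<rho> f" "norm (complex_of_real x) < \<rho>" "norm y < \<rho>"
  shows "ev (bar f) (of_real x) (cnj y) = cnj (ev f (of_real x) y)"
  unfolding ev_def slice_bar_real[OF assms(1,2)]
  by (rule eval_cnjf[OF conv_on_slice_evaluable[OF assms]])

subsection \<open>Comparison of stable polynomials on a half disc\<close>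

abbreviation lin_prod :: "complex list \<Rightarrow> complex poly" where
  "lin_prod as \<equiv> \<Prod>a\<leftarrow>as. [:-a, 1:]"

lemma poly_lin_prod: "poly (lin_prod as) z = (\<Prod>a\<leftarrow>as. z - a)"
  by (induction as) (auto simp: algebra_simps)

lemma norm_lin_prod_upper:
  "(\<And>a. a \<in> set as \<Longrightarrow> norm (z - a) \<le> c) \<Longrightarrow> norm (poly (lin_prod as) z) \<le> c ^ length as"
  unfolding poly_lin_prod
proof (induction as)
  case (Cons a as)
  have "norm ((z - a) * (\<Prod>a\<leftarrow>as. z - a)) \<le> c * c ^ length as"
    unfolding norm_mult using Cons order_trans[OF norm_ge_zero, of "z - a" c]
    by (intro mult_mono) auto
  thus ?case by simp
qed simp

lemma norm_lin_prod_lower: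
  "(\<And>a. a \<in> set as \<Longrightarrow> norm (z - a) \<ge> c) \<Longrightarrow> c \<ge> 0 \<Longrightarrow> norm (poly (lin_prod as) z) \<ge> c ^ length as"
  unfolding poly_lin_prod
proof (induction as)
  case (Cons a as)
  have "norm ((z - a) * (\<Prod>a\<leftarrow>as. z - a)) \<ge> c * c ^ length as"
    unfolding norm_mult using Cons by (intro mult_mono) auto
  thus ?case by simp
qed simp

text \<open>The maximum principle for the quotient of the two products on the half disc. The
  diameter is covered by the hypothesis; on the arc each factor of the numerator is at most
  3\<rho>/2 and each factor of the denominator at least \<rho>/2, whence the power of 3.\<close>

lemma half_disc_bound:
  fixes as bs :: "complex list"
  assumes \<rho>: "\<rho> > 0" and len: "length as = length bs"
    and as: "\<And>a. a \<in> set as \<Longrightarrow> norm a \<le> \<rho> / 2"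
    and bs: "\<And>b. b \<in> set bs \<Longrightarrow> Im b < 0 \<and> norm b \<le> \<rho> / 2"
    and C: "C \<ge> 3 ^ length bs"
    and real: "\<And>t::real. \<bar>t\<bar> \<le> \<rho> \<Longrightarrow> norm (poly (lin_prod as) (of_real t)) \<le> C * norm (poly (lin_prod bs) (of_real t))"
    and z: "Im z \<ge> 0" "norm z \<le> \<rho>"
  shows "norm (poly (lin_prod as) z) \<le> C * norm (poly (lin_prod bs) z)"
proof -
  define S where "S = {z. Im z \<ge> 0} \<inter> cball 0 \<rho>"
  define f where "f z = poly (lin_prod as) z / poly (lin_prod bs) z" for z
  have nz: "poly (lin_prod bs) z \<noteq> 0" if "Im z \<ge> 0" for z
  proof
    assume "poly (lin_prod bs) z = 0"
    then obtain b where "b \<in> set bs" "z = b" by (auto simp: poly_lin_prod prod_list_zero_iff)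
    thus False using bs that by force
  qed
  have "closed S" unfolding S_def by (intro closed_Int closed_cball closed_halfspace_Im_ge)
  have "f holomorphic_on S"
    unfolding f_def by (intro holomorphic_intros) (auto simp: S_def nz)
  hence hol: "f holomorphic_on interior S" and cont: "continuous_on (closure S) f"
    using \<open>closed S\<close> interior_subset by (auto intro: holomorphic_on_subset holomorphic_on_imp_continuous_on)
  have "norm (f z) \<le> C"
  proof (rule maximum_modulus_frontier[OF hol cont])
    show "bounded S" unfolding S_def by (simp add: bounded_Int)
    show "z \<in> S" using z by (simp add: S_def)
    fix u assume u: "u \<in> frontier S"
    hence uS: "u \<in> S" using \<open>closed S\<close> by (simp add: frontier_def)
    have "\<not> (Im u > 0 \<and> norm u < \<rho>)"
    proof
      assume "Im u > 0 \<and> norm u < \<rho>"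
      moreover have "open ({z. Im z > 0} \<inter> ball 0 \<rho>)" by (intro open_Int open_halfspace_Im_gt open_ball)
      moreover have "{z. Im z > 0} \<inter> ball 0 \<rho> \<subseteq> S" by (auto simp: S_def)
      ultimately have "u \<in> interior S" by (intro interiorI[of "{z. Im z > 0} \<inter> ball 0 \<rho>"]) auto
      thus False using u by (simp add: frontier_def)
    qed
    hence cs: "Im u = 0 \<or> norm u = \<rho>" using uS by (auto simp: S_def)
    have "norm (poly (lin_prod as) u) \<le> C * norm (poly (lin_prod bs) u)"
    proof (cases "norm u = \<rho>")
      case True
      have "norm (poly (lin_prod as) u) \<le> (3 * (\<rho> / 2)) ^ length as"
      proof (rule norm_lin_prod_upper)
        fix a assume "a \<in> set as"
        thus "norm (u - a) \<le> 3 * (\<rho> / 2)" using as[of a] True norm_triangle_ineq4[of u a] by simp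
      qed
      also have "\<dots> = 3 ^ length bs * (\<rho> / 2) ^ length bs"
        unfolding len by (simp only: power_mult_distrib)
      also have "\<dots> \<le> C * norm (poly (lin_prod bs) u)"
      proof (intro mult_mono C norm_lin_prod_lower)
        fix b assume "b \<in> set bs"
        thus "\<rho> / 2 \<le> norm (u - b)" using bs[of b] True norm_triangle_ineq2[of u b] by simp
      qed (use \<rho> C in \<open>auto intro: order_trans[of 0 "3 ^ length bs"]\<close>)
      finally show ?thesis .
    next
      case False
      hence "u = of_real (Re u)" using cs by (simp add: complex_eq_iff)
      moreover have "\<bar>Re u\<bar> \<le> \<rho>" using uS abs_Re_le_cmod[of u] by (simp add: S_def)
      ultimately show ?thesis using real[of "Re u"] by metis
    qed
    thus "norm (f u) \<le> C" using nz[of u] uS by (simp add: f_def S_def norm_divide field_simps)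
  qed
  thus ?thesis using nz[OF z(1)] by (simp add: f_def norm_divide field_simps)
qed

text \<open>The modulus of the resultant of the monic polynomial with roots \<open>as\<close> and
  its conjugate.\<close>

definition self_res :: "complex list \<Rightarrow> real" where
  "self_res as = (\<Prod>a\<leftarrow>as. norm (poly (lin_prod as) (cnj a)))"

lemma prod_list_map_mult: "(\<Prod>b\<leftarrow>bs. f b * g b :: real) = (\<Prod>b\<leftarrow>bs. f b) * (\<Prod>b\<leftarrow>bs. g b)"
  by (induction bs) auto

text \<open>Both sides are the product of all distances |cnj a - b|, and |cnj a - b| = |cnj b -
  a|.\<close>

lemma res_swap:
  "(\<Prod>a\<leftarrow>as. norm (poly (lin_prod bs) (cnj a))) = (\<Prod>b\<leftarrow>bs. norm (poly (lin_prod as) (cnj b)))"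
proof (induction as)
  case Nil thus ?case by (induction bs) auto
next
  case (Cons a as)
  have "norm (poly (lin_prod bs) (cnj a)) = (\<Prod>b\<leftarrow>bs. norm (cnj b - a))"
  proof (induction bs)
    case (Cons b bs)
    have "norm (cnj a - b) = norm (cnj (cnj a - b))" by (simp only: complex_mod_cnj)
    also have "\<dots> = norm (cnj b - a)" by (simp add: norm_minus_commute)
    finally show ?case using Cons unfolding poly_lin_prod by (simp add: norm_mult)
  qed simp
  thus ?case using Cons unfolding poly_lin_prod by (simp add: norm_mult prod_list_map_mult)
qed

lemma prod_list_mono:
  fixes f g :: "'a \<Rightarrow> real"
  assumes "\<And>x. x \<in> set xs \<Longrightarrow> 0 \<le> f x \<and> f x \<le> g x"
  shows "(\<Prod>x\<leftarrow>xs. f x) \<le> (\<Prod>x\<leftarrow>xs. g x)"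
proof -
  have "0 \<le> (\<Prod>x\<leftarrow>xs. f x) \<and> (\<Prod>x\<leftarrow>xs. f x) \<le> (\<Prod>x\<leftarrow>xs. g x)"
    using assms by (induction xs) (auto intro!: mult_mono intro: order_trans)
  thus ?thesis ..
qed

text \<open>The bound is used twice: at the points \<open>cnj a\<close> and, after swapping the roles in the mixed resultant, at \<open>cnj b\<close>.\<close>
lemma self_res_le:
  assumes \<rho>: "\<rho> > 0" and len: "length as = length bs"
    and as: "\<And>a. a \<in> set as \<Longrightarrow> Im a < 0 \<and> norm a \<le> \<rho> / 2"
    and bs: "\<And>b. b \<in> set bs \<Longrightarrow> Im b < 0 \<and> norm b \<le> \<rho> / 2"
    and C: "C \<ge> 3 ^ length bs"
    and real: "\<And>t::real. \<bar>t\<bar> \<le> \<rho> \<Longrightarrow> norm (poly (lin_prod as) (of_real t)) \<le> C * norm (poly (lin_prod bs) (of_real t))"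
  shows "self_res as \<le> C ^ (2 * length bs) * self_res bs"
proof -
  have C0: "C \<ge> 0" using C by (auto intro: order_trans[of 0 "3 ^ length bs"])
  have up: "norm (poly (lin_prod as) (cnj c)) \<le> C * norm (poly (lin_prod bs) (cnj c))"
    if "Im c < 0" "norm c \<le> \<rho> / 2" for c
    by (rule half_disc_bound[OF \<rho> len _ bs C real]) (use that as \<rho> in auto)
  have const: "(\<Prod>c\<leftarrow>cs. C * g c) = C ^ length cs * (\<Prod>c\<leftarrow>cs. g c)" for cs and g :: "complex \<Rightarrow> real"
    by (induction cs) auto
  have "self_res as \<le> (\<Prod>a\<leftarrow>as. C * norm (poly (lin_prod bs) (cnj a)))"
    unfolding self_res_def using up as by (intro prod_list_mono) auto
  also have "\<dots> = C ^ length bs * (\<Prod>b\<leftarrow>bs. norm (poly (lin_prod as) (cnj b)))"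
    by (simp only: const res_swap len)
  also have "\<dots> \<le> C ^ length bs * (\<Prod>b\<leftarrow>bs. C * norm (poly (lin_prod bs) (cnj b)))"
    using up bs C0 by (intro mult_left_mono prod_list_mono) auto
  also have "\<dots> = C ^ (2 * length bs) * self_res bs"
    by (simp only: const self_res_def mult_2 power_add mult.assoc)
  finally show ?thesis .
qed

subsection \<open>Orders of vanishing from growth on the positive axis\<close>

lemma tendsto_eval_fps_at_right:
  assumes "f \<in> conv1"
  shows "((\<lambda>x::real. eval_fps f (of_real x)) \<longlongrightarrow> fps_nth f 0) (at_right 0)"
proof -
  have "isCont (eval_fps f) 0" using assms by (intro continuous_eval_fps) (simp add: conv1_def zero_ereal_def)
  moreover have "((\<lambda>x::real. complex_of_real x) \<longlongrightarrow> of_real 0) (at_right 0)" by (intro tendsto_intros)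
  ultimately have "((\<lambda>x::real. eval_fps f (of_real x)) \<longlongrightarrow> eval_fps f 0) (at_right 0)"
    by (intro isCont_tendsto_compose[of 0 "eval_fps f"]) auto
  thus ?thesis by (simp add: eval_fps_at_0)
qed

lemma eventually_small_real: "\<rho> > 0 \<Longrightarrow> \<forall>\<^sub>F x in at_right (0::real). 0 < x \<and> norm (complex_of_real x) < \<rho>"
  unfolding eventually_at_right_field by (intro exI[of _ \<rho>]) auto

lemma conv1_radius:
  assumes "f \<in> conv1"
  obtains \<rho> where "\<rho> > 0" "\<And>x. norm x < \<rho> \<Longrightarrow> evaluable x f"
proof -
  obtain r where "0 < ereal r" "ereal r < fps_conv_radius f"
    using assms ereal_dense2[of 0 "fps_conv_radius f"] by (auto simp: conv1_def)
  thus ?thesis by (intro that[of r]) (auto intro: less_trans[of _ "ereal r"])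
qed

lemma eventually_evaluable: "f \<in> conv1 \<Longrightarrow> \<forall>\<^sub>F x in at_right (0::real). evaluable (of_real x) f"
  by (erule conv1_radius) (rule eventually_mono[OF eventually_small_real], blast+)

lemma eval_fps_subdegree:
  assumes "evaluable x f"
  shows "eval_fps f x = x ^ subdegree f * eval_fps (fps_shift (subdegree f) f) x"
proof -
  have "eval_fps (fps_shift (subdegree f) f * fps_X ^ subdegree f) x
      = eval_fps (fps_shift (subdegree f) f) x * x ^ subdegree f"
    using assms by (subst eval_fps_mult) auto
  thus ?thesis by (simp add: mult.commute flip: subdegree_decompose)
qed

text \<open>If g vanished to higher order than f, dividing by the power of x in f and letting x tend
  to 0 would make the leading coefficient of f vanish.\<close>

lemma subdegree_le_of_growth:
  assumes f: "f \<in> conv1" "f \<noteq> 0" and g: "g \<in> conv1"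
    and le: "\<forall>\<^sub>F x in at_right (0::real). norm (eval_fps f (of_real x)) \<le> C * norm (eval_fps g (of_real x))"
  shows "subdegree g \<le> subdegree f"
proof (rule ccontr)
  assume less: "\<not> subdegree g \<le> subdegree f"
  define m where "m = subdegree f"
  define n where "n = subdegree g"
  have mn: "m < n" using less by (simp add: m_def n_def)
  define f1 where "f1 = fps_shift m f"
  define g1 where "g1 = fps_shift n g"
  have fg1: "f1 \<in> conv1" "g1 \<in> conv1" using f g by (simp_all add: f1_def g1_def conv1_shift)
  have "\<forall>\<^sub>F x in at_right (0::real). norm (eval_fps f1 (of_real x)) \<le> C * (x ^ (n - m) * norm (eval_fps g1 (of_real x)))"
    using le eventually_evaluable[OF f(1)] eventually_evaluable[OF g] eventually_at_right_less[of 0]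
  proof eventually_elim
    case (elim x)
    have "x ^ m * norm (eval_fps f1 (of_real x)) \<le> C * (x ^ n * norm (eval_fps g1 (of_real x)))"
      using elim eval_fps_subdegree[OF elim(2)] eval_fps_subdegree[OF elim(3)]
      by (simp add: norm_mult norm_power f1_def g1_def m_def n_def)
    also have "\<dots> = x ^ m * (C * (x ^ (n - m) * norm (eval_fps g1 (of_real x))))"
      using mn by (simp add: mult.left_commute mult.assoc[symmetric] flip: power_add)
    finally show ?case using elim(4) by simp
  qed
  moreover have "((\<lambda>x. norm (eval_fps f1 (of_real x))) \<longlongrightarrow> norm (fps_nth f1 0)) (at_right 0)"
    by (intro tendsto_norm tendsto_eval_fps_at_right fg1)
  moreover have "((\<lambda>x. C * (x ^ (n - m) * norm (eval_fps g1 (of_real x)))) \<longlongrightarrow> C * (0 ^ (n - m) * norm (fps_nth g1 0))) (at_right (0::real))"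
    by (intro tendsto_intros tendsto_eval_fps_at_right fg1)
  ultimately have "norm (fps_nth f1 0) \<le> C * (0 ^ (n - m) * norm (fps_nth g1 0))"
    by (intro tendsto_le[of "at_right (0::real)"]) auto
  hence "fps_nth f1 0 = 0" using mn by (simp add: power_0_left)
  thus False using f(2) by (simp add: f1_def m_def)
qed

subsection \<open>The intersection number of a stable Weierstrass polynomial\<close>

text \<open>A root with |z| \<ge> \<eta> gives
  \<open>norm z ^ M \<le> norm z ^ M * \<phi> x\<close>, where \<phi> collects the lower
  coefficients. These vanish at x = 0, so \<phi> x drops below 1.\<close>

lemma weierstrass_roots_small:
  assumes W: "weierstrass_poly M W" and \<eta>: "\<eta> > 0"
  shows "\<forall>\<^sub>F x in at_right (0::real). \<forall>z. poly (spoly W (of_real x)) z = 0 \<longrightarrow> norm z < \<eta>"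
proof -
  define \<phi> where "\<phi> x = (\<Sum>j<M. norm (eval_fps (fps_nth W j) (of_real x)) * (1 / \<eta>) ^ (M - j))" for x :: real
  have "(\<phi> \<longlongrightarrow> (\<Sum>j<M. norm (cf W 0 j) * (1 / \<eta>) ^ (M - j))) (at_right 0)"
    unfolding \<phi>_def using W
    by (intro tendsto_sum tendsto_mult tendsto_norm tendsto_eval_fps_at_right tendsto_const cser_nth)
       (simp add: weierstrass_poly_def)
  moreover have "(\<Sum>j<M. norm (cf W 0 j) * (1 / \<eta>) ^ (M - j)) = 0"
    using W by (intro sum.neutral) (auto simp: weierstrass_poly_def)
  ultimately have "\<forall>\<^sub>F x in at_right 0. \<phi> x < 1" by (auto dest: order_tendstoD(2)[of _ _ _ 1])
  thus ?thesis
  proof eventually_elim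
    case (elim x)
    show ?case
    proof (intro allI impI, rule ccontr)
      fix z assume z: "poly (spoly W (of_real x)) z = 0" and "\<not> norm z < \<eta>"
      hence t: "norm z \<ge> \<eta>" "norm z > 0" using \<eta> by auto
      define c where "c j = eval_fps (fps_nth W j) (of_real x)" for j
      have co: "coeff (spoly W (of_real x)) j = c j" for j
        unfolding c_def by (rule coeff_spoly[of "Suc M"]) (use W in \<open>auto simp: weierstrass_poly_def\<close>)
      have "poly (spoly W (of_real x)) z = (\<Sum>j\<le>M. c j * z ^ j)"
        unfolding poly_altdef spoly_weierstrass(1)[OF W] co ..
      also have "\<dots> = (\<Sum>j<M. c j * z ^ j) + z ^ M"
        using W by (simp add: lessThan_Suc_atMost[symmetric] c_def weierstrass_poly_def)
      finally have "z ^ M = - (\<Sum>j<M. c j * z ^ j)" using z by (simp add: eq_neg_iff_add_eq_0 add.commute)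
      hence "norm (z ^ M) = norm (\<Sum>j<M. c j * z ^ j)" by (simp only: norm_minus_cancel)
      also have "\<dots> \<le> (\<Sum>j<M. norm (c j * z ^ j))" by (rule norm_sum)
      finally have "norm z ^ M \<le> (\<Sum>j<M. norm (c j) * norm z ^ j)" by (simp add: norm_mult norm_power)
      also have "(\<Sum>j<M. norm (c j) * norm z ^ j) \<le> (\<Sum>j<M. norm z ^ M * (norm (c j) * (1 / \<eta>) ^ (M - j)))"
      proof (intro sum_mono)
        fix j assume j: "j \<in> {..<M}"
        have "norm z ^ j * 1 \<le> norm z ^ j * (norm z / \<eta>) ^ (M - j)"
          using t \<eta> by (intro mult_left_mono one_le_power) auto
        also have "\<dots> = norm z ^ M * (1 / \<eta>) ^ (M - j)"
          using j by (simp add: power_divide flip: power_add)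
        finally show "norm (c j) * norm z ^ j \<le> norm z ^ M * (norm (c j) * (1 / \<eta>) ^ (M - j))"
          using mult_left_mono[of "norm z ^ j" "norm z ^ M * (1 / \<eta>) ^ (M - j)" "norm (c j)"]
          by (simp add: mult.left_commute)
      qed
      also have "\<dots> = norm z ^ M * \<phi> x" by (simp add: \<phi>_def c_def sum_distrib_left)
      also have "\<dots> < norm z ^ M * 1" using elim t by (intro mult_strict_left_mono) auto
      finally show False by simp
    qed
  qed
qed

lemma monic_poly_splits:
  assumes "lead_coeff w = 1"
  obtains as where "w = lin_prod as" "length as = degree w"
proof -
  define A where "A = proots w"
  have A: "Polynomial.smult (lead_coeff w) (\<Prod>a\<in>#A. [:-a, 1:]) = w"
    unfolding A_def by (rule complex_poly_decompose_multiset)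
  obtain as where as: "mset as = A" using ex_mset by blast
  have "(\<Prod>a\<in>#mset as. [:-a, 1:]) = lin_prod as" by (induction as) auto
  hence w: "w = lin_prod as" using A as assms by simp
  have "lin_prod as \<noteq> 0 \<and> degree (lin_prod as) = length as"
    by (induction as) (auto simp: degree_mult_eq simp del: mult_pCons_left)
  hence "degree (lin_prod as) = length as" ..
  thus ?thesis using w that by metis
qed

text \<open>Two convergent series are compared: the determinant D and the product R of all
  differences \<open>cnjf (b j) - b k\<close>. At small real x their moduli are the self-resultants
  of the roots of W and of the values \<open>b k\<close>; \<open>self_res_le\<close> in both
  directions makes their orders equal.\<close>

theorem codim_idl_stable:
  fixes b :: "nat \<Rightarrow> complex fps"
  assumes W: "weierstrass_poly M W"
    and b: "\<And>k. k < M \<Longrightarrow> b k \<in> conv1" "\<And>k. k < M \<Longrightarrow> fps_nth (b k) 0 = 0"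
    and bl: "\<And>k. k < M \<Longrightarrow> \<forall>\<^sub>F x in at_right (0::real). Im (eval_fps (b k) (of_real x)) < 0"
    and Wl: "\<epsilon> > 0" "\<forall>\<^sub>F x in at_right (0::real). \<forall>z. norm z < \<epsilon> \<longrightarrow> ev W (of_real x) z = 0 \<longrightarrow> Im z < 0"
    and cmp: "\<forall>\<^sub>F x in at_right (0::real). \<forall>y::real. \<bar>y\<bar> < \<epsilon> \<longrightarrow>
        norm (ev W (of_real x) (of_real y)) \<le> C * norm (\<Prod>k<M. of_real y - eval_fps (b k) (of_real x)) \<and>
        norm (\<Prod>k<M. of_real y - eval_fps (b k) (of_real x)) \<le> C * norm (ev W (of_real x) (of_real y))"
  shows "codim cser (idl W (bar W)) (\<Sum>j<M. \<Sum>k<M. subdegree (cnjf (b j) - b k))"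
proof -
  have Wc: "W \<in> cser" and W0: "\<And>j. j > M \<Longrightarrow> fps_nth W j = 0" using W by (auto simp: weierstrass_poly_def)
  obtain \<sigma> where \<sigma>: "conv_on \<sigma> W" using Wc by (auto simp: cser_def)
  obtain D \<rho>0 where D: "D \<in> conv1" "\<rho>0 > 0"
    "\<And>x. norm x < \<rho>0 \<Longrightarrow> eval_fps D x = det (mod_mat (spoly W x) (spoly (bar W) x))"
    "D \<noteq> 0 \<Longrightarrow> codim cser (idl W (bar W)) (subdegree D)"
    by (rule codim_idl_det[OF W cser_bar[OF Wc]]) (use W0 in auto)
  define R where "R = (\<Prod>j<M. \<Prod>k<M. (cnjf (b j) - b k))"
  \<comment> \<open>The comparison is given for |y| < \<epsilon> only, while
    \<open>half_disc_bound\<close> needs it on a closed interval; the roots themselves will lie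
    within \<rho>/2.\<close>
  define \<rho> where "\<rho> = \<epsilon> / 2"
  have \<rho>: "\<rho> > 0" using Wl by (simp add: \<rho>_def)
  define C' where "C' = max C (3 ^ M)"
  have small: "\<forall>\<^sub>F x in at_right (0::real). \<forall>k<M. norm (eval_fps (b k) (of_real x)) < \<rho> / 2"
  proof -
    have "\<forall>\<^sub>F x in at_right (0::real). \<forall>k\<in>{..<M}. norm (eval_fps (b k) (of_real x)) < \<rho> / 2"
    proof (intro eventually_ball_finite ballI)
      fix k assume "k \<in> {..<M}"
      hence "((\<lambda>x. norm (eval_fps (b k) (of_real x))) \<longlongrightarrow> norm (0::complex)) (at_right (0::real))"
        using tendsto_norm[OF tendsto_eval_fps_at_right[OF b(1)]] b(2) by force
      thus "\<forall>\<^sub>F x in at_right (0::real). norm (eval_fps (b k) (of_real x)) < \<rho> / 2"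
        using \<rho> by (auto dest: order_tendstoD(2)[of _ _ _ "\<rho> / 2"])
    qed simp
    thus ?thesis by (rule eventually_mono) auto
  qed
  have lower: "\<forall>\<^sub>F x in at_right (0::real). \<forall>k<M. Im (eval_fps (b k) (of_real x)) < 0"
  proof -
    have "\<forall>\<^sub>F x in at_right (0::real). \<forall>k\<in>{..<M}. Im (eval_fps (b k) (of_real x)) < 0"
      using bl by (intro eventually_ball_finite) auto
    thus ?thesis by (rule eventually_mono) auto
  qed
  have evb: "\<forall>\<^sub>F x in at_right (0::real). \<forall>k<M. evaluable (of_real x) (b k)"
  proof -
    have "\<forall>\<^sub>F x in at_right (0::real). \<forall>k\<in>{..<M}. evaluable (of_real x) (b k)"
      by (intro eventually_ball_finite ballI eventually_evaluable b) simp_all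
    thus ?thesis by (rule eventually_mono) auto
  qed
  have key: "\<forall>\<^sub>F x in at_right (0::real).
      norm (eval_fps D (of_real x)) \<le> C' ^ (2 * M) * norm (eval_fps R (of_real x)) \<and>
      norm (eval_fps R (of_real x)) \<le> C' ^ (2 * M) * norm (eval_fps D (of_real x)) \<and>
      eval_fps R (of_real x) \<noteq> 0"
    using small lower evb Wl(2) cmp weierstrass_roots_small[OF W half_gt_zero[OF \<rho>]]
      eventually_small_real[OF D(2)] eventually_small_real[OF conv_on_pos[OF \<sigma>]]
  proof eventually_elim
    case (elim x)
    let ?x = "complex_of_real x"
    define w where "w = spoly W ?x"
    have wev: "poly w z = ev W ?x z" for z
      unfolding w_def by (rule poly_spoly[of "Suc M"]) (use W0 in auto)
    have wd: "lead_coeff w = 1" "degree w = M" using spoly_weierstrass[OF W] by (simp_all add: w_def)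
    obtain as where as: "w = lin_prod as" "length as = M" using monic_poly_splits[OF wd(1)] wd(2) by metis
    define bs where "bs = map (\<lambda>k. eval_fps (b k) ?x) [0..<M]"
    have lb: "length bs = M" by (simp add: bs_def)
    have pb: "poly (lin_prod bs) z = (\<Prod>k<M. z - eval_fps (b k) ?x)" for z
      by (simp add: bs_def prod.list_conv_set_nth atLeast0LessThan poly_prod)
    have bsp: "Im c < 0 \<and> norm c \<le> \<rho> / 2" if "c \<in> set bs" for c
      using that elim(1,2) by (auto simp: bs_def)
    have asp: "Im a < 0 \<and> norm a \<le> \<rho> / 2" if "a \<in> set as" for a
    proof -
      have root: "poly w a = 0" using that unfolding as(1) poly_lin_prod by (auto simp: prod_list_zero_iff)
      hence na: "norm a < \<rho> / 2" using elim(6) \<rho> by (simp add: w_def)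
      moreover have "Im a < 0" using elim(4) na root \<rho> by (simp add: wev \<rho>_def)
      ultimately show ?thesis by simp
    qed
    have C': "C' \<ge> 3 ^ length bs" "C' \<ge> 3 ^ length as" "C' \<ge> C" by (simp_all add: C'_def lb as)
    have r1: "norm (poly (lin_prod as) (of_real t)) \<le> C' * norm (poly (lin_prod bs) (of_real t))"
      and r2: "norm (poly (lin_prod bs) (of_real t)) \<le> C' * norm (poly (lin_prod as) (of_real t))"
      if "\<bar>t\<bar> \<le> \<rho>" for t :: real
    proof -
      have t: "\<bar>t\<bar> < \<epsilon>" using that Wl(1) by (simp add: \<rho>_def)
      show "norm (poly (lin_prod as) (of_real t)) \<le> C' * norm (poly (lin_prod bs) (of_real t))"
        using elim(5)[rule_format, OF t] mult_right_mono[OF C'(3), of "norm (poly (lin_prod bs) (of_real t))"]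
        unfolding as(1)[symmetric] wev pb by auto
      show "norm (poly (lin_prod bs) (of_real t)) \<le> C' * norm (poly (lin_prod as) (of_real t))"
        using elim(5)[rule_format, OF t] mult_right_mono[OF C'(3), of "norm (poly (lin_prod as) (of_real t))"]
        unfolding as(1)[symmetric] wev pb by auto
    qed
    have s1: "self_res as \<le> C' ^ (2 * M) * self_res bs"
      using self_res_le[OF \<rho> _ asp bsp C'(1) r1] as lb by simp
    have s2: "self_res bs \<le> C' ^ (2 * M) * self_res as"
      using self_res_le[OF \<rho> _ bsp asp C'(2) r2] as lb by simp
    have barw: "spoly (bar W) ?x = lin_prod (map cnj as)"
    proof -
      have "poly (spoly (bar W) ?x) z = poly (lin_prod (map cnj as)) z" for z
      proof -
        have co: "coeff (spoly (bar W) ?x) j = cnj (coeff w j)" for j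
        proof -
          have ej: "evaluable ?x (fps_nth W j)" using elim(8) conv_on_evaluable[OF \<sigma>] by blast
          have "coeff (spoly (bar W) ?x) j = eval_fps (fps_nth (bar W) j) ?x"
            by (rule coeff_spoly[of "Suc M"]) (use W0 in auto)
          moreover have "coeff w j = eval_fps (fps_nth W j) ?x"
            unfolding w_def by (rule coeff_spoly[of "Suc M"]) (use W0 in auto)
          ultimately show ?thesis by (simp only: bar_nth eval_cnjf_real[OF ej])
        qed
        have "degree (spoly (bar W) ?x) = M"
          using wd by (intro antisym degree_le le_degree) (auto simp: co coeff_eq_0)
        hence "poly (spoly (bar W) ?x) z = (\<Sum>j\<le>M. cnj (coeff w j) * z ^ j)"
          by (simp add: poly_altdef co)
        also have "\<dots> = cnj (poly w (cnj z))" by (simp add: poly_altdef wd cnj_sum)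
        also have "\<dots> = poly (lin_prod (map cnj as)) z"
          unfolding as(1) poly_lin_prod by (induction as) auto
        finally show ?thesis .
      qed
      thus ?thesis by (simp add: poly_eq_poly_eq_iff[symmetric] fun_eq_iff)
    qed
    have "norm ?x < \<rho>0" using elim(7) by blast
    hence "norm (eval_fps D ?x) = norm (det (mod_mat w (lin_prod (map cnj as))))"
      by (simp only: D(3) barw w_def)
    also have "\<dots> = (\<Prod>\<beta>\<leftarrow>map cnj as. norm (poly w \<beta>))" by (rule norm_det_mod_mat[OF wd(1)])
    also have "\<dots> = self_res as" by (simp add: self_res_def as(1) o_def)
    finally have d: "norm (eval_fps D ?x) = self_res as" .
    have eb: "evaluable ?x (cnjf (b j) - b k) \<and> eval_fps (cnjf (b j) - b k) ?x = cnj (eval_fps (b j) ?x) - eval_fps (b k) ?x"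
      if "j < M" "k < M" for j k
    proof -
      have e: "evaluable ?x (b j)" "evaluable ?x (b k)" using elim(3) that by blast+
      hence c: "evaluable ?x (cnjf (b j))" by (simp only: radius_cnjf)
      show ?thesis using evaluable_diff[OF c e(2)] eval_fps_diff[OF c e(2)] eval_cnjf_real[OF e(1)] by simp
    qed
    have "eval_fps R ?x = (\<Prod>j<M. \<Prod>k<M. cnj (eval_fps (b j) ?x) - eval_fps (b k) ?x)"
    proof -
      have in1: "evaluable ?x (\<Prod>k<M. cnjf (b j) - b k) \<and>
          eval_fps (\<Prod>k<M. cnjf (b j) - b k) ?x = (\<Prod>k<M. eval_fps (cnjf (b j) - b k) ?x)" if "j < M" for j
        by (rule eval_fps_prod_evaluable) (use eb that in auto)
      have "eval_fps R ?x = (\<Prod>j<M. eval_fps (\<Prod>k<M. cnjf (b j) - b k) ?x)"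
        unfolding R_def by (rule conjunct2[OF eval_fps_prod_evaluable]) (use in1 in auto)
      also have "\<dots> = (\<Prod>j<M. \<Prod>k<M. cnj (eval_fps (b j) ?x) - eval_fps (b k) ?x)"
        using in1 eb by (intro prod.cong refl) (auto intro!: prod.cong)
      finally show ?thesis .
    qed
    hence r: "norm (eval_fps R ?x) = self_res bs"
      unfolding self_res_def pb
      by (simp add: bs_def prod.list_conv_set_nth atLeast0LessThan prod_norm)
    \<comment> \<open>Conjugates of points in the lower half plane lie in the upper one and are not
      roots. With the comparison this also gives D \<noteq> 0, hence a finite codimension.\<close>
    have "eval_fps R ?x \<noteq> 0"
    proof -
      have "poly (lin_prod bs) (cnj c) \<noteq> 0" if "c \<in> set bs" for c
      proof
        assume "poly (lin_prod bs) (cnj c) = 0"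
        then obtain d where "d \<in> set bs" "cnj c = d" by (auto simp: poly_lin_prod prod_list_zero_iff)
        hence "Im (cnj c) < 0" using bsp by blast
        thus False using bsp[OF that] by simp
      qed
      hence "self_res bs \<noteq> 0" unfolding self_res_def by (auto simp: prod_list_zero_iff)
      thus ?thesis using r by auto
    qed
    thus ?case using s1 s2 d r by simp
  qed
  have nt: "\<exists>x. P x" if "\<forall>\<^sub>F x in at_right (0::real). P x" for P
    using eventually_happens[OF that] by simp
  have Rc: "R \<in> conv1" unfolding R_def using b by (intro conv1_prod conv1_diff conv1_cnjf) auto
  have Rnz: "R \<noteq> 0" using nt[OF key] by auto
  have Dnz: "D \<noteq> 0" using nt[OF key] by auto
  have "subdegree R \<le> subdegree D"
    by (rule subdegree_le_of_growth[OF D(1) Dnz Rc]) (use key in \<open>auto elim: eventually_mono\<close>)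
  moreover have "subdegree D \<le> subdegree R"
    by (rule subdegree_le_of_growth[OF Rc Rnz D(1)]) (use key in \<open>auto elim: eventually_mono\<close>)
  moreover have "subdegree R = (\<Sum>j<M. \<Sum>k<M. subdegree (cnjf (b j) - b k))"
  proof -
    have sp: "subdegree (\<Prod>i\<in>I. f i) = (\<Sum>i\<in>I. subdegree (f i))"
      if "(\<Prod>i\<in>I. f i) \<noteq> 0" "finite I" for I and f :: "nat \<Rightarrow> complex fps"
      using that(2,1) by (induction I rule: finite_induct) (auto simp: subdegree_mult)
    have "(\<Prod>k<M. cnjf (b j) - b k) \<noteq> 0" if "j < M" for j
      using Rnz that unfolding R_def by (auto simp: prod_zero_iff)
    hence "(\<Sum>j<M. subdegree (\<Prod>k<M. cnjf (b j) - b k)) = (\<Sum>j<M. \<Sum>k<M. subdegree (cnjf (b j) - b k))"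
      by (intro sum.cong refl sp) simp_all
    thus ?thesis using sp[of "\<lambda>j. \<Prod>k<M. cnjf (b j) - b k" "{..<M}"] Rnz unfolding R_def by simp
  qed
  ultimately show ?thesis using D(4)[OF Dnz] by simp
qed

subsection \<open>A Hardy space estimate on a rectangle\<close>

lemma has_integral_poisson:
  fixes u v :: real
  assumes "v > 0" "a \<le> c"
  shows "((\<lambda>t. 1 / ((t - u)\<^sup>2 + v\<^sup>2)) has_integral (arctan ((c - u) / v) / v - arctan ((a - u) / v) / v)) {a..c}"
proof (rule fundamental_theorem_of_calculus[OF assms(2)])
  fix t assume "t \<in> {a..c}"
  have "((\<lambda>t. arctan ((t - u) / v) / v) has_real_derivative (1 / ((t - u)\<^sup>2 + v\<^sup>2))) (at t within {a..c})"
    using assms by (auto intro!: derivative_eq_intros simp: divide_simps power2_eq_square)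
  thus "((\<lambda>t. arctan ((t - u) / v) / v) has_vector_derivative (1 / ((t - u)\<^sup>2 + v\<^sup>2))) (at t within {a..c})"
    by (rule has_real_derivative_iff_has_vector_derivative[THEN iffD1])
qed

lemma poisson_le: "v > 0 \<Longrightarrow> arctan p / v - arctan q / v \<le> pi / v"
  using arctan_ubound[of p] arctan_lbound[of q] by (simp add: diff_divide_distrib[symmetric] divide_right_mono)

lemma norm_diff_of_real_sq: "(norm (of_real t - w))\<^sup>2 = (t - Re w)\<^sup>2 + (Im w)\<^sup>2"
  by (simp add: cmod_power2)

text \<open>Cauchy's formula on the boundary of the rectangle with base [-s, s] and height s. On the
  real side the Poisson kernel contributes at most pi / Im w. The other three sides have total
  length 4 s and distance at least s / 2 from w, hence 8 K. The bound is linear in the square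
  integral, so that it can be integrated over x later.\<close>

lemma hardy_bound:
  fixes h :: "complex \<Rightarrow> complex"
  assumes U: "open U" "convex U" "h holomorphic_on U"
    and s: "s > 0" and rect: "\<And>z. \<bar>Re z\<bar> \<le> s \<Longrightarrow> 0 \<le> Im z \<Longrightarrow> Im z \<le> s \<Longrightarrow> z \<in> U"
    and K: "\<And>z. \<bar>Re z\<bar> \<le> s \<Longrightarrow> 0 \<le> Im z \<Longrightarrow> Im z \<le> s \<Longrightarrow> \<bar>Re z\<bar> = s \<or> Im z = s \<Longrightarrow> norm (h z) \<le> K"
    and w: "\<bar>Re w\<bar> \<le> s / 2" "0 < Im w" "Im w \<le> s / 2"
  shows "sqrt (Im w) * norm (h w) \<le> integral {-s..s} (\<lambda>t. (norm (h (of_real t)))\<^sup>2) + 4 + 8 * K * sqrt (Im w)"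
proof -
  define a1 a2 a3 a4 where "a1 = complex_of_real (-s)" and "a2 = complex_of_real s"
    and "a3 = Complex s s" and "a4 = Complex (-s) s"
  define f where "f z = h z / (z - w)" for z
  have K0: "K \<ge> 0" using K[of "Complex s s"] s by (auto intro: order_trans[OF norm_ge_zero])
  have wbox: "w \<in> box a1 a3" using w s by (auto simp: in_box_complex_iff a1_def a3_def)
  have cb: "z \<in> U" if "z \<in> cbox a1 a3" for z
    using that rect s by (auto simp: in_cbox_complex_iff a1_def a3_def)
  have rp: "rectpath a1 a3 = linepath a1 a2 +++ linepath a2 a3 +++ linepath a3 a4 +++ linepath a4 a1"
    by (simp add: rectpath_def a1_def a2_def a3_def a4_def Let_def complex_of_real_def)
  have img: "path_image (rectpath a1 a3) \<subseteq> U - {w}"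
    using path_image_rectpath_cbox_minus_box[of a1 a3] wbox cb s by (auto simp: a1_def a3_def)
  have wU: "w \<in> interior U" using cb wbox U(1) box_subset_cbox by (metis interior_open subsetD)
  have "(f has_contour_integral (2 * pi * \<i> * winding_number (rectpath a1 a3) w * h w)) (rectpath a1 a3)"
    unfolding f_def by (rule Cauchy_integral_formula_convex_simple[OF U(2,3) wU _ img]) auto
  hence ci: "(f has_contour_integral (2 * pi * \<i> * h w)) (rectpath a1 a3)"
    using winding_number_rectpath[OF wbox] by simp
  have "f holomorphic_on (U - {w})"
    unfolding f_def using U(3) by (intro holomorphic_intros) (auto intro: holomorphic_on_subset)
  hence cont: "continuous_on (path_image (rectpath a1 a3)) f"
    by (intro holomorphic_on_imp_continuous_on holomorphic_on_subset[OF _ img])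
  have seg: "closed_segment a1 a2 \<subseteq> path_image (rectpath a1 a3)" "closed_segment a2 a3 \<subseteq> path_image (rectpath a1 a3)"
    "closed_segment a3 a4 \<subseteq> path_image (rectpath a1 a3)" "closed_segment a4 a1 \<subseteq> path_image (rectpath a1 a3)"
    unfolding rp by (auto simp: path_image_join)
  have int: "f contour_integrable_on linepath a1 a2" "f contour_integrable_on linepath a2 a3"
    "f contour_integrable_on linepath a3 a4" "f contour_integrable_on linepath a4 a1"
    by (intro contour_integrable_continuous_linepath continuous_on_subset[OF cont] seg)+
  have "contour_integral (rectpath a1 a3) f = contour_integral (linepath a1 a2) f + contour_integral (linepath a2 a3) f
      + contour_integral (linepath a3 a4) f + contour_integral (linepath a4 a1) f"
    unfolding rp using int by (simp add: contour_integrable_join add.assoc)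
  hence eq: "2 * pi * \<i> * h w = contour_integral (linepath a1 a2) f + contour_integral (linepath a2 a3) f
      + contour_integral (linepath a3 a4) f + contour_integral (linepath a4 a1) f"
    using contour_integral_unique[OF ci] by simp
  have side: "norm (f z) \<le> K / (s / 2)"
    if "\<bar>Re z\<bar> \<le> s" "0 \<le> Im z" "Im z \<le> s" "\<bar>Re z\<bar> = s \<or> Im z = s" for z
  proof -
    have "norm (z - w) \<ge> s / 2"
    proof (cases "\<bar>Re z\<bar> = s")
      case True
      hence "s / 2 \<le> \<bar>Re (z - w)\<bar>" using w s by (auto simp: abs_if split: if_splits)
      thus ?thesis using abs_Re_le_cmod[of "z - w"] by linarith
    next
      case False
      hence "s / 2 \<le> \<bar>Im (z - w)\<bar>" using that w s by auto
      thus ?thesis using abs_Im_le_cmod[of "z - w"] by linarith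
    qed
    thus ?thesis unfolding f_def norm_divide using K[OF that] s K0 by (intro frac_le) auto
  qed
  have ends: "a2 = Complex s 0" "a1 = Complex (-s) 0" by (simp_all add: a1_def a2_def complex_eq_iff)
  have seg2: "\<bar>Re z\<bar> \<le> s \<and> 0 \<le> Im z \<and> Im z \<le> s \<and> (\<bar>Re z\<bar> = s \<or> Im z = s)"
    if "z \<in> closed_segment a2 a3 \<union> closed_segment a3 a4 \<union> closed_segment a4 a1" for z
    using that s unfolding ends a3_def a4_def
    by (auto simp: closed_segment_same_Re closed_segment_same_Im closed_segment_eq_real_ivl split: if_splits)
  have n2: "norm (contour_integral (linepath a2 a3) f) \<le> K / (s / 2) * norm (a3 - a2)"
    by (rule contour_integral_bound_linepath[OF int(2)]) (use K0 s side seg2 in auto)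
  have n3: "norm (contour_integral (linepath a3 a4) f) \<le> K / (s / 2) * norm (a4 - a3)"
    by (rule contour_integral_bound_linepath[OF int(3)]) (use K0 s side seg2 in auto)
  have n4: "norm (contour_integral (linepath a4 a1) f) \<le> K / (s / 2) * norm (a1 - a4)"
    by (rule contour_integral_bound_linepath[OF int(4)]) (use K0 s side seg2 in auto)
  have lens: "norm (a3 - a2) = s" "norm (a4 - a3) = 2 * s" "norm (a1 - a4) = s"
    using s unfolding ends a3_def a4_def by (simp_all add: cmod_def real_sqrt_mult)
  \<comment> \<open>With this weight, multiplication by sqrt (Im w) leaves I / 2 from the first term
    and at most pi / 2 from the Poisson term.\<close>
  define \<mu> where "\<mu> = 1 / sqrt (Im w)"
  have \<mu>: "\<mu> > 0" using w by (simp add: \<mu>_def)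
  define I where "I = integral {-s..s} (\<lambda>t. (norm (h (of_real t)))\<^sup>2)"
  have hc: "continuous_on {-s..s} (\<lambda>t. h (complex_of_real t))"
  proof (rule continuous_on_compose2[OF holomorphic_on_imp_continuous_on[OF U(3)]])
    show "complex_of_real ` {- s..s} \<subseteq> U" using rect s by auto
  qed (intro continuous_intros)
  have fc: "continuous_on {-s..s} (\<lambda>t. f (complex_of_real t))"
    unfolding f_def using hc w by (intro continuous_intros) (auto simp: complex_eq_iff)
  have hI: "((\<lambda>t. (norm (h (of_real t)))\<^sup>2) has_integral I) {-s..s}"
    unfolding I_def by (intro integrable_integral integrable_continuous_real continuous_intros hc)
  have I0: "I \<ge> 0" using hI by (rule has_integral_nonneg) simp
  obtain J where J: "((\<lambda>t. 1 / ((t - Re w)\<^sup>2 + (Im w)\<^sup>2)) has_integral J) {-s..s}" "J \<le> pi / Im w"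
    using has_integral_poisson[of "Im w" "-s" s "Re w"] poisson_le w s by fastforce
  have "norm (integral {-s..s} (\<lambda>t. f (of_real t))) \<le> (\<mu> * I + J / \<mu>) / 2"
  proof (rule integral_norm_bound_integral[THEN order_trans])
    show "(\<lambda>t. f (complex_of_real t)) integrable_on {-s..s}" by (intro integrable_continuous_real fc)
    have hg: "((\<lambda>t. (\<mu> * (norm (h (of_real t)))\<^sup>2 + 1 / ((t - Re w)\<^sup>2 + (Im w)\<^sup>2) / \<mu>) / 2) has_integral (\<mu> * I + J / \<mu>) / 2) {-s..s}"
      by (intro has_integral_divide has_integral_add has_integral_mult_right hI J(1))
    thus "(\<lambda>t. (\<mu> * (norm (h (of_real t)))\<^sup>2 + 1 / ((t - Re w)\<^sup>2 + (Im w)\<^sup>2) / \<mu>) / 2) integrable_on {-s..s}"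
      by (rule has_integral_integrable)
    show "integral {-s..s} (\<lambda>t. (\<mu> * (norm (h (of_real t)))\<^sup>2 + 1 / ((t - Re w)\<^sup>2 + (Im w)\<^sup>2) / \<mu>) / 2) \<le> (\<mu> * I + J / \<mu>) / 2"
      using integral_unique[OF hg] by simp
    fix t assume "t \<in> {-s..s}"
    define p where "p = norm (h (of_real t))"
    define d where "d = 1 / norm (of_real t - w)"
    have d2: "d\<^sup>2 = 1 / ((t - Re w)\<^sup>2 + (Im w)\<^sup>2)"
      unfolding d_def power_divide norm_diff_of_real_sq by simp
    \<comment> \<open>The weighted arithmetic-geometric mean inequality, used in place of
      Cauchy-Schwarz for integrals.\<close>
    have "0 \<le> (\<mu> * p - d)\<^sup>2 / \<mu>" using \<mu> by simp
    also have "\<dots> = \<mu> * p\<^sup>2 + d\<^sup>2 / \<mu> - 2 * (p * d)" using \<mu> by (simp add: power2_eq_square field_simps)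
    finally have "p * d \<le> (\<mu> * p\<^sup>2 + d\<^sup>2 / \<mu>) / 2" by simp
    thus "norm (f (complex_of_real t)) \<le> (\<mu> * (norm (h (of_real t)))\<^sup>2 + 1 / ((t - Re w)\<^sup>2 + (Im w)\<^sup>2) / \<mu>) / 2"
      unfolding d2[symmetric] p_def[symmetric] by (simp add: f_def norm_divide p_def d_def)
  qed
  moreover have "contour_integral (linepath a1 a2) f = integral {-s..s} (\<lambda>t. f (of_real t))"
    using s by (subst contour_integral_linepath_Reals_eq) (auto simp: a1_def a2_def)
  ultimately have n1: "norm (contour_integral (linepath a1 a2) f) \<le> (\<mu> * I + J / \<mu>) / 2" by simp
  have "2 * pi * norm (h w) = norm (2 * pi * \<i> * h w)" by (simp add: norm_mult)
  also have "\<dots> \<le> norm (contour_integral (linepath a1 a2) f) + norm (contour_integral (linepath a2 a3) f)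
      + norm (contour_integral (linepath a3 a4) f) + norm (contour_integral (linepath a4 a1) f)"
    unfolding eq by (intro norm_triangle_mono norm_triangle_le order_refl)
  also have "\<dots> \<le> (\<mu> * I + J / \<mu>) / 2 + 8 * K"
  proof -
    have "K / (s / 2) * s = 2 * K" "K / (s / 2) * (2 * s) = 4 * K" using s by (simp_all add: field_simps)
    thus ?thesis using n1 n2 n3 n4 unfolding lens by linarith
  qed
  finally have main: "2 * pi * norm (h w) \<le> (\<mu> * I + J / \<mu>) / 2 + 8 * K" .
  define q where "q = sqrt (Im w)"
  have q: "q > 0" "q\<^sup>2 = Im w" "\<mu> = 1 / q" using w by (simp_all add: q_def \<mu>_def)
  have "q * norm (h w) \<le> q * (2 * pi * norm (h w))"
    using q pi_gt3 mult_right_mono[of 1 "2 * pi" "norm (h w)"] by (intro mult_left_mono) auto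
  also have "\<dots> \<le> q * ((\<mu> * I + J / \<mu>) / 2 + 8 * K)" using q main by (intro mult_left_mono) auto
  also have "\<dots> = I / 2 + Im w * J / 2 + 8 * K * q"
    unfolding q(3) q(2)[symmetric] using q(1) by (simp add: field_simps power2_eq_square)
  also have "\<dots> \<le> I + 4 + 8 * K * q"
  proof -
    have "Im w * J \<le> pi" using J(2) w by (simp add: field_simps)
    thus ?thesis using I0 pi_less_4 by linarith
  qed
  finally show ?thesis by (simp add: q_def I_def)
qed

subsection \<open>Local square integrability\<close>

text \<open>A square around the origin without the null line x = 0. For real x off 0 the branches
  are not real, so the factors of \<open>[P]\<close> do not vanish there.\<close>

definition Sq :: "real \<Rightarrow> (real \<times> real) set" where
  "Sq \<delta> = {z. 0 < \<bar>fst z\<bar> \<and> \<bar>fst z\<bar> < \<delta> \<and> \<bar>snd z\<bar> < \<delta>}"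

definition evr :: "ser \<Rightarrow> real \<times> real \<Rightarrow> complex" where
  "evr f z = ev f (of_real (fst z)) (of_real (snd z))"

definition sqint :: "ser \<Rightarrow> ser \<Rightarrow> real \<Rightarrow> ennreal" where
  "sqint F B \<delta> = (\<integral>\<^sup>+z. indicator (Sq \<delta>) z * ennreal ((norm (evr F z / evr B z))\<^sup>2) \<partial>lborel)"

definition L2 :: "ser \<Rightarrow> ser \<Rightarrow> bool" where
  "L2 F B \<longleftrightarrow> (\<exists>\<delta>>0. sqint F B \<delta> < \<infinity>)"

lemma open_Sq: "open (Sq \<delta>)"
proof -
  have "Sq \<delta> = {z. 0 < \<bar>fst z\<bar>} \<inter> {z. \<bar>fst z\<bar> < \<delta>} \<inter> {z. \<bar>snd z\<bar> < \<delta>}" by (auto simp: Sq_def)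
  thus ?thesis by (simp only:) (intro open_Int open_Collect_less continuous_intros)
qed

lemma Sq_mono: "\<delta> \<le> \<delta>' \<Longrightarrow> Sq \<delta> \<subseteq> Sq \<delta>'"
  by (auto simp: Sq_def)

lemma sqint_mono: "\<delta> \<le> \<delta>' \<Longrightarrow> sqint F B \<delta> \<le> sqint F B \<delta>'"
  unfolding sqint_def using Sq_mono[of \<delta> \<delta>']
  by (intro nn_integral_mono mult_right_mono) (auto simp: indicator_def)

lemma emeasure_Sq: "emeasure lborel (Sq \<delta>) < \<infinity>"
proof -
  have "Sq \<delta> \<subseteq> {-\<delta>..\<delta>} \<times> {-\<delta>..\<delta>}" by (auto simp: Sq_def)
  hence "bounded (Sq \<delta>)" by (rule bounded_subset[rotated]) (intro bounded_Times bounded_closed_interval)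
  thus ?thesis by (rule emeasure_bounded_finite)
qed

lemma evr_measurable:
  assumes "conv_on \<rho> f" "\<delta> \<le> \<rho>"
  shows "(\<lambda>z. indicator (Sq \<delta>) z *\<^sub>R evr f z) \<in> borel_measurable borel"
proof (rule borel_measurable_continuous_on_indicator)
  show "Sq \<delta> \<in> sets borel" using open_Sq by simp
  have "continuous_on (Sq \<delta>) (\<lambda>z. (\<lambda>(x,y). ev f x y) (complex_of_real (fst z), complex_of_real (snd z)))"
    by (rule continuous_on_compose2[OF continuous_on_ev[OF assms(1)]])
       (use assms(2) in \<open>auto simp: Sq_def intro!: continuous_intros\<close>)
  thus "continuous_on (Sq \<delta>) (evr f)" by (simp add: evr_def[abs_def])
qed

lemma sqint_measurable:
  assumes "conv_on \<rho> F" "conv_on \<rho> B" "\<delta> \<le> \<rho>"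
  shows "(\<lambda>z. indicator (Sq \<delta>) z * ennreal ((norm (evr F z / evr B z))\<^sup>2)) \<in> borel_measurable borel"
proof -
  have [measurable]: "(\<lambda>z. indicator (Sq \<delta>) z *\<^sub>R evr F z) \<in> borel_measurable borel"
    "(\<lambda>z. indicator (Sq \<delta>) z *\<^sub>R evr B z) \<in> borel_measurable borel"
    using evr_measurable assms by blast+
  \<comment> \<open>Numerator and denominator are cut off separately, so that both are Borel on the
    whole plane; outside \<open>Sq \<delta>\<close> the quotient is 0 / 0 = 0.\<close>
  have "(\<lambda>z. ennreal ((norm ((indicator (Sq \<delta>) z *\<^sub>R evr F z) / (indicator (Sq \<delta>) z *\<^sub>R evr B z)))\<^sup>2)) \<in> borel_measurable borel"
    by measurable
  also have "(\<lambda>z. ennreal ((norm ((indicator (Sq \<delta>) z *\<^sub>R evr F z) / (indicator (Sq \<delta>) z *\<^sub>R evr B z)))\<^sup>2))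
      = (\<lambda>z. indicator (Sq \<delta>) z * ennreal ((norm (evr F z / evr B z))\<^sup>2))"
    by (auto simp: indicator_def fun_eq_iff)
  finally show ?thesis .
qed

lemma L2_cmp:
  assumes c: "F \<in> cser" "B \<in> cser" and L: "L2 F B" and "\<delta>0 > 0"
    and le: "\<And>z. z \<in> Sq \<delta>0 \<Longrightarrow> norm (evr F' z / evr B' z) \<le> K * norm (evr F z / evr B z)"
  shows "L2 F' B'"
proof -
  obtain \<rho> where \<rho>: "conv_on \<rho> F" "conv_on \<rho> B" using cser_conv_on2[OF c] by blast
  obtain \<delta>1 where \<delta>1: "\<delta>1 > 0" "sqint F B \<delta>1 < \<infinity>" using L by (auto simp: L2_def)
  define \<delta> where "\<delta> = min \<rho> (min \<delta>0 \<delta>1)"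
  have \<delta>: "\<delta> > 0" "\<delta> \<le> \<rho>" "\<delta> \<le> \<delta>0" "\<delta> \<le> \<delta>1"
    using \<open>\<delta>0 > 0\<close> \<delta>1 conv_on_pos[OF \<rho>(1)] by (auto simp: \<delta>_def)
  have "sqint F' B' \<delta> \<le> (\<integral>\<^sup>+z. ennreal (K\<^sup>2) * (indicator (Sq \<delta>) z * ennreal ((norm (evr F z / evr B z))\<^sup>2)) \<partial>lborel)"
    unfolding sqint_def
  proof (intro nn_integral_mono)
    fix z :: "real \<times> real"
    show "indicator (Sq \<delta>) z * ennreal ((norm (evr F' z / evr B' z))\<^sup>2)
      \<le> ennreal (K\<^sup>2) * (indicator (Sq \<delta>) z * ennreal ((norm (evr F z / evr B z))\<^sup>2))"
    proof (cases "z \<in> Sq \<delta>")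
      case True
      hence "norm (evr F' z / evr B' z) \<le> K * norm (evr F z / evr B z)" using le Sq_mono[OF \<delta>(3)] by blast
      hence "(norm (evr F' z / evr B' z))\<^sup>2 \<le> K\<^sup>2 * (norm (evr F z / evr B z))\<^sup>2"
        by (metis norm_ge_zero power_mono power_mult_distrib)
      thus ?thesis using True by (simp add: ennreal_mult[symmetric] ennreal_leI)
    qed simp
  qed
  also have "\<dots> = ennreal (K\<^sup>2) * sqint F B \<delta>"
    unfolding sqint_def using sqint_measurable[OF \<rho> \<delta>(2)] by (intro nn_integral_cmult) simp
  also have "\<dots> < \<infinity>"
    using le_less_trans[OF sqint_mono[OF \<delta>(4)] \<delta>1(2)] by (simp add: ennreal_mult_less_top)
  finally show ?thesis unfolding L2_def using \<delta>(1) by blast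
qed

lemma L2_add:
  assumes c: "F \<in> cser" "G \<in> cser" "B \<in> cser" and L: "L2 F B" "L2 G B"
  shows "L2 (F + G) B"
proof -
  obtain \<rho>1 where r1: "conv_on \<rho>1 F" "conv_on \<rho>1 G" using cser_conv_on2[OF c(1,2)] by blast
  obtain \<rho>2 where r2: "conv_on \<rho>2 B" using c(3) by (auto simp: cser_def)
  obtain d1 where d1: "d1 > 0" "sqint F B d1 < \<infinity>" using L by (auto simp: L2_def)
  obtain d2 where d2: "d2 > 0" "sqint G B d2 < \<infinity>" using L by (auto simp: L2_def)
  define \<delta> where "\<delta> = min (min \<rho>1 \<rho>2) (min d1 d2)"
  have \<delta>: "\<delta> > 0" "\<delta> \<le> d1" "\<delta> \<le> d2" "\<delta> \<le> \<rho>1" "\<delta> \<le> \<rho>2"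
    using d1 d2 conv_on_pos[OF r1(1)] conv_on_pos[OF r2(1)] by (auto simp: \<delta>_def)
  have con: "conv_on \<delta> F" "conv_on \<delta> G" "conv_on \<delta> B"
    using conv_on_mono r1 r2 \<delta> by blast+
  have "sqint (F + G) B \<delta> \<le> (\<integral>\<^sup>+z. 2 * (indicator (Sq \<delta>) z * ennreal ((norm (evr F z / evr B z))\<^sup>2))
      + 2 * (indicator (Sq \<delta>) z * ennreal ((norm (evr G z / evr B z))\<^sup>2)) \<partial>lborel)"
    unfolding sqint_def
  proof (intro nn_integral_mono)
    fix z :: "real \<times> real"
    show "indicator (Sq \<delta>) z * ennreal ((norm (evr (F + G) z / evr B z))\<^sup>2)
      \<le> 2 * (indicator (Sq \<delta>) z * ennreal ((norm (evr F z / evr B z))\<^sup>2))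
      + 2 * (indicator (Sq \<delta>) z * ennreal ((norm (evr G z / evr B z))\<^sup>2))"
    proof (cases "z \<in> Sq \<delta>")
      case True
      define p where "p = norm (evr F z / evr B z)"
      define q where "q = norm (evr G z / evr B z)"
      have "evr (F + G) z = evr F z + evr G z"
        unfolding evr_def using True by (intro ev_add[OF con(1,2)]) (auto simp: Sq_def)
      hence "norm (evr (F + G) z / evr B z) \<le> p + q"
        unfolding p_def q_def by (simp add: add_divide_distrib norm_triangle_ineq)
      hence "(norm (evr (F + G) z / evr B z))\<^sup>2 \<le> (p + q)\<^sup>2" by (intro power_mono) auto
      also have "\<dots> \<le> 2 * p\<^sup>2 + 2 * q\<^sup>2" using sum_squares_bound[of p q] by (simp add: power2_sum)
      finally have "ennreal ((norm (evr (F + G) z / evr B z))\<^sup>2) \<le> ennreal (2 * p\<^sup>2 + 2 * q\<^sup>2)"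
        by (rule ennreal_leI)
      also have "\<dots> = 2 * ennreal (p\<^sup>2) + 2 * ennreal (q\<^sup>2)" by (simp add: ennreal_mult)
      finally show ?thesis using True by (simp add: p_def q_def)
    qed simp
  qed
  also have "\<dots> = 2 * sqint F B \<delta> + 2 * sqint G B \<delta>"
    unfolding sqint_def
    using sqint_measurable[OF con(1,3) order_refl] sqint_measurable[OF con(2,3) order_refl]
    by (subst nn_integral_add) (simp_all add: nn_integral_cmult)
  also have "\<dots> < \<infinity>"
    using le_less_trans[OF sqint_mono[OF \<delta>(2)] d1(2)] le_less_trans[OF sqint_mono[OF \<delta>(3)] d2(2)]
    by (simp add: ennreal_mult_less_top)
  finally show ?thesis unfolding L2_def using \<delta>(1) by blast
qed

lemma L2_1:
  assumes "F \<in> cser"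
  shows "L2 F 1"
proof -
  obtain \<rho> where \<rho>: "conv_on \<rho> F" using assms by (auto simp: cser_def)
  then obtain C where C: "bnd \<rho> \<rho> F C" "\<rho> > 0" by (auto simp: conv_on_def)
  have "sqint F 1 \<rho> \<le> (\<integral>\<^sup>+z. ennreal (C\<^sup>2) * indicator (Sq \<rho>) z \<partial>lborel)"
    unfolding sqint_def
  proof (intro nn_integral_mono)
    fix z :: "real \<times> real"
    show "indicator (Sq \<rho>) z * ennreal ((norm (evr F z / evr 1 z))\<^sup>2) \<le> ennreal (C\<^sup>2) * indicator (Sq \<rho>) z"
    proof (cases "z \<in> Sq \<rho>")
      case True
      hence "norm (evr F z) \<le> C" unfolding evr_def using C by (intro bnd_ev) (auto simp: Sq_def)
      hence "(norm (evr F z / evr 1 z))\<^sup>2 \<le> C\<^sup>2" by (intro power_mono) (auto simp: evr_def)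
      thus ?thesis using True by (simp add: ennreal_leI)
    qed simp
  qed
  also have "\<dots> = ennreal (C\<^sup>2) * emeasure lborel (Sq \<rho>)"
    using open_Sq by (simp add: nn_integral_cmult_indicator)
  also have "\<dots> < \<infinity>" using emeasure_Sq[of \<rho>] by (simp add: ennreal_mult_less_top)
  finally show ?thesis unfolding L2_def using C by blast
qed

definition I2 :: "ser \<Rightarrow> ser set" where
  "I2 B = {F \<in> cser. L2 F B}"

lemma evr_mult:
  assumes "conv_on \<rho> f" "conv_on \<rho> g" "z \<in> Sq \<rho>"
  shows "evr (f * g) z = evr f z * evr g z"
  unfolding evr_def using assms(3) by (intro ev_mult[OF assms(1,2)]) (auto simp: Sq_def)

lemma L2_mult_bound:
  assumes "H \<in> cser" "F \<in> cser" "B \<in> cser" "L2 F B"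
  shows "L2 (H * F) B"
proof -
  obtain \<rho> where \<rho>: "conv_on \<rho> H" "conv_on \<rho> F" using cser_conv_on2 assms by blast
  then obtain C where C: "bnd \<rho> \<rho> H C" "\<rho> > 0" by (auto simp: conv_on_def)
  show ?thesis
  proof (rule L2_cmp[OF assms(2,3,4) C(2), where K=C])
    fix z assume z: "z \<in> Sq \<rho>"
    have "norm (evr H z) \<le> C" unfolding evr_def using C z by (intro bnd_ev) (auto simp: Sq_def)
    hence "norm (evr H z) * norm (evr F z / evr B z) \<le> C * norm (evr F z / evr B z)"
      by (intro mult_right_mono) auto
    thus "norm (evr (H * F) z / evr B z) \<le> C * norm (evr F z / evr B z)"
      using evr_mult[OF \<rho> z] by (simp add: norm_mult norm_divide)
  qed
qed

lemma subsp_I2: "B \<in> cser \<Longrightarrow> subsp (I2 B)"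
proof -
  assume B: "B \<in> cser"
  have "L2 0 B" unfolding L2_def sqint_def
  proof (intro exI[of _ 1] conjI)
    have "evr 0 z = 0" for z using ev_xser[of 0] by (simp add: evr_def)
    thus "(\<integral>\<^sup>+ z. indicator (Sq 1) z * ennreal ((cmod (evr 0 z / evr B z))\<^sup>2) \<partial>lborel) < \<infinity>" by simp
  qed simp
  thus ?thesis using B unfolding subsp_def I2_def by (auto intro: cser_add cser_mult L2_add L2_mult_bound)
qed

lemma evr_bar:
  assumes "conv_on \<rho> f" "z \<in> Sq \<rho>"
  shows "evr (bar f) z = cnj (evr f z)"
  using ev_bar_real[OF assms(1), of "fst z" "complex_of_real (snd z)"] assms(2)
  by (simp add: evr_def Sq_def)

text \<open>Both quotients have modulus at most 1, also at zeros of B, since division by zero gives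
  0. For \<open>bar B\<close> this uses that it takes conjugate values on the real plane.\<close>

lemma L2_self:
  assumes "B \<in> cser"
  shows "L2 B B" "L2 (bar B) B"
proof -
  obtain \<rho> where \<rho>: "conv_on \<rho> B" using assms by (auto simp: cser_def)
  note pos = conv_on_pos[OF \<rho>]
  show "L2 B B"
    by (rule L2_cmp[OF cser_1 cser_1 L2_1[OF cser_1] pos, where K=1]) (auto simp: norm_divide evr_def)
  show "L2 (bar B) B"
    by (rule L2_cmp[OF cser_1 cser_1 L2_1[OF cser_1] pos, where K=1])
       (use evr_bar[OF \<rho>] in \<open>auto simp: norm_divide evr_def\<close>)
qed

lemma idl_bar_subset_I2: "B \<in> cser \<Longrightarrow> idl B (bar B) \<subseteq> I2 B"
  unfolding idl_def I2_def
  by (auto intro!: cser_add cser_mult cser_bar L2_add L2_mult_bound L2_self)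

lemma sqint_fubini:
  assumes "conv_on \<rho> F" "conv_on \<rho> B" "\<delta> \<le> \<rho>"
  defines "G \<equiv> \<lambda>x. \<integral>\<^sup>+y. indicator (Sq \<delta>) (x,y) * ennreal ((norm (evr F (x,y) / evr B (x,y)))\<^sup>2) \<partial>lborel"
  shows "G \<in> borel_measurable lborel" "sqint F B \<delta> = (\<integral>\<^sup>+x. G x \<partial>lborel)"
proof -
  have m: "(\<lambda>z. indicator (Sq \<delta>) z * ennreal ((norm (evr F z / evr B z))\<^sup>2)) \<in> borel_measurable (lborel \<Otimes>\<^sub>M lborel)"
    using sqint_measurable[OF assms(1-3)] by (simp add: lborel_prod)
  show "G \<in> borel_measurable lborel"
    unfolding G_def by (rule lborel.borel_measurable_nn_integral_fst[OF m])
  show "sqint F B \<delta> = (\<integral>\<^sup>+x. G x \<partial>lborel)"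
    unfolding G_def sqint_def using lborel.nn_integral_fst[OF m] by (simp add: lborel_prod)
qed

subsection \<open>Substituting a series in x for y\<close>

lemma weierstrass_poly_linear:
  "\<beta> \<in> conv1 \<Longrightarrow> fps_nth \<beta> 0 = 0 \<Longrightarrow> weierstrass_poly 1 (yvar - xser \<beta>)"
  unfolding weierstrass_poly_def by (auto intro!: cser_diff xser_cser)

text \<open>Weierstrass division by \<open>y - \<beta>\<close>; the remainder f is the restriction
  of F to the branch y = \<beta>(x), as \<open>eval_linear_remainder\<close> shows.\<close>

lemma linear_remainder:
  assumes "F \<in> cser" "\<beta> \<in> conv1" "fps_nth \<beta> 0 = 0"
  obtains f Q where "f \<in> conv1" "Q \<in> cser" "F = xser f + (yvar - xser \<beta>) * Q"
proof -
  have lin: "yvar - xser \<beta> \<in> cser" "regular 1 (yvar - xser \<beta>)"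
    using weierstrass_poly_linear[OF assms(2,3)] by (auto simp: weierstrass_poly_def intro: weierstrass_poly_regular)
  obtain Q where Q: "Q \<in> cser" "\<And>j. j \<ge> 1 \<Longrightarrow> fps_nth (F - Q * (yvar - xser \<beta>)) j = 0"
    using weierstrass_division[OF lin assms(1)] by blast
  define R where "R = F - Q * (yvar - xser \<beta>)"
  have Rc: "R \<in> cser" unfolding R_def by (rule cser_diff[OF assms(1) cser_mult[OF Q(1) lin(1)]])
  have "R = (\<Sum>j<1. xser (fps_nth R j) * yvar ^ j)"
    using Q(2) unfolding R_def by (rule fps_truncated_as_sum)
  also have "\<dots> = xser (fps_nth R 0)" by simp
  finally have R0: "R = xser (fps_nth R 0)" .
  show ?thesis
  proof (rule that[OF cser_nth[OF Rc] Q(1)])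
    have "F = R + (yvar - xser \<beta>) * Q" by (simp add: R_def mult.commute)
    thus "F = xser (fps_nth R 0) + (yvar - xser \<beta>) * Q" by (simp only: R0[symmetric])
  qed
qed

text \<open>The difference p - q has y-degree 0 and is divisible by \<open>y - \<beta>\<close>, so
  uniqueness of division makes it vanish.\<close>

lemma linear_remainder_unique:
  assumes "xser p = xser q + (yvar - xser \<beta>) * H" "\<beta> \<in> conv1" "fps_nth \<beta> 0 = 0"
  shows "p = q"
proof -
  have eq: "H * (yvar - xser \<beta>) = xser (p - q)"
    unfolding fps_const_sub[symmetric] assms(1) by (simp add: mult.commute)
  have "H = 0"
  proof (rule weierstrass_division_unique)
    show "regular 1 (yvar - xser \<beta>)"
      using weierstrass_poly_linear[OF assms(2,3)] by (rule weierstrass_poly_regular)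
    show "fps_nth (H * (yvar - xser \<beta>)) j = 0" if "j \<ge> 1" for j unfolding eq using that by simp
  qed
  thus ?thesis using eq by simp
qed

lemma small_eval:
  assumes "\<beta> \<in> conv1" "fps_nth \<beta> 0 = 0" "\<rho> > 0"
  obtains \<delta> where "\<delta> > 0" "\<And>x. norm x < \<delta> \<Longrightarrow> norm (eval_fps \<beta> x) < \<rho> \<and> evaluable x \<beta>"
proof -
  obtain r where r: "r > 0" "\<And>x. norm x < r \<Longrightarrow> evaluable x \<beta>" by (rule conv1_radius[OF assms(1)]) blast
  have "isCont (eval_fps \<beta>) 0"
    using assms by (intro continuous_eval_fps) (simp add: conv1_def zero_ereal_def)
  then obtain d where d: "d > 0" "\<And>x. norm x < d \<Longrightarrow> norm (eval_fps \<beta> x) < \<rho>"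
    using assms(2,3) unfolding continuous_at_eps_delta by (auto simp: dist_norm eval_fps_at_0)
  show ?thesis using r d by (intro that[of "min r d"]) auto
qed

lemma eval_linear_remainder:
  assumes "f \<in> conv1" "Q \<in> cser" "\<beta> \<in> conv1" "fps_nth \<beta> 0 = 0"
  obtains \<delta> where "\<delta> > 0"
    "\<And>x. norm x < \<delta> \<Longrightarrow> ev (xser f + (yvar - xser \<beta>) * Q) x (eval_fps \<beta> x) = eval_fps f x"
proof -
  have "xser \<beta> \<in> cser" "xser f \<in> cser" using assms xser_cser by auto
  then obtain \<rho>0 where \<rho>0: "conv_on \<rho>0 (xser \<beta>)" "conv_on \<rho>0 (xser f)" using cser_conv_on2 by blast
  obtain \<rho>1 where \<rho>1: "conv_on \<rho>1 Q" using assms by (auto simp: cser_def)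
  define \<rho> where "\<rho> = min \<rho>0 \<rho>1"
  have pos: "\<rho> > 0" using conv_on_pos[OF \<rho>0(1)] conv_on_pos[OF \<rho>1] by (simp add: \<rho>_def)
  have con: "conv_on \<rho> (xser \<beta>)" "conv_on \<rho> (xser f)" "conv_on \<rho> Q"
    using conv_on_mono[OF \<rho>0(1) pos] conv_on_mono[OF \<rho>0(2) pos] conv_on_mono[OF \<rho>1 pos] by (auto simp: \<rho>_def)
  obtain d where d: "d > 0" "\<And>x. norm x < d \<Longrightarrow> norm (eval_fps \<beta> x) < \<rho> \<and> evaluable x \<beta>"
    using small_eval[OF assms(3,4) pos] by blast
  show ?thesis
  proof (rule that[of "min d \<rho>"])
    fix x :: complex assume x: "norm x < min d \<rho>"
    have y: "norm x < \<rho>" "norm (eval_fps \<beta> x) < \<rho>" using x d(2)[of x] by auto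
    have c2: "conv_on \<rho> (yvar - xser \<beta>)" by (intro conv_on_diff conv_on_yvar pos con)
    show "ev (xser f + (yvar - xser \<beta>) * Q) x (eval_fps \<beta> x) = eval_fps f x"
      using ev_add[OF con(2) conv_on_mult[OF c2 con(3)] y] ev_mult[OF c2 con(3) y]
        ev_diff[OF conv_on_yvar[OF pos] con(1) y] by simp
  qed (use d pos in auto)
qed

lemma nn_integral_inverse_infinite:
  assumes "\<kappa> > 0" "\<delta> > 0"
  shows "(\<integral>\<^sup>+x. ennreal (\<kappa> / x) * indicator {0<..<\<delta>} x \<partial>lborel) = \<infinity>"
proof (rule ccontr)
  let ?I = "\<integral>\<^sup>+x. ennreal (\<kappa> / x) * indicator {0<..<\<delta>} x \<partial>lborel"
  assume "?I \<noteq> \<infinity>"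
  then obtain T where T: "?I = ennreal T" "T \<ge> 0" by (cases ?I) auto
  \<comment> \<open>Chosen so that the integral of \<open>\<kappa> / x\<close> from \<epsilon> to
    \<open>\<delta> / 2\<close> equals T + 1, more than the supposed value T.\<close>
  define \<epsilon> where "\<epsilon> = \<delta> / 2 * exp (- (T + 1) / \<kappa>)"
  have \<epsilon>: "\<epsilon> > 0" "\<epsilon> \<le> \<delta> / 2" using assms T by (auto simp: \<epsilon>_def mult_le_cancel_left1 divide_nonpos_pos)
  have ln\<epsilon>: "\<kappa> * ln (\<delta> / 2) - \<kappa> * ln \<epsilon> = T + 1"
    using assms by (simp add: \<epsilon>_def ln_mult ln_div field_simps)
  have "((\<lambda>x. \<kappa> / x) has_integral (\<kappa> * ln (\<delta> / 2) - \<kappa> * ln \<epsilon>)) {\<epsilon>..\<delta> / 2}"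
  proof (rule fundamental_theorem_of_calculus[OF \<epsilon>(2)])
    fix x assume "x \<in> {\<epsilon>..\<delta> / 2}"
    hence "x > 0" using \<epsilon> by simp
    hence "((\<lambda>x. \<kappa> * ln x) has_real_derivative (\<kappa> / x)) (at x within {\<epsilon>..\<delta> / 2})"
      by (auto intro!: derivative_eq_intros)
    thus "((\<lambda>x. \<kappa> * ln x) has_vector_derivative (\<kappa> / x)) (at x within {\<epsilon>..\<delta> / 2})"
      by (rule has_real_derivative_iff_has_vector_derivative[THEN iffD1])
  qed
  hence "(\<integral>\<^sup>+x. ennreal (\<kappa> / x) * indicator {\<epsilon>..\<delta> / 2} x \<partial>lborel) = ennreal (T + 1)"
    unfolding ln\<epsilon> using assms \<epsilon> by (intro nn_integral_has_integral_lebesgue') auto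
  moreover have "(\<integral>\<^sup>+x. ennreal (\<kappa> / x) * indicator {\<epsilon>..\<delta> / 2} x \<partial>lborel) \<le> ?I"
    using \<epsilon> assms by (intro nn_integral_mono) (auto simp: indicator_def)
  ultimately have "ennreal (T + 1) \<le> ennreal T" using T by simp
  thus False using T by simp
qed

lemma fps_poly_part_nth:
  "fps_nth (\<Sum>i<N. fps_const (a i) * fps_X ^ i) j = (if j < N then a j else (0::complex))"
proof -
  have "fps_nth (\<Sum>i<N. fps_const (a i) * fps_X ^ i) j = (\<Sum>i<N. if i = j then a j else 0)"
    unfolding fps_sum_nth by (intro sum.cong refl) (auto simp: fps_X_power_nth)
  thus ?thesis by simp
qed

subsection \<open>The square integrable multipliers of a product of factors\<close>

text \<open>The branches \<open>y = b_j(x)\<close> of \<open>[P]\<close>: \<open>b_j = - q_j - i x^(2 L_j)\<close>.\<close>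
locale stable_factors =
  fixes b :: "nat \<Rightarrow> complex fps" and L :: "nat \<Rightarrow> nat"
  assumes rad: "\<And>j. fps_conv_radius (b j) = \<infinity>"
    and b0: "\<And>j. fps_nth (b j) 0 = 0"
    and Lpos: "\<And>j. L j \<ge> 1"
    and bdiff: "\<And>j. cnjf (b j) - b j = fps_const (2 * \<i>) * fps_X ^ (2 * L j)"
begin

definition Bn :: "nat \<Rightarrow> ser" where
  "Bn n = (\<Prod>j<n. yvar - xser (b j))"

definition cb :: "nat \<Rightarrow> complex fps" where
  "cb j = cnjf (b j)"

text \<open>The restriction of \<open>Bn n\<close> to the conjugate branch \<open>y = cb n\<close>
  of the next factor.\<close>

definition lead :: "nat \<Rightarrow> complex fps" where
  "lead n = (\<Prod>k<n. cb n - b k)"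

lemma conv1_b: "b j \<in> conv1" and conv1_cb: "cb j \<in> conv1"
  by (simp_all add: conv1_def cb_def rad)

lemma evaluable_b: "evaluable x (b j)" and evaluable_cb: "evaluable x (cb j)"
  by (simp_all add: cb_def rad)

lemma cb0: "fps_nth (cb j) 0 = 0"
  by (simp add: cb_def b0)

lemma conv1_lead: "lead n \<in> conv1"
  unfolding lead_def by (intro conv1_prod conv1_diff conv1_b conv1_cb)

lemma eval_cb_real: "eval_fps (cb j) (of_real x) = cnj (eval_fps (b j) (of_real x))"
  unfolding cb_def by (rule eval_cnjf_real[OF evaluable_b])

lemma eval_cb_diff: "eval_fps (cb j) x - eval_fps (b j) x = 2 * \<i> * x ^ (2 * L j)"
proof -
  have "eval_fps (cb j - b j) x = eval_fps (cb j) x - eval_fps (b j) x"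
    by (rule eval_fps_diff[OF evaluable_cb evaluable_b])
  moreover have "eval_fps (fps_const (2 * \<i>) * fps_X ^ (2 * L j)) x = 2 * \<i> * x ^ (2 * L j)"
    by (subst eval_fps_mult) auto
  ultimately show ?thesis using bdiff[of j] by (simp add: cb_def)
qed

lemma Im_b: "Im (eval_fps (b j) (of_real x)) = - (x ^ (2 * L j))"
proof -
  have "cnj (eval_fps (b j) (of_real x)) - eval_fps (b j) (of_real x) = 2 * \<i> * of_real (x ^ (2 * L j))"
    using eval_cb_diff[of j "of_real x"] by (simp add: eval_cb_real)
  hence "Im (cnj (eval_fps (b j) (of_real x)) - eval_fps (b j) (of_real x)) = 2 * x ^ (2 * L j)"
    by (simp only:) (simp flip: of_real_power)
  thus ?thesis by simp
qed

lemma conv_on_factor: "\<rho> > 0 \<Longrightarrow> conv_on \<rho> (yvar - xser (b j))"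
  by (intro conv_on_diff conv_on_yvar conv_on_xser) (simp_all add: rad)

lemma conv_on_Bn: "\<rho> > 0 \<Longrightarrow> conv_on \<rho> (Bn n)"
  unfolding Bn_def by (intro conv_on_prod conv_on_factor)

lemma cser_Bn: "Bn n \<in> cser"
  unfolding cser_def by (intro CollectI exI[of _ 1] conv_on_Bn) simp

lemma Bn_Suc: "Bn (Suc n) = Bn n * (yvar - xser (b n))"
  by (simp add: Bn_def)

lemma ev_factor: "ev (yvar - xser (b j)) x y = y - eval_fps (b j) x"
proof -
  define \<rho> where "\<rho> = norm x + norm y + 1"
  have \<rho>: "\<rho> > 0" "norm x < \<rho>" "norm y < \<rho>" by (auto simp: \<rho>_def add_nonneg_pos)
  have "conv_on \<rho> (xser (b j))" using \<rho> by (intro conv_on_xser) (simp_all add: rad)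
  from ev_diff[OF conv_on_yvar[OF \<rho>(1)] this \<rho>(2,3)] show ?thesis by simp
qed

lemma ev_Bn: "ev (Bn n) x y = (\<Prod>j<n. y - eval_fps (b j) x)"
proof (induction n)
  case 0 thus ?case by (simp add: Bn_def)
next
  case (Suc n)
  define \<rho> where "\<rho> = norm x + norm y + 1"
  have \<rho>: "\<rho> > 0" "norm x < \<rho>" "norm y < \<rho>" by (auto simp: \<rho>_def add_nonneg_pos)
  have "ev (Bn (Suc n)) x y = ev (Bn n) x y * ev (yvar - xser (b n)) x y"
    unfolding Bn_Suc using \<rho> by (intro ev_mult[of \<rho>] conv_on_Bn conv_on_factor)
  thus ?case by (simp add: Suc ev_factor)
qed

lemma eval_lead: "eval_fps (lead n) x = ev (Bn n) x (eval_fps (cb n) x)"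
proof -
  have "eval_fps (lead n) x = (\<Prod>k<n. eval_fps (cb n - b k) x)"
    unfolding lead_def
    by (intro conjunct2[OF eval_fps_prod_evaluable] evaluable_diff evaluable_b evaluable_cb)
  thus ?thesis by (simp add: ev_Bn eval_fps_diff[OF evaluable_cb evaluable_b])
qed

text \<open>The remainder of \<open>Bn n\<close> on the branch is identified with
  \<open>lead n\<close> through its values near 0.\<close>

lemma Bn_mod:
  obtains Q where "Q \<in> cser" "Bn n = xser (lead n) + (yvar - xser (cb n)) * Q"
proof -
  obtain f Q where f: "f \<in> conv1" "Q \<in> cser" "Bn n = xser f + (yvar - xser (cb n)) * Q"
    by (rule linear_remainder[OF cser_Bn conv1_cb cb0])
  obtain \<delta> where \<delta>: "\<delta> > 0"
    "\<And>x. norm x < \<delta> \<Longrightarrow> ev (xser f + (yvar - xser (cb n)) * Q) x (eval_fps (cb n) x) = eval_fps f x"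
    using eval_linear_remainder[OF f(1,2) conv1_cb cb0, of n] by blast
  have "f = lead n"
  proof (rule eval_fps_eqD)
    show "fps_conv_radius f > 0" "fps_conv_radius (lead n) > 0"
      using f(1) conv1_lead by (auto simp: conv1_def)
    have "\<forall>\<^sub>F z::complex in nhds 0. norm z < \<delta>"
      using eventually_nhds_in_open[of "ball 0 \<delta>" "0::complex"] \<delta>(1) by (simp add: dist_norm)
    thus "\<forall>\<^sub>F z in nhds 0. eval_fps f z = eval_fps (lead n) z"
      by eventually_elim (use \<delta>(2) f(3) in \<open>simp add: eval_lead\<close>)
  qed
  thus ?thesis using f that by blast
qed

text \<open>At x = 1 the conjugate branch has imaginary part 1 and every branch has imaginary part
  -1.\<close>

lemma lead_nonzero: "lead n \<noteq> 0"
proof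
  assume "lead n = 0"
  hence "(\<Prod>j<n. eval_fps (cb n) 1 - eval_fps (b j) 1) = 0"
    using eval_lead[of n 1] by (simp add: ev_Bn)
  then obtain j where "eval_fps (cb n) 1 = eval_fps (b j) 1" by auto
  hence "cnj (eval_fps (b n) 1) = eval_fps (b j) 1" using eval_cb_real[of n 1] by simp
  hence "Im (cnj (eval_fps (b n) 1)) = Im (eval_fps (b j) 1)" by simp
  thus False using Im_b[of n 1] Im_b[of j 1] by simp
qed

section \<open>Square integrable multipliers for n and for n + 1 factors\<close>

lemma norm_conj_factor:
  "norm (of_real y - eval_fps (cb n) (of_real x)) = norm (of_real y - eval_fps (b n) (of_real x))"
proof -
  have "of_real y - eval_fps (cb n) (of_real x) = cnj (of_real y - eval_fps (b n) (of_real x))"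
    by (simp add: eval_cb_real)
  thus ?thesis by (simp only: complex_mod_cnj)
qed

lemma factor_nonzero: "x \<noteq> 0 \<Longrightarrow> of_real y - eval_fps (b n) (of_real x) \<noteq> (0::complex)"
proof
  assume "x \<noteq> 0" "of_real y - eval_fps (b n) (of_real x) = (0::complex)"
  hence "Im (eval_fps (b n) (of_real x)) = Im (complex_of_real y)" by simp
  thus False using Im_b[of n x] \<open>x \<noteq> 0\<close> by simp
qed

text \<open>On the real plane \<open>y - cb n\<close> has the same modulus as the new factor
  \<open>y - b n\<close>, so the two cancel in the modulus of the quotient.\<close>

lemma I2_conj_factor_iff:
  assumes v: "v \<in> cser"
  shows "(yvar - xser (cb n)) * v \<in> I2 (Bn (Suc n)) \<longleftrightarrow> v \<in> I2 (Bn n)"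
proof -
  define D where "D = yvar - xser (cb n)"
  have D: "D \<in> cser" unfolding D_def by (intro cser_diff cser_yvar xser_cser conv1_cb)
  obtain \<rho> where \<rho>: "conv_on \<rho> v" using v by (auto simp: cser_def)
  note pos = conv_on_pos[OF \<rho>]
  have cD: "conv_on \<rho> D" "conv_on \<rho> (xser (cb n))" unfolding D_def using pos
    by (auto intro!: conv_on_diff conv_on_yvar conv_on_xser simp: cb_def rad)
  have eq: "norm (evr (D * v) z / evr (Bn (Suc n)) z) = norm (evr v z / evr (Bn n) z)" if z: "z \<in> Sq \<rho>" for z
  proof -
    let ?x = "complex_of_real (fst z)" and ?y = "complex_of_real (snd z)"
    have xy: "norm ?x < \<rho>" "norm ?y < \<rho>" "fst z \<noteq> 0" using z by (auto simp: Sq_def)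
    have "evr D z = ?y - eval_fps (cb n) ?x"
      unfolding evr_def D_def using ev_diff[OF conv_on_yvar[OF pos] cD(2) xy(1,2)] by simp
    hence "norm (evr D z) = norm (?y - eval_fps (b n) ?x)" using norm_conj_factor by simp
    moreover have "evr (Bn (Suc n)) z = evr (Bn n) z * (?y - eval_fps (b n) ?x)"
      by (simp add: evr_def ev_Bn)
    ultimately show ?thesis
      using evr_mult[OF cD(1) \<rho> z] factor_nonzero[OF xy(3), of "snd z" n]
      by (simp add: norm_mult norm_divide)
  qed
  show ?thesis
    unfolding I2_def D_def[symmetric]
  proof (intro iffI CollectI conjI; (elim CollectE conjE)?)
    assume "L2 (D * v) (Bn (Suc n))"
    thus "L2 v (Bn n)"
      by (rule L2_cmp[OF cser_mult[OF D v] cser_Bn _ pos, where K=1]) (simp add: eq)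
  next
    assume "L2 v (Bn n)"
    thus "L2 (D * v) (Bn (Suc n))"
      by (rule L2_cmp[OF v cser_Bn _ pos, where K=1]) (simp add: eq)
  qed (use v D in \<open>auto intro: cser_mult\<close>)
qed

text \<open>After \<open>Bn n\<close> cancels, the square of the quotient is at most C^2 v / ((y -
  u)^2 + v^2) with v = \<open>x ^ (2 * L n)\<close>. Its integral over y is at most C^2 pi,
  uniformly in x: the factor \<open>x ^ L n\<close> is just what the Poisson kernel needs.\<close>

lemma I2_principal_part:
  assumes e: "e \<in> conv1"
  shows "xser (fps_X ^ L n * e) * Bn n \<in> I2 (Bn (Suc n))"
proof -
  define F where "F = xser (fps_X ^ L n * e) * Bn n"
  have xe: "xser e \<in> cser" using e by (rule xser_cser)
  have Fc: "F \<in> cser" unfolding F_def by (intro cser_mult xser_cser conv1_mult conv1_power e cser_Bn) simp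
  obtain \<rho> where \<rho>: "conv_on \<rho> F" "conv_on \<rho> (xser e)" using cser_conv_on2[OF Fc xe] by blast
  then obtain C where C: "bnd \<rho> \<rho> (xser e) C" "\<rho> > 0" by (auto simp: conv_on_def)
  define G where "G x = (\<integral>\<^sup>+y. indicator (Sq \<rho>) (x,y) * ennreal ((norm (evr F (x,y) / evr (Bn (Suc n)) (x,y)))\<^sup>2) \<partial>lborel)" for x
  have fub: "sqint F (Bn (Suc n)) \<rho> = (\<integral>\<^sup>+x. G x \<partial>lborel)"
    unfolding G_def by (rule sqint_fubini(2)[OF \<rho>(1) conv_on_Bn[OF C(2)] order_refl])
  have Gb: "G x \<le> ennreal (C\<^sup>2 * pi) * indicator {-\<rho>..\<rho>} x" for x
  proof (cases "0 < \<bar>x\<bar> \<and> \<bar>x\<bar> < \<rho>")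
    case False
    hence "indicator (Sq \<rho>) (x,y) = (0::ennreal)" for y by (auto simp: Sq_def indicator_def)
    thus ?thesis by (simp add: G_def)
  next
    case True
    define u where "u = Re (eval_fps (b n) (of_real x))"
    define v where "v = x ^ (2 * L n)"
    have v: "v > 0" using True by (simp add: v_def power_mult)
    have ce: "ereal \<rho> \<le> fps_conv_radius e"
      using bnd_radius[OF C(1) C(2) C(2), of 0] by simp
    have ee: "evaluable (of_real x) e" using True by (intro less_le_trans[OF _ ce]) simp
    have pt: "indicator (Sq \<rho>) (x,y) * ennreal ((norm (evr F (x,y) / evr (Bn (Suc n)) (x,y)))\<^sup>2)
        \<le> ennreal (C\<^sup>2 * v) * (ennreal (1 / ((y - u)\<^sup>2 + v\<^sup>2)) * indicator {-\<rho>..\<rho>} y)" for y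
    proof (cases "(x,y) \<in> Sq \<rho>")
      case False thus ?thesis by simp
    next
      case y: True
      have yb: "\<bar>y\<bar> < \<rho>" "-\<rho> \<le> y" "y \<le> \<rho>" using y by (auto simp: Sq_def)
      have Fv: "evr F (x,y) = of_real x ^ L n * eval_fps e (of_real x) * evr (Bn n) (x,y)"
      proof -
        have "conv_on \<rho> (xser (fps_X ^ L n))" using C by (intro conv_on_xser) auto
        hence c1: "conv_on \<rho> (xser (fps_X ^ L n * e))"
          using conv_on_mult[OF _ \<rho>(2)] by (simp flip: fps_const_mult)
        have "eval_fps (fps_X ^ L n * e) (of_real x) = of_real x ^ L n * eval_fps e (of_real x)"
          using ee by (subst eval_fps_mult) auto
        thus ?thesis unfolding F_def evr_mult[OF c1 conv_on_Bn[OF C(2)] y] by (simp add: evr_def)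
      qed
      have Bv: "evr (Bn (Suc n)) (x,y) = evr (Bn n) (x,y) * (of_real y - eval_fps (b n) (of_real x))"
        by (simp add: evr_def ev_Bn)
      have "norm (eval_fps e (of_real x)) \<le> C"
        using bnd_ev[OF C(1) C(2) C(2), of "of_real x" "of_real y"] True yb by simp
      hence "norm (of_real x ^ L n * eval_fps e (of_real x)) \<le> \<bar>x\<bar> ^ L n * C"
        by (simp add: norm_mult norm_power mult_left_mono)
      hence "norm (evr F (x,y) / evr (Bn (Suc n)) (x,y)) \<le> \<bar>x\<bar> ^ L n * C / norm (of_real y - eval_fps (b n) (of_real x))"
        unfolding Fv Bv using order_trans[OF norm_ge_zero \<open>norm (of_real x ^ L n * _) \<le> _\<close>]
        by (cases "evr (Bn n) (x,y) = 0") (auto simp: norm_mult norm_divide divide_right_mono)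
      hence "(norm (evr F (x,y) / evr (Bn (Suc n)) (x,y)))\<^sup>2
          \<le> (\<bar>x\<bar> ^ L n * C / norm (of_real y - eval_fps (b n) (of_real x)))\<^sup>2"
        by (intro power_mono) auto
      also have "\<dots> = (C\<^sup>2 * v) * (1 / ((y - u)\<^sup>2 + v\<^sup>2))"
      proof -
        have "(\<bar>x\<bar> ^ L n)\<^sup>2 = v" by (simp add: v_def power_even_abs mult.commute flip: power_mult)
        thus ?thesis unfolding power_divide norm_diff_of_real_sq Im_b power_mult_distrib
          by (simp add: u_def v_def mult.commute)
      qed
      finally have "ennreal ((norm (evr F (x,y) / evr (Bn (Suc n)) (x,y)))\<^sup>2)
          \<le> ennreal (C\<^sup>2 * v * (1 / ((y - u)\<^sup>2 + v\<^sup>2)))" by (rule ennreal_leI)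
      also have "\<dots> = ennreal (C\<^sup>2 * v) * ennreal (1 / ((y - u)\<^sup>2 + v\<^sup>2))"
        using v by (intro ennreal_mult) auto
      finally show ?thesis using y yb by (simp add: indicator_def abs_less_iff)
    qed
    obtain J where J: "((\<lambda>y. 1 / ((y - u)\<^sup>2 + v\<^sup>2)) has_integral J) {-\<rho>..\<rho>}" "J \<le> pi / v"
      using has_integral_poisson[of v "-\<rho>" \<rho> u] poisson_le v C(2) by fastforce
    have "G x \<le> (\<integral>\<^sup>+y. ennreal (C\<^sup>2 * v) * (ennreal (1 / ((y - u)\<^sup>2 + v\<^sup>2)) * indicator {-\<rho>..\<rho>} y) \<partial>lborel)"
      unfolding G_def by (intro nn_integral_mono pt)
    also have "\<dots> = ennreal (C\<^sup>2 * v) * (\<integral>\<^sup>+y. ennreal (1 / ((y - u)\<^sup>2 + v\<^sup>2)) * indicator {-\<rho>..\<rho>} y \<partial>lborel)"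
      by (intro nn_integral_cmult) measurable
    also have "\<dots> = ennreal (C\<^sup>2 * v) * ennreal J"
      using nn_integral_has_integral_lebesgue'[OF _ J(1)] by simp
    also have "\<dots> \<le> ennreal (C\<^sup>2 * v) * ennreal (pi / v)"
      using J(2) by (intro mult_left_mono ennreal_leI) auto
    also have "\<dots> = ennreal (C\<^sup>2 * pi)" using v by (simp flip: ennreal_mult)
    finally show ?thesis using True by (simp add: indicator_def abs_less_iff)
  qed
  have "sqint F (Bn (Suc n)) \<rho> \<le> (\<integral>\<^sup>+x. ennreal (C\<^sup>2 * pi) * indicator {-\<rho>..\<rho>} x \<partial>lborel)"
    unfolding fub by (intro nn_integral_mono Gb)
  also have "\<dots> < \<infinity>" using C(2) by (simp add: nn_integral_cmult_indicator ennreal_mult_less_top)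
  finally have "L2 F (Bn (Suc n))" unfolding L2_def using C(2) by blast
  thus ?thesis using Fc unfolding F_def[symmetric] I2_def by simp
qed


section \<open>The Hardy space bound on a conjugate branch\<close>

lemma eval_lead_nonzero: "x \<noteq> 0 \<Longrightarrow> eval_fps (lead n) (of_real x) \<noteq> 0"
proof
  assume x: "x \<noteq> 0" and "eval_fps (lead n) (of_real x) = 0"
  then obtain j where "eval_fps (cb n) (of_real x) = eval_fps (b j) (of_real x)"
    by (auto simp: eval_lead ev_Bn)
  hence "Im (cnj (eval_fps (b n) (of_real x))) = Im (eval_fps (b j) (of_real x))" by (simp add: eval_cb_real)
  hence "x ^ (2 * L n) + x ^ (2 * L j) = 0" by (simp add: Im_b)
  moreover have "x ^ (2 * L i) > 0" for i using x by (simp add: power_mult)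
  ultimately show False using add_pos_pos[of "x ^ (2 * L n)" "x ^ (2 * L j)"] by simp
qed

text \<open>At fixed x > 0 all zeros of the denominator lie below the real axis, and
  \<open>hardy_bound\<close> applies at \<open>w = cb n\<close>, where sqrt (Im w) =
  \<open>x ^ L n\<close>. On the far sides of the rectangle |z| \<ge> s, while the branches stay
  within s / 2; this gives the constant K.\<close>

lemma hardy_bound_at_branch:
  fixes x :: real
  assumes C: "bnd \<rho> \<rho> F C" "\<rho> > 0" and s: "s > 0" "3 * s \<le> \<rho>" and x: "0 < x" "x < \<rho>" "x < 1"
    and sm: "\<And>j. j < Suc n \<Longrightarrow> norm (eval_fps (b j) (of_real x)) < s / 2"
  defines "h \<equiv> \<lambda>z. ev F (of_real x) z / ev (Bn (Suc n)) (of_real x) z"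
  defines "K \<equiv> C / (s / 2) ^ Suc n"
  obtains I where "((\<lambda>t. (norm (h (of_real t)))\<^sup>2) has_integral I) {-s..s}"
    "x ^ L n * norm (h (eval_fps (cb n) (of_real x))) \<le> I + 4 + 8 * K"
proof -
  let ?x = "complex_of_real x"
  have conF: "conv_on \<rho> F" using C by (auto simp: conv_on_def)
  have C0: "C \<ge> 0" using bnd_nonneg[OF C(1)] C(2) by simp
  have K0: "K \<ge> 0" using C0 s by (simp add: K_def)
  have xp: "x ^ (2 * L j) > 0" for j using x by simp
  \<comment> \<open>An open convex set around the closed rectangle, as \<open>hardy_bound\<close>
    requires: the half planes above the branches, cut with a disc in which F converges.\<close>
  define U where "U = ball 0 \<rho> \<inter> (\<Inter>j<Suc n. {z. Im z > Im (eval_fps (b j) ?x)})"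
  have U: "open U" "convex U"
    unfolding U_def
    by (intro open_Int open_ball open_INT ballI open_halfspace_Im_gt finite_lessThan,
        intro convex_Int convex_ball convex_INT convex_halfspace_Im_gt)
  have hol: "h holomorphic_on U"
    unfolding h_def
  proof (intro holomorphic_on_divide)
    show "ev F ?x holomorphic_on U"
      by (rule holomorphic_on_subset[OF ev_holomorphic_y[OF conF]]) (use x in \<open>auto simp: U_def\<close>)
    show "ev (Bn (Suc n)) ?x holomorphic_on U"
      unfolding ev_Bn[abs_def] by (intro holomorphic_intros)
    show "ev (Bn (Suc n)) ?x z \<noteq> 0" if "z \<in> U" for z
      using that unfolding ev_Bn by (auto simp: U_def)
  qed
  have rectU: "z \<in> U" if "\<bar>Re z\<bar> \<le> s" "0 \<le> Im z" "Im z \<le> s" for z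
  proof -
    have "norm z < \<rho>" using cmod_le[of z] that s by linarith
    moreover have "Im z > Im (eval_fps (b j) ?x)" for j using that xp[of j] by (simp add: Im_b)
    ultimately show ?thesis by (simp add: U_def)
  qed
  define w where "w = eval_fps (cb n) ?x"
  have wcnj: "w = cnj (eval_fps (b n) ?x)" by (simp add: w_def eval_cb_real)
  have wn: "norm w < s / 2" using sm[of n] by (simp add: wcnj)
  have wI: "Im w = x ^ (2 * L n)" by (simp add: wcnj Im_b)
  have w: "\<bar>Re w\<bar> \<le> s / 2" "0 < Im w" "Im w \<le> s / 2"
    using wn abs_Re_le_cmod[of w] abs_Im_le_cmod[of w] xp[of n] by (auto simp: wI)
  have sq: "sqrt (Im w) = x ^ L n"
  proof -
    have "Im w = (x ^ L n)\<^sup>2" by (simp add: wI power_mult mult.commute flip: power_mult)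
    thus ?thesis using x by (simp add: real_sqrt_abs)
  qed
  have "sqrt (Im w) * norm (h w) \<le> integral {-s..s} (\<lambda>t. (norm (h (of_real t)))\<^sup>2) + 4 + 8 * K * sqrt (Im w)"
  proof (rule hardy_bound[OF U hol s(1) rectU _ w])
    fix z assume z: "\<bar>Re z\<bar> \<le> s" "0 \<le> Im z" "Im z \<le> s" "\<bar>Re z\<bar> = s \<or> Im z = s"
    have zn: "norm z \<ge> s" using z abs_Re_le_cmod[of z] abs_Im_le_cmod[of z] by auto
    have "norm z \<le> \<rho>" using rectU[OF z(1-3)] by (simp add: U_def)
    hence "norm (ev F ?x z) \<le> C" using bnd_ev[OF C(1) C(2) C(2), of ?x z] x by simp
    moreover have "(s / 2) ^ Suc n \<le> norm (ev (Bn (Suc n)) ?x z)"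
    proof -
      have "(\<Prod>j<Suc n. s / 2) \<le> (\<Prod>j<Suc n. norm (z - eval_fps (b j) ?x))"
      proof (rule prod_mono)
        fix j assume "j \<in> {..<Suc n}"
        thus "0 \<le> s / 2 \<and> s / 2 \<le> norm (z - eval_fps (b j) ?x)"
          using sm[of j] zn norm_triangle_ineq2[of z "eval_fps (b j) ?x"] s by auto
      qed
      thus ?thesis unfolding ev_Bn by (simp only: prod_norm prod_constant card_lessThan)
    qed
    ultimately show "norm (h z) \<le> K"
      unfolding h_def K_def norm_divide using s C0 by (intro frac_le) auto
  qed
  hence "x ^ L n * norm (h w) \<le> integral {-s..s} (\<lambda>t. (norm (h (of_real t)))\<^sup>2) + 4 + 8 * K * x ^ L n"
    by (simp add: sq)
  also have "8 * K * x ^ L n \<le> 8 * K * 1" using x K0 by (intro mult_left_mono power_le_one) auto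
  finally have main: "x ^ L n * norm (h w) \<le> integral {-s..s} (\<lambda>t. (norm (h (of_real t)))\<^sup>2) + 4 + 8 * K" by simp
  have "continuous_on {-s..s} (\<lambda>t. h (complex_of_real t))"
  proof (rule continuous_on_compose2[OF holomorphic_on_imp_continuous_on[OF hol]])
    show "complex_of_real ` {- s..s} \<subseteq> U" using rectU s by auto
  qed (intro continuous_intros)
  hence "((\<lambda>t. (norm (h (of_real t)))\<^sup>2) has_integral integral {-s..s} (\<lambda>t. (norm (h (of_real t)))\<^sup>2)) {-s..s}"
    by (intro integrable_integral integrable_continuous_real continuous_intros)
  thus ?thesis using main unfolding w_def by (rule that)
qed

text \<open>On the branch \<open>y = cb n\<close> the quotient equals f / (2 i
  \<open>x ^ (2 * L n)\<close> \<open>lead n\<close>), of order m - k - 2 L. The Hardy bound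
  multiplies it by \<open>x ^ L n\<close> and dominates it by \<open>G x\<close> plus a constant,
  and G is integrable. So m - k - L \<le> -1 is impossible, because 1/x is not integrable at
  0.\<close>

theorem I2_vanishing_order:
  assumes F: "F \<in> I2 (Bn (Suc n))" and f: "f \<in> conv1" "f \<noteq> 0" and Q: "Q \<in> cser"
    and eq: "F = xser f + (yvar - xser (cb n)) * Q"
  shows "L n + subdegree (lead n) \<le> subdegree f"
proof (rule ccontr)
  define m where "m = subdegree f"
  define k where "k = subdegree (lead n)"
  assume "\<not> L n + subdegree (lead n) \<le> subdegree f"
  \<comment> \<open>Orders are integers, so a failure costs a full power of x, just enough for
    divergence.\<close>
  hence mlt: "m + 1 \<le> k + L n" by (simp add: m_def k_def)
  have "F \<in> cser" "L2 F (Bn (Suc n))" using F by (auto simp: I2_def)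
  then obtain \<rho>0 \<delta>1 where \<rho>0: "conv_on \<rho>0 F" and \<delta>1: "\<delta>1 > 0" "sqint F (Bn (Suc n)) \<delta>1 < \<infinity>"
    by (auto simp: cser_def L2_def)
  define r where "r = min \<rho>0 \<delta>1"
  have r: "r > 0" "conv_on r F" "sqint F (Bn (Suc n)) r < \<infinity>"
    using \<delta>1 conv_on_pos[OF \<rho>0] conv_on_mono[OF \<rho>0, of r] le_less_trans[OF sqint_mono[of r \<delta>1] \<delta>1(2)]
    by (auto simp: r_def)
  obtain C where C: "bnd r r F C" using r(2) by (auto simp: conv_on_def)
  define s where "s = r / 3"
  have s: "s > 0" "3 * s \<le> r" using r by (simp_all add: s_def)
  define K where "K = C / (s / 2) ^ Suc n"
  have K0: "K \<ge> 0" using bnd_nonneg[OF C] r s by (simp add: K_def)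
  define f1 where "f1 = fps_shift m f"
  define g1 where "g1 = fps_shift k (lead n)"
  have fg1: "f1 \<in> conv1" "g1 \<in> conv1" using f conv1_lead by (simp_all add: f1_def g1_def conv1_shift)
  define \<kappa>1 where "\<kappa>1 = norm (fps_nth f1 0) / 2"
  define \<kappa>2 where "\<kappa>2 = norm (fps_nth g1 0) + 1"
  have \<kappa>: "\<kappa>1 > 0" "\<kappa>2 > 0" using f(2) by (simp_all add: \<kappa>1_def \<kappa>2_def f1_def m_def add_nonneg_pos)
  \<comment> \<open>A lower bound for f over an upper bound for \<open>lead n\<close>, both stripped
    of their powers of x; the 2 comes from \<open>cb n - b n = 2 i x ^ (2 * L n)\<close>.\<close>
  define \<kappa> where "\<kappa> = \<kappa>1 / (2 * \<kappa>2)"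
  define G where "G x = (\<integral>\<^sup>+y. indicator (Sq r) (x,y) * ennreal ((norm (evr F (x,y) / evr (Bn (Suc n)) (x,y)))\<^sup>2) \<partial>lborel)" for x
  note fub = sqint_fubini[OF r(2) conv_on_Bn[OF r(1)] order_refl, of "Suc n", folded G_def]
  have e1: "\<forall>\<^sub>F x in at_right (0::real). 0 < x \<and> norm (complex_of_real x) < min r 1"
    using r by (intro eventually_small_real) simp
  have e2: "\<forall>\<^sub>F x in at_right (0::real). ev F (of_real x) (eval_fps (cb n) (of_real x)) = eval_fps f (of_real x)"
  proof -
    obtain \<delta> where "\<delta> > 0" "\<And>x. norm x < \<delta> \<Longrightarrow> ev F x (eval_fps (cb n) x) = eval_fps f x"
      using eval_linear_remainder[OF f(1) Q conv1_cb cb0, of n] unfolding eq by blast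
    thus ?thesis by (intro eventually_mono[OF eventually_small_real]) blast+
  qed
  have e3: "\<forall>\<^sub>F x in at_right (0::real). \<forall>j\<in>{..<Suc n}. norm (eval_fps (b j) (of_real x)) < s / 2"
  proof (intro eventually_ball_finite ballI finite_lessThan)
    fix j
    obtain \<delta> where "\<delta> > 0" "\<And>x. norm x < \<delta> \<Longrightarrow> norm (eval_fps (b j) x) < s / 2 \<and> evaluable x (b j)"
      using small_eval[OF conv1_b b0, of "s / 2" j] s by auto
    thus "\<forall>\<^sub>F x in at_right (0::real). norm (eval_fps (b j) (of_real x)) < s / 2"
      by (intro eventually_mono[OF eventually_small_real]) blast+
  qed
  have e4: "\<forall>\<^sub>F x in at_right (0::real). \<kappa>1 < norm (eval_fps f1 (of_real x))"
    using order_tendstoD(1)[OF tendsto_norm[OF tendsto_eval_fps_at_right[OF fg1(1)]], of \<kappa>1] \<kappa> by (simp add: \<kappa>1_def)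
  have e5: "\<forall>\<^sub>F x in at_right (0::real). norm (eval_fps g1 (of_real x)) < \<kappa>2"
    using order_tendstoD(2)[OF tendsto_norm[OF tendsto_eval_fps_at_right[OF fg1(2)]], of \<kappa>2] by (simp add: \<kappa>2_def)
  have "\<forall>\<^sub>F x in at_right (0::real). ennreal (\<kappa> / x) \<le> G x + ennreal (4 + 8 * K)"
    using e1 e2 e3 e4 e5 eventually_evaluable[OF f(1)] eventually_evaluable[OF conv1_lead[of n]]
  proof eventually_elim
    case (elim x)
    let ?x = "complex_of_real x"
    define h where "h = (\<lambda>z. ev F ?x z / ev (Bn (Suc n)) ?x z)"
    have x: "0 < x" "x < r" "x < 1" using elim(1) by auto
    obtain I where I: "((\<lambda>t. (norm (h (of_real t)))\<^sup>2) has_integral I) {-s..s}"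
      "x ^ L n * norm (h (eval_fps (cb n) ?x)) \<le> I + 4 + 8 * K"
      using hardy_bound_at_branch[OF C r(1) s x, of n] elim(3) unfolding h_def K_def by auto
    have I0: "I \<ge> 0" using I(1) by (rule has_integral_nonneg) simp
    have "ennreal I = (\<integral>\<^sup>+t. ennreal ((norm (h (of_real t)))\<^sup>2) * indicator {-s..s} t \<partial>lborel)"
      using nn_integral_has_integral_lebesgue'[OF _ I(1)] by simp
    also have "\<dots> \<le> G x"
      unfolding G_def
    proof (intro nn_integral_mono)
      fix t :: real
      show "ennreal ((norm (h (of_real t)))\<^sup>2) * indicator {-s..s} t
          \<le> indicator (Sq r) (x,t) * ennreal ((norm (evr F (x,t) / evr (Bn (Suc n)) (x,t)))\<^sup>2)"
      proof (cases "t \<in> {-s..s}")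
        case True
        hence "(x,t) \<in> Sq r" using x s by (auto simp: Sq_def)
        thus ?thesis using True by (simp add: h_def evr_def)
      qed simp
    qed
    finally have IG: "ennreal I \<le> G x" .
    define p where "p = norm (eval_fps f ?x)"
    define g where "g = norm (eval_fps (lead n) ?x)"
    have g0: "g > 0" using eval_lead_nonzero[of x n] x by (simp add: g_def)
    have "ev (Bn (Suc n)) ?x (eval_fps (cb n) ?x) = eval_fps (lead n) ?x * (2 * \<i> * ?x ^ (2 * L n))"
      by (simp add: eval_lead eval_cb_diff[symmetric]) (simp add: ev_Bn)
    hence hw: "norm (h (eval_fps (cb n) ?x)) = p / (g * (2 * x ^ (2 * L n)))"
      using elim(2) x by (simp add: h_def p_def g_def norm_divide norm_mult norm_power)
    have pb: "p \<ge> x ^ m * \<kappa>1"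
      using eval_fps_subdegree[OF elim(6)] elim(4) x
      by (simp add: p_def norm_mult norm_power f1_def m_def mult_left_mono)
    have gb: "g \<le> x ^ k * \<kappa>2"
      using eval_fps_subdegree[OF elim(7)] elim(5) x
      by (simp add: g_def norm_mult norm_power g1_def k_def mult_left_mono)
    have "\<kappa> / x = (x ^ m * \<kappa>1) / (2 * \<kappa>2 * x ^ (m + 1))"
      using x by (simp add: \<kappa>_def field_simps)
    also have "\<dots> \<le> p / (2 * (g * x ^ L n))"
    proof (rule frac_le)
      have "g * x ^ L n \<le> x ^ k * \<kappa>2 * x ^ L n" using gb x by (intro mult_right_mono) auto
      also have "\<dots> = \<kappa>2 * x ^ (k + L n)" by (simp add: power_add)
      also have "\<dots> \<le> \<kappa>2 * x ^ (m + 1)"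
        using x mlt \<kappa> by (intro mult_left_mono power_decreasing) auto
      finally show "2 * (g * x ^ L n) \<le> 2 * \<kappa>2 * x ^ (m + 1)" by simp
      show "0 \<le> p" by (simp add: p_def)
      show "0 < 2 * (g * x ^ L n)" using g0 x by simp
    qed (rule pb)
    also have "\<dots> = x ^ L n * (p / (g * (2 * x ^ (2 * L n))))"
    proof -
      define X where "X = x ^ L n"
      have X: "X > 0" "x ^ (2 * L n) = X * X" using x by (simp_all add: X_def mult_2 power_add)
      show ?thesis unfolding X(2) X_def[symmetric] using g0 X(1) by simp
    qed
    also have "\<dots> \<le> I + (4 + 8 * K)" using I(2) hw by simp
    finally have "ennreal (\<kappa> / x) \<le> ennreal (I + (4 + 8 * K))" by (rule ennreal_leI)
    also have "\<dots> = ennreal I + ennreal (4 + 8 * K)" using I0 K0 by (intro ennreal_plus) auto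
    also have "\<dots> \<le> G x + ennreal (4 + 8 * K)" using IG by (intro add_right_mono)
    finally show ?case .
  qed
  then obtain \<delta> where \<delta>: "\<delta> > 0" "\<And>x. 0 < x \<Longrightarrow> x < \<delta> \<Longrightarrow> ennreal (\<kappa> / x) \<le> G x + ennreal (4 + 8 * K)"
    unfolding eventually_at_right_field by blast
  have "(\<integral>\<^sup>+x. ennreal (\<kappa> / x) * indicator {0<..<\<delta>} x \<partial>lborel)
      \<le> (\<integral>\<^sup>+x. G x + ennreal (4 + 8 * K) * indicator {0<..<\<delta>} x \<partial>lborel)"
    using \<delta>(2) by (intro nn_integral_mono) (auto simp: indicator_def)
  also have "\<dots> = sqint F (Bn (Suc n)) r + ennreal (4 + 8 * K) * emeasure lborel {0<..<\<delta>}"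
    unfolding fub(2) using fub(1) by (subst nn_integral_add) (auto simp: nn_integral_cmult_indicator)
  also have "\<dots> < \<infinity>" using r(3) \<delta>(1) by (simp add: ennreal_mult_less_top)
  finally show False
    using nn_integral_inverse_infinite[of \<kappa> \<delta>] \<delta>(1) \<kappa> by (simp add: \<kappa>_def)
qed

text \<open>Between all convergent series and \<open>I2 (Bn (Suc n))\<close> lies J, the series
  whose restriction to the branch \<open>y = cb n\<close> is divisible by
  \<open>x ^ (l + k)\<close>. The powers of x below this exponent are a basis modulo J, and
  multiplication by D identifies the quotient by \<open>I2 (Bn n)\<close> with J modulo
  \<open>I2 (Bn (Suc n))\<close>.\<close>

lemma codim_I2_step:
  assumes IH: "codim cser (I2 (Bn n)) d"
  shows "codim cser (I2 (Bn (Suc n))) (L n + subdegree (lead n) + d)"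
proof -
  define l where "l = L n"
  define k where "k = subdegree (lead n)"
  define g1 where "g1 = fps_shift k (lead n)"
  have g1: "g1 \<in> conv1" "fps_nth g1 0 \<noteq> 0"
    using conv1_lead lead_nonzero[of n] by (simp_all add: g1_def k_def conv1_shift)
  have lead: "lead n = fps_X ^ k * g1"
    unfolding g1_def k_def using subdegree_decompose[of "lead n"] by (simp add: mult.commute)
  have ig1: "inverse g1 \<in> conv1" "g1 * inverse g1 = 1"
    using g1 by (simp_all add: conv1_inverse inverse_mult_eq_1')
  define D where "D = yvar - xser (cb n)"
  have D: "D \<in> cser" unfolding D_def by (intro cser_diff cser_yvar xser_cser conv1_cb)
  define J where "J = {xser (fps_X ^ (l + k) * e) + D * G | e G. e \<in> conv1 \<and> G \<in> cser}"
  have JI: "xser (fps_X ^ (l + k) * e) + D * G \<in> J" if "e \<in> conv1" "G \<in> cser" for e G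
    using that unfolding J_def by blast
  have Jsub: "J \<subseteq> cser"
    unfolding J_def using D by (auto intro!: cser_add cser_mult xser_cser conv1_mult conv1_power)
  have Jsp: "subsp J"
    unfolding subsp_def
  proof (intro conjI ballI allI)
    show "0 \<in> J" using JI[of 0 0] by simp
    fix p assume "p \<in> J"
    then obtain e G where p: "p = xser (fps_X ^ (l + k) * e) + D * G" "e \<in> conv1" "G \<in> cser" by (auto simp: J_def)
    show "p + q \<in> J" if q: "q \<in> J" for q
    proof -
      obtain e' G' where q: "q = xser (fps_X ^ (l + k) * e') + D * G'" "e' \<in> conv1" "G' \<in> cser"
        using q by (auto simp: J_def)
      have "p + q = xser (fps_X ^ (l + k) * (e + e')) + D * (G + G')"
        unfolding p q distrib_left fps_const_add[symmetric] by (simp only: ac_simps)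
      thus ?thesis using JI[of "e + e'" "G + G'"] p q by (simp add: conv1_add cser_add)
    qed
    show "cc c * p \<in> J" for c
    proof -
      have "cc c * p = xser (fps_X ^ (l + k) * (fps_const c * e)) + D * (cc c * G)"
        unfolding p distrib_left by (simp add: fps_const_mult[symmetric] mult_ac del: fps_const_mult)
      thus ?thesis using JI[of "fps_const c * e" "cc c * G"] p by (simp add: conv1_mult cser_mult)
    qed
  qed
  have "codim cser J (l + k)"
    unfolding codim_def
  proof (intro exI[of _ "\<lambda>i. xser (fps_X ^ i)"] conjI ballI allI impI)
    have lcx: "lc (l + k) a (\<lambda>i. xser (fps_X ^ i)) = xser (\<Sum>i<l + k. fps_const (a i) * fps_X ^ i)" for a
    proof -
      have xs: "xser (\<Sum>i\<in>I. g i) = (\<Sum>i\<in>I. xser (g i))" for g :: "nat \<Rightarrow> complex fps" and I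
        by (induction I rule: infinite_finite_induct) (simp_all flip: fps_const_add)
      show ?thesis unfolding lc_def xs by simp
    qed
    show "xser (fps_X ^ i) \<in> cser" for i by (intro xser_cser conv1_power) simp
    show "\<exists>a. v - lc (l + k) a (\<lambda>i. xser (fps_X ^ i)) \<in> J" if v: "v \<in> cser" for v
    proof -
      obtain f Q where f: "f \<in> conv1" "Q \<in> cser" "v = xser f + D * Q"
        unfolding D_def by (rule linear_remainder[OF v conv1_cb cb0])
      have "f - (\<Sum>i<l + k. fps_const (fps_nth f i) * fps_X ^ i) = fps_X ^ (l + k) * fps_shift (l + k) f"
        by (rule fps_ext) (auto simp: fps_poly_part_nth fps_X_power_mult_nth)
      hence "v - lc (l + k) (fps_nth f) (\<lambda>i. xser (fps_X ^ i)) = xser (fps_X ^ (l + k) * fps_shift (l + k) f) + D * Q"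
        unfolding lcx f(3) by (simp flip: fps_const_sub)
      thus ?thesis using JI[OF conv1_shift[OF f(1)] f(2)] by metis
    qed
    show "indep_seq (l + k) (\<lambda>i. xser (fps_X ^ i)) J"
      unfolding indep_seq_def
    proof (intro allI impI)
      fix a i assume a: "lc (l + k) a (\<lambda>i. xser (fps_X ^ i)) \<in> J" and i: "i < l + k"
      then obtain e G where "xser (\<Sum>i<l + k. fps_const (a i) * fps_X ^ i) = xser (fps_X ^ (l + k) * e) + D * G"
        unfolding lcx J_def by blast
      hence eq: "(\<Sum>i<l + k. fps_const (a i) * fps_X ^ i) = fps_X ^ (l + k) * e"
        unfolding D_def by (rule linear_remainder_unique[OF _ conv1_cb cb0])
      show "a i = 0" using arg_cong[OF eq, of "\<lambda>p. fps_nth p i"] i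
        by (simp add: fps_poly_part_nth fps_X_power_mult_nth)
    qed
  qed
  moreover have "codim J (I2 (Bn (Suc n))) d"
  proof (rule codim_map[OF IH, where D=D])
    show "subsp cser" by (rule subsp_cser)
    show "subsp (I2 (Bn (Suc n)))" by (rule subsp_I2[OF cser_Bn])
    show "D * v \<in> J" if "v \<in> cser" for v using JI[of 0 v] that by simp
    show "v \<in> I2 (Bn n)" if "v \<in> cser" "D * v \<in> I2 (Bn (Suc n))" for v
      using I2_conj_factor_iff[OF that(1)] that(2) by (simp add: D_def)
    show "D * w \<in> I2 (Bn (Suc n))" if w: "w \<in> I2 (Bn n)" for w
    proof -
      have "w \<in> cser" using w by (simp add: I2_def)
      from I2_conj_factor_iff[OF this] show ?thesis using w by (simp add: D_def)
    qed
    fix v' assume "v' \<in> J"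
    then obtain e G where v': "v' = xser (fps_X ^ (l + k) * e) + D * G" "e \<in> conv1" "G \<in> cser" by (auto simp: J_def)
    obtain Q where Q: "Q \<in> cser" "Bn n = xser (lead n) + D * Q" unfolding D_def by (rule Bn_mod)
    \<comment> \<open>As \<open>u * lead n\<close> is \<open>x ^ (l + k) * e\<close>, the product
      \<open>u * Bn n\<close> has the same restriction to the branch as v'. It is square integrable
      by \<open>I2_principal_part\<close>, because u is divisible by \<open>x ^ l\<close>.\<close>
    define u where "u = fps_X ^ l * (inverse g1 * e)"
    have u: "u \<in> conv1" unfolding u_def using ig1 v' by (intro conv1_mult conv1_power) auto
    have "fps_X ^ (l + k) * e = u * lead n"
    proof -
      have "u * lead n = fps_X ^ l * fps_X ^ k * (g1 * inverse g1) * e"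
        unfolding u_def lead by (simp only: ac_simps)
      thus ?thesis using ig1 by (simp add: power_add)
    qed
    hence "v' = xser u * xser (lead n) + D * G" using v' by simp
    also have "xser (lead n) = Bn n - D * Q" using Q by simp
    finally have "v' - D * (G - xser u * Q) = xser u * Bn n" by (simp add: algebra_simps)
    moreover have "xser u * Bn n \<in> I2 (Bn (Suc n))"
      unfolding u_def l_def using ig1 v' by (intro I2_principal_part conv1_mult)
    moreover have "G - xser u * Q \<in> cser" using v' Q u by (intro cser_diff cser_mult xser_cser)
    ultimately show "\<exists>v\<in>cser. v' - D * v \<in> I2 (Bn (Suc n))" by metis
  qed
  moreover have "I2 (Bn (Suc n)) \<subseteq> J"
  proof
    fix F assume F: "F \<in> I2 (Bn (Suc n))"
    hence "F \<in> cser" by (simp add: I2_def)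
    then obtain f Q where f: "f \<in> conv1" "Q \<in> cser" "F = xser f + D * Q"
      unfolding D_def by (rule linear_remainder[OF _ conv1_cb cb0])
    have "f = fps_X ^ (l + k) * fps_shift (l + k) f"
    proof (cases "f = 0")
      case False
      have "l + k \<le> subdegree f"
        unfolding l_def k_def by (rule I2_vanishing_order[OF F f(1) False f(2) f(3)[unfolded D_def]])
      thus ?thesis by (intro fps_ext) (auto simp: fps_X_power_mult_nth intro!: nth_less_subdegree_zero)
    qed simp
    thus "F \<in> J" using f JI[OF conv1_shift[OF f(1)] f(2), of "l + k"] by simp
  qed
  ultimately show ?thesis
    using codim_trans[of cser J "l + k" "I2 (Bn (Suc n))" d] Jsp subsp_I2[OF cser_Bn] Jsub
    by (simp add: l_def k_def)
qed

section \<open>Counting the dimensions for a product of factors\<close>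

theorem codim_I2: "codim cser (I2 (Bn n)) (\<Sum>j<n. L j + subdegree (lead j))"
proof (induction n)
  case 0
  have "cser \<subseteq> I2 (Bn 0)" by (auto simp: I2_def Bn_def L2_1)
  thus ?case by (simp add: codim_0)
next
  case (Suc n)
  from codim_I2_step[OF Suc] show ?case by (simp add: add_ac)
qed

lemma subdegree_lead: "subdegree (lead j) = (\<Sum>k<j. subdegree (cb j - b k))"
proof -
  have sp: "subdegree (\<Prod>i\<in>I. f i) = (\<Sum>i\<in>I. subdegree (f i))"
    if "(\<Prod>i\<in>I. f i) \<noteq> 0" "finite I" for I and f :: "nat \<Rightarrow> complex fps"
    using that(2,1) by (induction I rule: finite_induct) (auto simp: subdegree_mult)
  show ?thesis unfolding lead_def by (rule sp) (use lead_nonzero[of j] in \<open>simp_all add: lead_def\<close>)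
qed

text \<open>Conjugating the coefficients of \<open>cb j - b k\<close> gives the negative of
  \<open>cb k - b j\<close>, and neither operation changes the order.\<close>

lemma subdegree_sym: "subdegree (cb j - b k) = subdegree (cb k - b j)"
proof -
  have sc: "subdegree (cnjf f) = subdegree f" for f
  proof (cases "f = 0")
    case False
    show ?thesis
    proof (rule subdegreeI)
      show "fps_nth (cnjf f) (subdegree f) \<noteq> 0" using nth_subdegree_nonzero[OF False] by simp
      show "fps_nth (cnjf f) i = 0" if "i < subdegree f" for i
        using nth_less_subdegree_zero[OF that] by simp
    qed
  qed simp
  have "cnjf (cb j - b k) = - (cb k - b j)" by (rule fps_ext) (simp add: cb_def)
  hence "subdegree (cb j - b k) = subdegree (- (cb k - b j))" using sc[of "cb j - b k"] by metis
  thus ?thesis by (simp only: subdegree_uminus)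
qed

text \<open>The matrix of orders is symmetric with even diagonal entries \<open>2 * L n\<close>;
  passing from n to n + 1 adds a row and an equal column.\<close>

lemma intersection_number_even:
  "(\<Sum>j<n. \<Sum>k<n. subdegree (cb j - b k)) = 2 * (\<Sum>j<n. L j + subdegree (lead j))"
proof (induction n)
  case 0 thus ?case by simp
next
  case (Suc n)
  have diag: "subdegree (cb n - b n) = 2 * L n"
    unfolding cb_def bdiff by (simp add: subdegree_mult)
  have "(\<Sum>j<Suc n. \<Sum>k<Suc n. subdegree (cb j - b k))
      = (\<Sum>j<n. \<Sum>k<n. subdegree (cb j - b k)) + (\<Sum>j<n. subdegree (cb j - b n))
        + (\<Sum>k<n. subdegree (cb n - b k)) + subdegree (cb n - b n)"
    by (simp add: sum.distrib)
  also have "(\<Sum>j<n. subdegree (cb j - b n)) = (\<Sum>k<n. subdegree (cb n - b k))"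
    by (intro sum.cong refl subdegree_sym)
  finally have E: "(\<Sum>j<Suc n. \<Sum>k<Suc n. subdegree (cb j - b k))
      = (\<Sum>j<n. \<Sum>k<n. subdegree (cb j - b k)) + (\<Sum>k<n. subdegree (cb n - b k))
        + (\<Sum>k<n. subdegree (cb n - b k)) + subdegree (cb n - b n)" .
  have "(\<Sum>j<Suc n. L j + subdegree (lead j)) = (\<Sum>j<n. L j + subdegree (lead j)) + (L n + (\<Sum>k<n. subdegree (cb n - b k)))"
    by (simp only: sum.lessThan_Suc subdegree_lead)
  thus ?case using E Suc diag by linarith
qed


lemma weierstrass_poly_Bn: "weierstrass_poly n (Bn n)"
proof -
  have "fps_nth (Bn n) n = 1 \<and> (\<forall>j>n. fps_nth (Bn n) j = 0) \<and> (\<forall>j<n. cf (Bn n) 0 j = 0)"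
  proof (induction n)
    case 0 thus ?case by (simp add: Bn_def)
  next
    case (Suc n)
    have nth: "fps_nth (Bn (Suc n)) j = (if j = 0 then 0 else fps_nth (Bn n) (j - 1)) - fps_nth (Bn n) j * b n" for j
      unfolding Bn_Suc right_diff_distrib by (simp add: fps_X_mult_right_nth)
    show ?case using Suc b0[of n] by (auto simp: nth)
  qed
  thus ?thesis using cser_Bn by (simp add: weierstrass_poly_def)
qed

lemma eventually_lower: "\<forall>\<^sub>F x in at_right (0::real). Im (eval_fps (b k) (of_real x)) < 0"
  using eventually_at_right_less[of 0] by eventually_elim (simp add: Im_b)

lemma codim_idl_comparable:
  assumes "weierstrass_poly M W" "\<epsilon> > 0"
    and "\<forall>\<^sub>F x in at_right (0::real). \<forall>z. norm z < \<epsilon> \<longrightarrow> ev W (of_real x) z = 0 \<longrightarrow> Im z < 0"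
    and "\<forall>\<^sub>F x in at_right (0::real). \<forall>y::real. \<bar>y\<bar> < \<epsilon> \<longrightarrow>
        norm (ev W (of_real x) (of_real y)) \<le> C * norm (ev (Bn M) (of_real x) (of_real y)) \<and>
        norm (ev (Bn M) (of_real x) (of_real y)) \<le> C * norm (ev W (of_real x) (of_real y))"
  shows "codim cser (idl W (bar W)) (2 * (\<Sum>j<M. L j + subdegree (lead j)))"
  using codim_idl_stable[OF assms(1) conv1_b b0 eventually_lower assms(2,3), of C] assms(4)
  by (simp add: ev_Bn intersection_number_even[symmetric] cb_def)

lemma codim_idl_Bn: "codim cser (idl (Bn M) (bar (Bn M))) (2 * (\<Sum>j<M. L j + subdegree (lead j)))"
proof (rule codim_idl_comparable[where \<epsilon>=1 and C=1])
  show "\<forall>\<^sub>F x in at_right (0::real). \<forall>z. norm z < 1 \<longrightarrow> ev (Bn M) (of_real x) z = 0 \<longrightarrow> Im z < 0"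
    using eventually_at_right_less[of 0] by eventually_elim (auto simp: ev_Bn Im_b)
qed (simp_all add: weierstrass_poly_Bn)

text \<open>The ideal lies in \<open>I2 (Bn M)\<close>, and in the ring of all convergent series it
  has twice the codimension of \<open>I2 (Bn M)\<close>; additivity leaves the same number for the
  quotient of the two.\<close>

lemma codim_I2_idl: "codim (I2 (Bn M)) (idl (Bn M) (bar (Bn M))) (\<Sum>j<M. L j + subdegree (lead j))"
proof -
  have sub: "subsp (I2 (Bn M))" "subsp (idl (Bn M) (bar (Bn M)))" "idl (Bn M) (bar (Bn M)) \<subseteq> I2 (Bn M)"
    "I2 (Bn M) \<subseteq> cser"
    using subsp_I2[OF cser_Bn] subsp_idl idl_bar_subset_I2[OF cser_Bn] by (auto simp: I2_def)
  obtain n where n: "codim (I2 (Bn M)) (idl (Bn M) (bar (Bn M))) n"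
    using codim_subspace_exists[OF codim_idl_Bn sub(1,2,4)] by blast
  have "(\<Sum>j<M. L j + subdegree (lead j)) + n = 2 * (\<Sum>j<M. L j + subdegree (lead j))"
    using codim_unique[OF codim_trans[OF codim_I2 n sub] codim_idl_Bn sub(2)] .
  thus ?thesis using n by simp
qed

end

subsection \<open>Polynomials\<close>

lemma poly2_conv_on:
  assumes "poly2 c" "\<rho> > 0"
  shows "conv_on \<rho> (to_ser c)"
proof -
  have "finite {ij \<in> UNIV. (\<lambda>(i,j). norm (c (i,j)) * \<rho> ^ (i + j)) ij \<noteq> 0}"
    using assms(1) unfolding poly2_def by (rule finite_subset[rotated]) auto
  hence "(\<lambda>(i,j). norm (c (i,j)) * \<rho> ^ (i + j)) summable_on UNIV"
    by (rule finite_nonzero_values_imp_summable_on)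
  thus ?thesis using assms by (simp add: conv_on_iff_summable_on)
qed

lemma poly2_ps_eval:
  assumes "poly2 c"
  shows "ps_eval c x y = ev (to_ser c) x y"
proof -
  define \<rho> where "\<rho> = norm x + norm y + 1"
  have "\<rho> > 0" "norm x < \<rho>" "norm y < \<rho>" by (auto simp: \<rho>_def add_nonneg_pos)
  thus ?thesis by (intro ps_eval_eq_ev[of \<rho>] poly2_conv_on assms)
qed

lemma poly2_cser: "poly2 c \<Longrightarrow> to_ser c \<in> cser"
  unfolding cser_def using poly2_conv_on[of c 1] by auto

lemma poly2_y_degree:
  assumes "poly2 c"
  obtains d where "\<And>j. j \<ge> d \<Longrightarrow> fps_nth (to_ser c) j = 0"
proof -
  obtain d where d: "\<forall>k\<in>snd ` {ij. c ij \<noteq> 0}. k < d"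
    using assms finite_nat_set_iff_bounded[of "snd ` {ij. c ij \<noteq> 0}"] unfolding poly2_def by auto
  have "fps_nth (to_ser c) j = 0" if "j \<ge> d" for j
  proof (rule fps_ext)
    fix i
    have "c (i,j) = 0" using d that by force
    thus "fps_nth (fps_nth (to_ser c) j) i = fps_nth 0 i" by simp
  qed
  thus ?thesis by (rule that)
qed

lemma continuous_ev_poly2:
  assumes "poly2 c"
  shows "continuous_on UNIV (\<lambda>z. ev (to_ser c) (fst z) (snd z))"
proof -
  have "ev (to_ser c) x y = (\<Sum>ij\<in>{ij. c ij \<noteq> 0}. c ij * x ^ fst ij * y ^ snd ij)" for x y
  proof -
    have "ev (to_ser c) x y = infsum (\<lambda>ij. c ij * x ^ fst ij * y ^ snd ij) UNIV"
      unfolding poly2_ps_eval[OF assms, symmetric] ps_eval_def by (simp add: case_prod_unfold)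
    also have "\<dots> = infsum (\<lambda>ij. c ij * x ^ fst ij * y ^ snd ij) {ij. c ij \<noteq> 0}"
      by (rule infsum_cong_neutral) auto
    finally show ?thesis using assms by (simp add: poly2_def)
  qed
  thus ?thesis by (simp only:) (intro continuous_intros)
qed

lemma idl_units:
  assumes "U \<in> cser" "V \<in> cser" "V * U = 1" "U' \<in> cser" "V' \<in> cser" "V' * U' = 1"
  shows "idl (U * F) (U' * G) = idl F G"
proof (intro equalityI subsetI)
  fix p assume "p \<in> idl (U * F) (U' * G)"
  then obtain a c where "p = a * (U * F) + c * (U' * G)" "a \<in> cser" "c \<in> cser" by (auto simp: idl_def)
  hence "p = (a * U) * F + (c * U') * G" "a * U \<in> cser" "c * U' \<in> cser"
    using assms by (auto simp: mult.assoc intro: cser_mult)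
  thus "p \<in> idl F G" unfolding idl_def by blast
next
  fix p assume "p \<in> idl F G"
  then obtain a c where p: "p = a * F + c * G" "a \<in> cser" "c \<in> cser" by (auto simp: idl_def)
  have "p = (a * (V * U)) * F + (c * (V' * U')) * G" unfolding p assms by simp
  also have "\<dots> = (a * V) * (U * F) + (c * V') * (U' * G)" by (simp only: mult.assoc)
  finally show "p \<in> idl (U * F) (U' * G)"
    unfolding idl_def using assms p by (blast intro: cser_mult)
qed

lemma to_ser_ps_bar: "to_ser (ps_bar c) = bar (to_ser c)"
  by (rule ser_eqI) (simp add: ps_bar_def)

lemma to_ser_ideal2: "to_ser ` ideal2 F G = idl (to_ser F) (to_ser G)"
proof (intro equalityI subsetI)
  fix p assume "p \<in> to_ser ` ideal2 F G"
  then obtain A B where "p = to_ser A * to_ser F + to_ser B * to_ser G" "to_ser A \<in> cser" "to_ser B \<in> cser"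
    by (auto simp: ideal2_def to_ser_add to_ser_mult ps_conv_iff)
  thus "p \<in> idl (to_ser F) (to_ser G)" unfolding idl_def by blast
next
  fix p assume "p \<in> idl (to_ser F) (to_ser G)"
  then obtain a c where p: "p = a * to_ser F + c * to_ser G" "a \<in> cser" "c \<in> cser" by (auto simp: idl_def)
  define A where "A = (\<lambda>(i,j). cf a i j)"
  define C where "C = (\<lambda>(i,j). cf c i j)"
  have AC: "to_ser A = a" "to_ser C = c" by (simp_all add: A_def C_def to_ser_surj)
  have "p = to_ser (ps_add (ps_mult A F) (ps_mult C G))"
    by (simp add: p AC to_ser_add to_ser_mult)
  moreover have "ps_conv A" "ps_conv C" using p AC by (simp_all add: ps_conv_iff)
  ultimately show "p \<in> to_ser ` ideal2 F G" unfolding ideal2_def by blast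
qed

lemma to_ser_image: "to_ser ` {c. R (to_ser c)} = {f. R f}"
proof (intro equalityI subsetI)
  fix f assume "f \<in> {f. R f}"
  thus "f \<in> to_ser ` {c. R (to_ser c)}" using to_ser_surj[of f] by (intro image_eqI[of _ _ "\<lambda>(i,j). cf f i j"]) auto
qed auto

subsection \<open>Local integrability\<close>

text \<open>This permits full neighbourhoods of the origin to be replaced by the sets
  \<open>Sq \<delta>\<close>.\<close>

lemma AE_fst_nonzero: "AE z in (lborel :: (real \<times> real) measure). fst z \<noteq> 0"
proof -
  have "emeasure (lborel \<Otimes>\<^sub>M lborel) ({0::real} \<times> (UNIV :: real set)) = emeasure lborel {0::real} * emeasure lborel (UNIV :: real set)"
    by (rule lborel.emeasure_pair_measure_Times) auto
  hence "emeasure lborel ({0::real} \<times> (UNIV :: real set)) = 0" by (simp add: lborel_prod)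
  hence "{0::real} \<times> (UNIV :: real set) \<in> null_sets lborel"
    by (intro null_setsI) (auto intro!: borel_closed closed_Times)
  thus ?thesis by (rule AE_I') auto
qed

lemma powr_2_eq: "norm (z :: complex) powr 2 = (norm z)\<^sup>2"
  by (cases "z = 0") auto

text \<open>The full square V and the punctured square \<open>Sq\<close> differ by a null set.
  Inside the bidisc of convergence the two integrands agree pointwise, also at zeros of P, where
  both quotients are 0.\<close>

lemma Lp_loc_iff_L2:
  assumes P: "poly2 P" and Q: "ps_conv Q"
  shows "Lp_loc 2 (\<lambda>(x,y). ps_eval Q (of_real x) (of_real y) / ps_eval P (of_real x) (of_real y))
    \<longleftrightarrow> L2 (to_ser Q) (to_ser P)"
proof -
  define f where "f = (\<lambda>(x,y). ps_eval Q (complex_of_real x) (of_real y) / ps_eval P (of_real x) (of_real y))"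
  obtain \<rho> where \<rho>: "conv_on \<rho> (to_ser Q)" using Q by (auto simp: ps_conv_iff cser_def)
  note pos = conv_on_pos[OF \<rho>]
  have cP: "conv_on \<rho> (to_ser P)" by (rule poly2_conv_on[OF P pos])
  define V where "V \<delta> = {z :: real \<times> real. \<bar>fst z\<bar> < \<delta> \<and> \<bar>snd z\<bar> < \<delta>}" for \<delta> :: real
  have Vo: "open (V \<delta>)" for \<delta>
  proof -
    have "V \<delta> = {z. \<bar>fst z\<bar> < \<delta>} \<inter> {z. \<bar>snd z\<bar> < \<delta>}" by (auto simp: V_def)
    thus ?thesis by (simp only:) (intro open_Int open_Collect_less continuous_intros)
  qed
  have fV: "f z = evr (to_ser Q) z / evr (to_ser P) z" if "z \<in> V \<rho>" for z
    using that ps_eval_eq_ev[OF \<rho>, of "of_real (fst z)" "of_real (snd z)"] poly2_ps_eval[OF P]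
    by (simp add: f_def case_prod_unfold evr_def V_def)
  show ?thesis unfolding f_def[symmetric]
  proof
    assume "Lp_loc 2 f"
    then obtain U where U: "open U" "(0,0) \<in> U" "(\<integral>\<^sup>+ z \<in> U. ennreal (norm (f z) powr 2) \<partial>lborel) < \<infinity>"
      unfolding Lp_loc_def by blast
    obtain e where e: "e > 0" "ball (0,0) e \<subseteq> U" using U(1,2) open_contains_ball by blast
    define \<delta> where "\<delta> = min \<rho> (e / 2)"
    have \<delta>: "\<delta> > 0" "\<delta> \<le> \<rho>" using pos e by (auto simp: \<delta>_def)
    have sub: "Sq \<delta> \<subseteq> U" "Sq \<delta> \<subseteq> V \<rho>"
    proof -
      have "z \<in> ball (0,0) e" if "z \<in> Sq \<delta>" for z
      proof -
        have "norm z \<le> \<bar>fst z\<bar> + \<bar>snd z\<bar>" using norm_Pair_le[of "fst z" "snd z"] by simp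
        also have "\<dots> < e" using that by (simp add: Sq_def \<delta>_def)
        finally show ?thesis by (simp add: dist_norm zero_prod_def[symmetric])
      qed
      thus "Sq \<delta> \<subseteq> U" using e(2) by blast
      show "Sq \<delta> \<subseteq> V \<rho>" using \<delta> by (auto simp: Sq_def V_def)
    qed
    have "sqint (to_ser Q) (to_ser P) \<delta> \<le> (\<integral>\<^sup>+ z \<in> U. ennreal (norm (f z) powr 2) \<partial>lborel)"
      unfolding sqint_def
    proof (intro nn_integral_mono)
      fix z :: "real \<times> real"
      show "indicator (Sq \<delta>) z * ennreal ((norm (evr (to_ser Q) z / evr (to_ser P) z))\<^sup>2)
          \<le> ennreal (norm (f z) powr 2) * indicator U z"
      proof (cases "z \<in> Sq \<delta>")
        case True
        hence "z \<in> U" "z \<in> V \<rho>" using sub by auto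
        thus ?thesis using True fV[of z] by (simp add: powr_2_eq)
      qed simp
    qed
    thus "L2 (to_ser Q) (to_ser P)" using U(3) \<delta>(1) unfolding L2_def by (meson le_less_trans)
  next
    assume "L2 (to_ser Q) (to_ser P)"
    then obtain \<delta>0 where \<delta>0: "\<delta>0 > 0" "sqint (to_ser Q) (to_ser P) \<delta>0 < \<infinity>" by (auto simp: L2_def)
    define \<delta> where "\<delta> = min \<rho> \<delta>0"
    have \<delta>: "\<delta> > 0" "\<delta> \<le> \<rho>" "\<delta> \<le> \<delta>0" using pos \<delta>0 by (auto simp: \<delta>_def)
    have VV: "V \<delta> \<subseteq> V \<rho>" using \<delta> by (auto simp: V_def)
    have meas: "(\<lambda>z. indicator (V \<delta>) z *\<^sub>R evr g z) \<in> borel_measurable borel" if "conv_on \<rho> g" for g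
    proof (rule borel_measurable_continuous_on_indicator)
      show "V \<delta> \<in> sets borel" using Vo by simp
      have "continuous_on (V \<delta>) (\<lambda>z. (\<lambda>(x,y). ev g x y) (complex_of_real (fst z), complex_of_real (snd z)))"
        by (rule continuous_on_compose2[OF continuous_on_ev[OF that]])
           (use \<delta>(2) in \<open>auto simp: V_def intro!: continuous_intros\<close>)
      thus "continuous_on (V \<delta>) (evr g)" by (simp add: evr_def[abs_def])
    qed
    show "Lp_loc 2 f"
      unfolding Lp_loc_def
    proof (intro exI[of _ "V \<delta>"] conjI)
      show "open (V \<delta>)" by (rule Vo)
      show "(0,0) \<in> V \<delta>" using \<delta> by (simp add: V_def)
      have [measurable]: "(\<lambda>z. indicator (V \<delta>) z *\<^sub>R evr (to_ser Q) z) \<in> borel_measurable borel"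
        "(\<lambda>z. indicator (V \<delta>) z *\<^sub>R evr (to_ser P) z) \<in> borel_measurable borel"
        using meas \<rho> cP by auto
      have "(\<lambda>z. (indicator (V \<delta>) z *\<^sub>R evr (to_ser Q) z) / (indicator (V \<delta>) z *\<^sub>R evr (to_ser P) z)) \<in> borel_measurable borel"
        by measurable
      also have "(\<lambda>z. (indicator (V \<delta>) z *\<^sub>R evr (to_ser Q) z) / (indicator (V \<delta>) z *\<^sub>R evr (to_ser P) z))
          = (\<lambda>z. indicator (V \<delta>) z *\<^sub>R f z)"
        using fV VV by (auto simp: fun_eq_iff indicator_def)
      finally show "set_borel_measurable lborel (V \<delta>) f" by (simp add: set_borel_measurable_def)
      have "(\<integral>\<^sup>+ z \<in> V \<delta>. ennreal (norm (f z) powr 2) \<partial>lborel) = sqint (to_ser Q) (to_ser P) \<delta>"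
        unfolding sqint_def
      proof (rule nn_integral_cong_AE)
        show "AE z in lborel. ennreal (norm (f z) powr 2) * indicator (V \<delta>) z
            = indicator (Sq \<delta>) z * ennreal ((norm (evr (to_ser Q) z / evr (to_ser P) z))\<^sup>2)"
          using AE_fst_nonzero
        proof eventually_elim
          case (elim z)
          hence "z \<in> Sq \<delta> \<longleftrightarrow> z \<in> V \<delta>" by (auto simp: Sq_def V_def)
          thus ?case using fV[of z] VV by (auto simp: indicator_def powr_2_eq)
        qed
      qed
      also have "\<dots> < \<infinity>" using le_less_trans[OF sqint_mono[OF \<delta>(3)] \<delta>0(2)] .
      finally show "(\<integral>\<^sup>+ z \<in> V \<delta>. ennreal (norm (f z) powr 2) \<partial>lborel) < \<infinity>" .
    qed
  qed
qed

subsection \<open>Zeros of a polynomial without zeros in the product of half planes\<close>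

text \<open>Hurwitz's theorem: the polynomials P(x + i/n, y) have no zero in the upper half plane
  and converge locally uniformly to P(x, y), which is not identically zero because of y0.\<close>

lemma no_zeros_upper_boundary:
  assumes P: "poly2 P"
    and nozeros: "\<And>x y. Im x > 0 \<Longrightarrow> Im y > 0 \<Longrightarrow> ev (to_ser P) x y \<noteq> 0"
    and y0: "ev (to_ser P) (of_real x) y0 \<noteq> 0" and z: "Im z > 0"
  shows "ev (to_ser P) (of_real x) z \<noteq> 0"
proof -
  define S where "S = {z. Im z > 0}"
  obtain d where d: "\<And>j. j \<ge> d \<Longrightarrow> fps_nth (to_ser P) j = 0" using poly2_y_degree[OF P] by blast
  define a where "a j w = eval_fps (fps_nth (to_ser P) j) w" for j w
  have pe: "ev (to_ser P) w z = (\<Sum>j<d. a j w * z ^ j)" for w z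
  proof -
    have "ev (to_ser P) w z = poly (spoly (to_ser P) w) z" by (rule poly_spoly[OF d, symmetric])
    also have "spoly (to_ser P) w = (\<Sum>j<d. monom (a j w) j)"
      unfolding a_def using poly_as_sum_lessThan[of d "spoly (to_ser P) w"] d
      by (simp add: coeff_spoly[OF d])
    finally show ?thesis by (simp add: poly_sum poly_monom)
  qed
  define xn where "xn n = complex_of_real x + \<i> * of_real (inverse (real (Suc n)))" for n
  have xn: "xn \<longlonglongrightarrow> of_real x"
  proof -
    have "(\<lambda>n. complex_of_real x + \<i> * of_real (inverse (real (Suc n)))) \<longlonglongrightarrow> of_real x + \<i> * of_real 0"
      by (intro tendsto_intros LIMSEQ_inverse_real_of_nat)
    thus ?thesis by (simp add: xn_def[abs_def])
  qed
  have alim: "(\<lambda>n. a j (xn n)) \<longlonglongrightarrow> a j (of_real x)" for j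
  proof -
    have "evaluable (of_real x) (fps_nth (to_ser P) j)"
      by (rule conv_on_evaluable[OF poly2_conv_on[OF P, of "norm (complex_of_real x) + 1"]]) (auto simp: add_nonneg_pos)
    hence "isCont (eval_fps (fps_nth (to_ser P) j)) (of_real x)" by (rule continuous_eval_fps)
    thus ?thesis unfolding a_def using xn by (rule isCont_tendsto_compose)
  qed
  \<comment> \<open>Constant with a zero means identically zero on the half plane, so the polynomial
    in y would be 0, against its value at y0.\<close>
  have nc: "\<not> ev (to_ser P) (of_real x) constant_on S" if root: "ev (to_ser P) (of_real x) z = 0"
  proof
    assume "ev (to_ser P) (of_real x) constant_on S"
    then obtain c where c: "\<And>w. w \<in> S \<Longrightarrow> ev (to_ser P) (of_real x) w = c" unfolding constant_on_def by blast
    hence zero: "poly (spoly (to_ser P) (of_real x)) w = 0" if "w \<in> S" for w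
      using that c[of z] root z poly_spoly[OF d, where x="of_real x" and y=w] by (simp add: S_def)
    have "spoly (to_ser P) (of_real x) = 0"
    proof (rule ccontr)
      assume "spoly (to_ser P) (of_real x) \<noteq> 0"
      hence "finite {w. poly (spoly (to_ser P) (of_real x)) w = 0}" by (rule poly_roots_finite)
      moreover have "S \<subseteq> {w. poly (spoly (to_ser P) (of_real x)) w = 0}" using zero by blast
      ultimately have "finite S" by (rule rev_finite_subset)
      moreover have "open S" "S \<noteq> {}" using z unfolding S_def by (auto simp: open_halfspace_Im_gt)
      ultimately show False using finite_imp_not_open by blast
    qed
    thus False using y0 poly_spoly[OF d, where x="of_real x" and y=y0] by simp
  qed
  show ?thesis
  proof
    assume root: "ev (to_ser P) (of_real x) z = 0"
    have "ev (to_ser P) (of_real x) z \<noteq> 0"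
    proof (rule Hurwitz_no_zeros[of S "\<lambda>n. ev (to_ser P) (xn n)" "ev (to_ser P) (of_real x)"])
      show "open S" "connected S" unfolding S_def
        by (auto simp: open_halfspace_Im_gt intro: convex_connected convex_halfspace_Im_gt)
      show "ev (to_ser P) (xn n) holomorphic_on S" for n unfolding pe[abs_def] by (intro holomorphic_intros)
      show "ev (to_ser P) (of_real x) holomorphic_on S" unfolding pe[abs_def] by (intro holomorphic_intros)
      show "\<not> ev (to_ser P) (of_real x) constant_on S" by (rule nc[OF root])
      show "z \<in> S" using z by (simp add: S_def)
      show "ev (to_ser P) (xn n) w \<noteq> 0" if "w \<in> S" for n w
        by (rule nozeros) (use that in \<open>auto simp: S_def xn_def\<close>)
      fix K :: "complex set" assume K: "compact K" "K \<subseteq> S"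
      obtain R where R: "\<And>w. w \<in> K \<Longrightarrow> norm w \<le> R" using compact_imp_bounded[OF K(1)] unfolding bounded_iff by blast
      show "uniform_limit K (\<lambda>n. ev (to_ser P) (xn n)) (ev (to_ser P) (of_real x)) sequentially"
      proof (rule uniform_limitI)
        fix e :: real assume "e > 0"
        have "(\<lambda>n. \<Sum>j<d. norm (a j (xn n) - a j (of_real x)) * R ^ j) \<longlonglongrightarrow> (\<Sum>j<d. norm (a j (of_real x) - a j (of_real x)) * R ^ j)"
          by (intro tendsto_intros alim)
        hence "\<forall>\<^sub>F n in sequentially. (\<Sum>j<d. norm (a j (xn n) - a j (of_real x)) * R ^ j) < e"
          using \<open>e > 0\<close> by (intro order_tendstoD(2)) simp_all
        thus "\<forall>\<^sub>F n in sequentially. \<forall>w\<in>K. dist (ev (to_ser P) (xn n) w) (ev (to_ser P) (of_real x) w) < e"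
        proof eventually_elim
          case (elim n)
          show ?case
          proof
            fix w assume w: "w \<in> K"
            have "dist (ev (to_ser P) (xn n) w) (ev (to_ser P) (of_real x) w)
                = norm (\<Sum>j<d. (a j (xn n) - a j (of_real x)) * w ^ j)"
              unfolding pe dist_norm by (simp add: left_diff_distrib sum_subtractf)
            also have "\<dots> \<le> (\<Sum>j<d. norm (a j (xn n) - a j (of_real x)) * R ^ j)"
              using R[OF w] by (intro sum_norm_le) (auto simp: norm_mult norm_power intro!: mult_left_mono power_mono)
            finally show "dist (ev (to_ser P) (xn n) w) (ev (to_ser P) (of_real x) w) < e" using elim by simp
          qed
        qed
      qed
    qed
    thus False using root by simp
  qed
qed

lemma eval_fps_nonzero_near:
  assumes "f \<in> conv1" "f \<noteq> 0"
  obtains \<delta> where "\<delta> > 0" "\<And>x. 0 < norm x \<Longrightarrow> norm x < \<delta> \<Longrightarrow> eval_fps f x \<noteq> 0"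
proof -
  obtain r where r: "r > 0" "\<And>x. norm x < r \<Longrightarrow> evaluable x f" using conv1_radius[OF assms(1)] by blast
  define f1 where "f1 = fps_shift (subdegree f) f"
  have "isCont (eval_fps f1) 0"
    using assms by (intro continuous_eval_fps) (simp add: f1_def conv1_def zero_ereal_def)
  moreover have "eval_fps f1 0 \<noteq> 0" using assms(2) by (simp add: eval_fps_at_0 f1_def)
  ultimately obtain e where e: "e > 0" "\<And>x. dist x 0 < e \<Longrightarrow> eval_fps f1 x \<noteq> 0"
    using continuous_at_avoid[of 0 "eval_fps f1" 0] by (auto simp: dist_commute)
  show ?thesis
  proof (rule that[of "min r e"])
    fix x :: complex assume x: "0 < norm x" "norm x < min r e"
    have "eval_fps f x = x ^ subdegree f * eval_fps f1 x"
      unfolding f1_def using x r by (intro eval_fps_subdegree) auto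
    thus "eval_fps f x \<noteq> 0" using x e(2)[of x] by simp
  qed (use r e in auto)
qed

text \<open>At a zero of P the quotient B/P has the junk value 0, but near it the bound on B/P forces B to
  vanish too.\<close>
lemma comparable_nonzero:
  assumes P: "poly2 P" "P \<noteq> (\<lambda>_. 0)" and B: "poly2 B"
    and bounded: "\<epsilon> > 0" "\<And>x y::real. 0 < norm (x,y) \<Longrightarrow> norm (x,y) < \<epsilon> \<Longrightarrow>
        norm (ev (to_ser P) (of_real x) (of_real y) / ev (to_ser B) (of_real x) (of_real y)) \<le> C \<and>
        norm (ev (to_ser B) (of_real x) (of_real y) / ev (to_ser P) (of_real x) (of_real y)) \<le> C"
    and Bnz: "\<And>x y::real. x \<noteq> 0 \<Longrightarrow> ev (to_ser B) (of_real x) (of_real y) \<noteq> 0"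
  obtains \<delta> where "\<delta> > 0" "\<And>x y::real. 0 < \<bar>x\<bar> \<Longrightarrow> \<bar>x\<bar> < \<delta> \<Longrightarrow> \<bar>y\<bar> < \<delta> \<Longrightarrow>
      ev (to_ser P) (of_real x) (of_real y) \<noteq> 0 \<and>
      norm (ev (to_ser P) (of_real x) (of_real y)) \<le> C * norm (ev (to_ser B) (of_real x) (of_real y)) \<and>
      norm (ev (to_ser B) (of_real x) (of_real y)) \<le> C * norm (ev (to_ser P) (of_real x) (of_real y))"
proof -
  define p where "p x y = ev (to_ser P) (complex_of_real x) (complex_of_real y)" for x y :: real
  define \<beta> where "\<beta> x y = ev (to_ser B) (complex_of_real x) (complex_of_real y)" for x y :: real
  obtain d where d: "\<And>j. j \<ge> d \<Longrightarrow> fps_nth (to_ser P) j = 0" using poly2_y_degree[OF P(1)] by blast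
  \<comment> \<open>Some coefficient of a power of y is a nonzero series in x; close to 0 but off 0
    it does not vanish, so P(x, y) is a nonzero polynomial in y there.\<close>
  obtain i j where "P (i,j) \<noteq> 0" using P(2) by (metis ext surj_pair)
  hence "fps_nth (to_ser P) j \<noteq> 0" by (metis cf_to_ser fps_zero_nth)
  then obtain \<delta>1 where \<delta>1: "\<delta>1 > 0"
    "\<And>x. 0 < norm x \<Longrightarrow> norm x < \<delta>1 \<Longrightarrow> eval_fps (fps_nth (to_ser P) j) x \<noteq> 0"
    using eval_fps_nonzero_near[OF cser_nth[OF poly2_cser[OF P(1)]]] by blast
  have cont: "continuous_on UNIV (\<lambda>t. p x t)" "continuous_on UNIV (\<lambda>t. \<beta> x t)" for x
    unfolding p_def \<beta>_def
    by (rule continuous_on_compose2[OF continuous_ev_poly2[OF P(1)], where f="\<lambda>t. (complex_of_real x, complex_of_real t)", simplified]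
        continuous_on_compose2[OF continuous_ev_poly2[OF B], where f="\<lambda>t. (complex_of_real x, complex_of_real t)", simplified];
        intro continuous_intros)+
  define \<delta> where "\<delta> = min \<delta>1 (\<epsilon> / 2)"
  show ?thesis
  proof (rule that[of \<delta>])
    show "\<delta> > 0" using \<delta>1 bounded by (simp add: \<delta>_def)
    fix x y :: real assume xy: "0 < \<bar>x\<bar>" "\<bar>x\<bar> < \<delta>" "\<bar>y\<bar> < \<delta>"
    have inr: "0 < norm (x,t) \<and> norm (x,t) < \<epsilon>" if "\<bar>t\<bar> < \<delta>" for t
    proof -
      have "norm (x,t) \<le> \<bar>x\<bar> + \<bar>t\<bar>" using norm_Pair_le[of x t] by simp
      thus ?thesis using xy that by (auto simp: \<delta>_def zero_prod_def)
    qed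
    have le1: "norm (p x t) \<le> C * norm (\<beta> x t)" if "\<bar>t\<bar> < \<delta>" for t
      using bounded(2)[of x t] inr[OF that] Bnz[of x t] xy by (simp add: p_def \<beta>_def norm_divide field_simps)
    have le2: "norm (\<beta> x t) \<le> C * norm (p x t)" if "\<bar>t\<bar> < \<delta>" "p x t \<noteq> 0" for t
      using bounded(2)[of x t] inr[OF that(1)] that(2) by (simp add: p_def \<beta>_def norm_divide field_simps)
    \<comment> \<open>\<open>le2\<close> gives the inequality off the finitely many zeros of P(x, y)
      in y; continuity extends it to these zeros.\<close>
    have "norm (\<beta> x y) \<le> C * norm (p x y)"
    proof (rule tendsto_le[of "at y"])
      show "((\<lambda>t. norm (\<beta> x t)) \<longlongrightarrow> norm (\<beta> x y)) (at y)"
        using cont(2) by (intro tendsto_norm) (auto simp: continuous_on_def)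
      show "((\<lambda>t. C * norm (p x t)) \<longlongrightarrow> C * norm (p x y)) (at y)"
        using cont(1) by (intro tendsto_intros) (auto simp: continuous_on_def)
      have "spoly (to_ser P) (of_real x) \<noteq> 0"
      proof
        assume "spoly (to_ser P) (of_real x) = 0"
        hence "eval_fps (fps_nth (to_ser P) j) (of_real x) = 0"
          using coeff_spoly[OF d, where x="of_real x" and j=j] by simp
        thus False using \<delta>1(2)[of "of_real x"] xy by (simp add: \<delta>_def)
      qed
      hence "finite {z. poly (spoly (to_ser P) (of_real x)) z = 0}" by (rule poly_roots_finite)
      hence "finite (complex_of_real -` {z. poly (spoly (to_ser P) (of_real x)) z = 0})"
        by (rule finite_vimageI) (simp add: inj_def)
      moreover have "complex_of_real -` {z. poly (spoly (to_ser P) (of_real x)) z = 0} = {t. p x t = 0}"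
        unfolding p_def using poly_spoly[OF d] by auto
      ultimately have fin: "finite {t. p x t = 0}" by simp
      have "\<forall>\<^sub>F t in at y. t \<notin> {t. p x t = 0} - {y}"
      proof -
        have "open (- ({t. p x t = 0} - {y}))" using fin by (intro open_Compl finite_imp_closed) simp
        thus ?thesis by (intro eventually_at_topological[THEN iffD2] exI[of _ "- ({t. p x t = 0} - {y})"]) auto
      qed
      moreover have "\<forall>\<^sub>F t in at y. t \<noteq> y" by (simp add: eventually_at_filter)
      moreover have "\<forall>\<^sub>F t in at y. \<bar>t\<bar> < \<delta>"
      proof -
        have "((\<lambda>t. \<bar>t\<bar>) \<longlongrightarrow> \<bar>y\<bar>) (at y)" by (intro tendsto_intros)
        thus ?thesis using xy(3) by (rule order_tendstoD(2))
      qed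
      ultimately show "\<forall>\<^sub>F t in at y. norm (\<beta> x t) \<le> C * norm (p x t)"
        by eventually_elim (auto intro: le2)
    qed simp
    moreover from this have "p x y \<noteq> 0" using Bnz[of x y] xy by (auto simp: \<beta>_def)
    ultimately show "ev (to_ser P) (of_real x) (of_real y) \<noteq> 0 \<and>
      norm (ev (to_ser P) (of_real x) (of_real y)) \<le> C * norm (ev (to_ser B) (of_real x) (of_real y)) \<and>
      norm (ev (to_ser B) (of_real x) (of_real y)) \<le> C * norm (ev (to_ser P) (of_real x) (of_real y))"
      using le1[OF xy(3)] by (simp add: p_def \<beta>_def)
  qed
qed

section \<open>Codimension of (P, bar P) for a polynomial P comparable with the product of
  factors\<close>

context stable_factors
begin

text \<open>Letting x tend to 0 at fixed y turns the comparison into one between P(0, y) and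
  \<open>y ^ M\<close>, because all branches pass through the origin. Hence P(0, y) has order
  M.\<close>

lemma regular_of_comparable:
  assumes P: "poly2 P" and Bc: "poly2 B" "to_ser B = Bn M" and "\<delta> > 0"
    and cmp: "\<And>x y::real. 0 < \<bar>x\<bar> \<Longrightarrow> \<bar>x\<bar> < \<delta> \<Longrightarrow> \<bar>y\<bar> < \<delta> \<Longrightarrow>
      norm (ev (to_ser P) (of_real x) (of_real y)) \<le> C * norm (ev (to_ser B) (of_real x) (of_real y)) \<and>
      norm (ev (to_ser B) (of_real x) (of_real y)) \<le> C * norm (ev (to_ser P) (of_real x) (of_real y))"
  shows "regular M (to_ser P)"
proof -
  define p where "p = slice (to_ser P) 0"
  have pe: "ev (to_ser P) 0 y = eval_fps p y" for y by (simp add: ev_def p_def)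
  have pn: "fps_nth p j = cf (to_ser P) 0 j" for j by (simp add: p_def eval_fps_at_0)
  have pc: "p \<in> conv1"
    using conv_on_slice_evaluable[OF poly2_conv_on[OF P, of 1], of 0 0] by (simp add: conv1_def p_def zero_ereal_def)
  have B0: "ev (to_ser B) 0 y = y ^ M" for y
    unfolding Bc(2) ev_Bn by (simp add: eval_fps_at_0 b0)
  have lim: "((\<lambda>x::real. norm (ev (to_ser c) (of_real x) (of_real y))) \<longlongrightarrow> norm (ev (to_ser c) 0 (of_real y))) (at_right 0)"
    if "poly2 c" for c and y :: real
  proof (intro tendsto_norm)
    have "continuous_on UNIV (\<lambda>x::real. (\<lambda>z. ev (to_ser c) (fst z) (snd z)) (complex_of_real x, complex_of_real y))"
      by (rule continuous_on_compose2[OF continuous_ev_poly2[OF that]]) (auto intro!: continuous_intros)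
    hence "((\<lambda>x::real. ev (to_ser c) (of_real x) (of_real y)) \<longlongrightarrow> ev (to_ser c) (of_real 0) (of_real y)) (at 0)"
      unfolding continuous_on_def by (elim ballE[of _ _ 0]) simp_all
    hence "((\<lambda>x::real. ev (to_ser c) (of_real x) (of_real y)) \<longlongrightarrow> ev (to_ser c) 0 (of_real y)) (at 0)" by simp
    thus "((\<lambda>x::real. ev (to_ser c) (of_real x) (of_real y)) \<longlongrightarrow> ev (to_ser c) 0 (of_real y)) (at_right 0)"
      by (rule tendsto_within_subset) simp
  qed
  have near: "\<forall>\<^sub>F x in at_right (0::real). 0 < \<bar>x\<bar> \<and> \<bar>x\<bar> < \<delta>"
    using eventually_small_real[OF \<open>\<delta> > 0\<close>] by eventually_elim auto
  have c0: "norm (eval_fps p (of_real y)) \<le> C * norm (eval_fps (fps_X ^ M) (complex_of_real y)) \<and>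
      norm (eval_fps (fps_X ^ M) (complex_of_real y)) \<le> C * norm (eval_fps p (of_real y))" if y: "\<bar>y\<bar> < \<delta>" for y
  proof
    have "\<forall>\<^sub>F x in at_right (0::real).
        norm (ev (to_ser P) (of_real x) (of_real y)) \<le> C * norm (ev (to_ser B) (of_real x) (of_real y)) \<and>
        norm (ev (to_ser B) (of_real x) (of_real y)) \<le> C * norm (ev (to_ser P) (of_real x) (of_real y))"
      using near
    proof eventually_elim
      case (elim x)
      show ?case by (rule cmp) (use elim y in auto)
    qed
    hence e1: "\<forall>\<^sub>F x in at_right (0::real). norm (ev (to_ser P) (of_real x) (of_real y)) \<le> C * norm (ev (to_ser B) (of_real x) (of_real y))"
      and e2: "\<forall>\<^sub>F x in at_right (0::real). norm (ev (to_ser B) (of_real x) (of_real y)) \<le> C * norm (ev (to_ser P) (of_real x) (of_real y))"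
      by (simp_all only: eventually_conj_iff)
    have "norm (ev (to_ser P) 0 (of_real y)) \<le> C * norm (ev (to_ser B) 0 (of_real y))"
      by (rule tendsto_le[OF _ tendsto_mult[OF tendsto_const lim[OF Bc(1)]] lim[OF P] e1]) simp
    thus "norm (eval_fps p (of_real y)) \<le> C * norm (eval_fps (fps_X ^ M) (complex_of_real y))" by (simp add: pe B0)
    have "norm (ev (to_ser B) 0 (of_real y)) \<le> C * norm (ev (to_ser P) 0 (of_real y))"
      by (rule tendsto_le[OF _ tendsto_mult[OF tendsto_const lim[OF P]] lim[OF Bc(1)] e2]) simp
    thus "norm (eval_fps (fps_X ^ M) (complex_of_real y)) \<le> C * norm (eval_fps p (of_real y))" by (simp add: pe B0)
  qed
  have "\<forall>\<^sub>F y in at_right (0::real).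
      norm (eval_fps p (of_real y)) \<le> C * norm (eval_fps (fps_X ^ M) (complex_of_real y)) \<and>
      norm (eval_fps (fps_X ^ M) (complex_of_real y)) \<le> C * norm (eval_fps p (of_real y))"
    using near
  proof eventually_elim
    case (elim y)
    show ?case by (rule c0) (use elim in blast)
  qed
  hence ev1: "\<forall>\<^sub>F y in at_right (0::real). norm (eval_fps p (of_real y)) \<le> C * norm (eval_fps (fps_X ^ M) (complex_of_real y))"
    and ev2: "\<forall>\<^sub>F y in at_right (0::real). norm (eval_fps (fps_X ^ M) (complex_of_real y)) \<le> C * norm (eval_fps p (of_real y))"
    by (simp_all only: eventually_conj_iff)
  have pnz: "p \<noteq> 0"
  proof
    assume "p = 0"
    hence "norm (eval_fps (fps_X ^ M) (complex_of_real (\<delta> / 2))) \<le> 0" using c0[of "\<delta> / 2"] \<open>\<delta> > 0\<close> by simp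
    hence "(\<delta> / 2) ^ M \<le> 0" using \<open>\<delta> > 0\<close> by (simp add: norm_power)
    moreover have "(\<delta> / 2) ^ M > 0" using \<open>\<delta> > 0\<close> by simp
    ultimately show False by linarith
  qed
  have XM: "fps_X ^ M \<in> conv1" by (intro conv1_power) simp
  have "subdegree p = M"
    using subdegree_le_of_growth[OF pc pnz XM ev1] subdegree_le_of_growth[OF XM _ pc ev2] by simp
  thus ?thesis
    unfolding regular_def pn[symmetric] using pnz nth_subdegree_nonzero[OF pnz] by (auto intro: nth_less_subdegree_zero)
qed

text \<open>Weierstrass preparation replaces P by W = U P; as U and \<open>bar U\<close> are units,
  the ideal stays the same and the comparison changes only by constants. For small x > 0 the
  comparison excludes real zeros near 0 and \<open>no_zeros_upper_boundary\<close> excludes those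
  above the axis, so the zeros of W near 0 lie below it.\<close>

theorem codim_idl_polynomial:
  assumes P: "poly2 P" and nozeros: "\<And>x y. Im x > 0 \<Longrightarrow> Im y > 0 \<Longrightarrow> ev (to_ser P) x y \<noteq> 0"
    and Bc: "poly2 B" "to_ser B = Bn M" and "\<delta> > 0"
    and cmp: "\<And>x y::real. 0 < \<bar>x\<bar> \<Longrightarrow> \<bar>x\<bar> < \<delta> \<Longrightarrow> \<bar>y\<bar> < \<delta> \<Longrightarrow>
      ev (to_ser P) (of_real x) (of_real y) \<noteq> 0 \<and>
      norm (ev (to_ser P) (of_real x) (of_real y)) \<le> C * norm (ev (to_ser B) (of_real x) (of_real y)) \<and>
      norm (ev (to_ser B) (of_real x) (of_real y)) \<le> C * norm (ev (to_ser P) (of_real x) (of_real y))"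
  shows "codim cser (idl (to_ser P) (bar (to_ser P))) (2 * (\<Sum>j<M. L j + subdegree (lead j)))"
proof -
  define F where "F = to_ser P"
  have Fc: "F \<in> cser" unfolding F_def by (rule poly2_cser[OF P])
  have "regular M F"
    unfolding F_def by (rule regular_of_comparable[OF P Bc \<open>\<delta> > 0\<close>]) (use cmp in blast)
  then obtain U where U: "U \<in> cser" "cf U 0 0 \<noteq> 0" "weierstrass_poly M (U * F)"
    using weierstrass_preparation[OF Fc] by blast
  obtain V where V: "V \<in> cser" "V * U = 1" using cser_unit[OF U(1,2)] by blast
  define W where "W = U * F"
  have VW: "V * W = F" unfolding W_def using V(2) by (simp add: mult.assoc[symmetric])
  have barVU: "bar V * bar U = 1"
  proof -
    have "bar V * bar U = bar (V * U)" by (simp add: bar_mult)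
    also have "\<dots> = 1" unfolding V(2) by (rule ser_eqI) simp
    finally show ?thesis .
  qed
  have "idl W (bar W) = idl F (bar F)"
    unfolding W_def bar_mult using U V barVU by (intro idl_units[where V=V and V'="bar V"] cser_bar)
  moreover have "codim cser (idl W (bar W)) (2 * (\<Sum>j<M. L j + subdegree (lead j)))"
  proof -
    obtain \<rho> where \<rho>: "conv_on \<rho> U" "conv_on \<rho> V" using cser_conv_on2[OF U(1) V(1)] by blast
    note pos = conv_on_pos[OF \<rho>(1)]
    have Fr: "conv_on \<rho> F" unfolding F_def by (rule poly2_conv_on[OF P pos])
    have Wr: "conv_on \<rho> W" unfolding W_def by (rule conv_on_mult[OF \<rho>(1) Fr])
    obtain CU where CU: "bnd \<rho> \<rho> U CU" using \<rho> by (auto simp: conv_on_def)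
    obtain CV where CV: "bnd \<rho> \<rho> V CV" using \<rho> by (auto simp: conv_on_def)
    have CUV: "CU \<ge> 0" "CV \<ge> 0" using bnd_nonneg[OF CU] bnd_nonneg[OF CV] pos by auto
    define \<epsilon> where "\<epsilon> = min \<delta> \<rho>"
    have \<epsilon>: "\<epsilon> > 0" "\<epsilon> \<le> \<delta>" "\<epsilon> \<le> \<rho>" using \<open>\<delta> > 0\<close> pos by (auto simp: \<epsilon>_def)
    \<comment> \<open>The bounds for the unit U and its inverse V enter one in each direction of the
      comparison.\<close>
    define K where "K = max (CU * C) (C * CV)"
    \<comment> \<open>The sign of C is read off at the single point (\<delta>/2, 0), where the
      product of factors does not vanish.\<close>
    have C0: "C \<ge> 0"
    proof -
      have "0 < norm (ev (to_ser B) (complex_of_real (\<delta> / 2)) (of_real 0))"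
        unfolding Bc(2) ev_Bn using factor_nonzero[of "\<delta> / 2" 0] \<open>\<delta> > 0\<close> by simp
      moreover have "0 \<le> C * norm (ev (to_ser B) (complex_of_real (\<delta> / 2)) (of_real 0))"
        using cmp[of "\<delta> / 2" 0] \<open>\<delta> > 0\<close> by (auto intro: order_trans[OF norm_ge_zero])
      ultimately show ?thesis by (simp add: zero_le_mult_iff)
    qed
    have near: "\<forall>\<^sub>F x in at_right (0::real). 0 < x \<and> norm (complex_of_real x) < \<epsilon>"
      by (rule eventually_small_real[OF \<epsilon>(1)])
    show ?thesis
    proof (rule codim_idl_comparable[where \<epsilon>=\<epsilon> and C=K])
      show "weierstrass_poly M W" using U by (simp add: W_def)
      show "\<epsilon> > 0" by (rule \<epsilon>)
      show "\<forall>\<^sub>F x in at_right (0::real). \<forall>z. norm z < \<epsilon> \<longrightarrow> ev W (of_real x) z = 0 \<longrightarrow> Im z < 0"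
        using near
      proof eventually_elim
        case (elim x)
        show ?case
        proof (intro allI impI, rule ccontr)
          fix z assume z: "norm z < \<epsilon>" "ev W (of_real x) z = 0" "\<not> Im z < 0"
          have "ev (V * W) (of_real x) z = ev V (of_real x) z * ev W (of_real x) z"
            using elim z \<epsilon> by (intro ev_mult[OF \<rho>(2) Wr]) auto
          hence F0: "ev (to_ser P) (of_real x) z = 0" using z VW by (simp add: F_def)
          have nz: "ev (to_ser P) (of_real x) (of_real y) \<noteq> 0" if "\<bar>y\<bar> < \<epsilon>" for y :: real
            using cmp[of x y] elim that \<epsilon> by auto
          show False
          proof (cases "Im z = 0")
            case True
            hence "z = of_real (Re z)" by (simp add: complex_eq_iff)
            moreover have "\<bar>Re z\<bar> < \<epsilon>" using abs_Re_le_cmod[of z] z(1) by linarith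
            ultimately show False using nz[of "Re z"] F0 by metis
          next
            case False
            hence "Im z > 0" using z(3) by simp
            thus False using no_zeros_upper_boundary[OF P nozeros nz[of 0]] F0 \<epsilon> by simp
          qed
        qed
      qed
      show "\<forall>\<^sub>F x in at_right (0::real). \<forall>y::real. \<bar>y\<bar> < \<epsilon> \<longrightarrow>
          norm (ev W (of_real x) (of_real y)) \<le> K * norm (ev (Bn M) (of_real x) (of_real y)) \<and>
          norm (ev (Bn M) (of_real x) (of_real y)) \<le> K * norm (ev W (of_real x) (of_real y))"
        using near
      proof eventually_elim
        case (elim x)
        show ?case
        proof (intro allI impI)
          fix y :: real assume y: "\<bar>y\<bar> < \<epsilon>"
          let ?x = "complex_of_real x" and ?y = "complex_of_real y"
          have n: "norm ?x < \<rho>" "norm ?y < \<rho>" using elim y \<epsilon> by auto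
          have W1: "ev W ?x ?y = ev U ?x ?y * ev F ?x ?y" unfolding W_def by (rule ev_mult[OF \<rho>(1) Fr n])
          have F1: "ev F ?x ?y = ev V ?x ?y * ev W ?x ?y" using ev_mult[OF \<rho>(2) Wr n] VW by simp
          have bU: "norm (ev U ?x ?y) \<le> CU" and bV: "norm (ev V ?x ?y) \<le> CV"
            using bnd_ev[OF CU pos pos] bnd_ev[OF CV pos pos] n by auto
          have c: "norm (ev F ?x ?y) \<le> C * norm (ev (Bn M) ?x ?y)" "norm (ev (Bn M) ?x ?y) \<le> C * norm (ev F ?x ?y)"
            using cmp[of x y] elim y \<epsilon> unfolding F_def Bc(2) by auto
          have "norm (ev W ?x ?y) \<le> CU * (C * norm (ev (Bn M) ?x ?y))"
            unfolding W1 norm_mult using bU c(1) CUV by (intro mult_mono) auto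
          also have "\<dots> \<le> K * norm (ev (Bn M) ?x ?y)"
            unfolding mult.assoc[symmetric] by (intro mult_right_mono) (auto simp: K_def)
          finally have r1: "norm (ev W ?x ?y) \<le> K * norm (ev (Bn M) ?x ?y)" .
          have "norm (ev F ?x ?y) \<le> CV * norm (ev W ?x ?y)"
            unfolding F1 norm_mult using bV by (intro mult_right_mono) auto
          hence "norm (ev (Bn M) ?x ?y) \<le> C * (CV * norm (ev W ?x ?y))"
            using c(2) C0 by (meson mult_left_mono order_trans)
          also have "\<dots> \<le> K * norm (ev W ?x ?y)"
            unfolding mult.assoc[symmetric] by (intro mult_right_mono) (auto simp: K_def)
          finally show "norm (ev W ?x ?y) \<le> K * norm (ev (Bn M) ?x ?y) \<and> norm (ev (Bn M) ?x ?y) \<le> K * norm (ev W ?x ?y)"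
            using r1 by simp
        qed
      qed
    qed
  qed
  ultimately show ?thesis by (simp add: F_def)
qed

end

text \<open>Since q has real coefficients, conjugation of -q - i x^(2 L) changes only the sign of
  the last term. The locale speaks of all indices, so beyond M the family is continued by -i x^2
  with exponent 1; below M the degree bound excludes L = 0.\<close>

lemma stable_factors_of_polys:
  fixes q :: "nat \<Rightarrow> real poly" and L :: "nat \<Rightarrow> nat"
  assumes "\<And>j. j < M \<Longrightarrow> poly (q j) 0 = 0" "\<And>j. j < M \<Longrightarrow> degree (q j) < 2 * L j"
  defines "b \<equiv> \<lambda>j. if j < M then fps_of_poly (- map_poly complex_of_real (q j) - monom \<i> (2 * L j))
      else fps_of_poly (- monom \<i> 2)"
  defines "L' \<equiv> \<lambda>j. if j < M then L j else 1"
  shows "stable_factors b L'"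
proof
  fix j
  show "fps_conv_radius (b j) = \<infinity>" by (simp add: b_def)
  show Lp: "L' j \<ge> 1" using assms(2)[of j] by (cases "L j = 0") (auto simp: L'_def)
  show "fps_nth (b j) 0 = 0"
    using assms(1)[of j] Lp by (auto simp: b_def L'_def coeff_map_poly poly_0_coeff_0)
  show "cnjf (b j) - b j = fps_const (2 * \<i>) * fps_X ^ (2 * L' j)"
  proof (rule fps_ext)
    fix n
    show "fps_nth (cnjf (b j) - b j) n = fps_nth (fps_const (2 * \<i>) * fps_X ^ (2 * L' j)) n"
      by (auto simp: b_def L'_def coeff_map_poly fps_X_power_nth)
  qed
qed

text \<open>The factor 1/2 stands as a factor 2 on the other side, because dimensions take values in
  \<open>enat\<close>. B with q and L is \<open>[P]\<close>, described by its values and by the two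
  bounded quotients.\<close>

theorem theorem1p6:
  fixes P B :: ps2 and L :: "nat \<Rightarrow> nat" and q :: "nat \<Rightarrow> real poly"
  assumes Ppoly: "poly2 P"
    and nozeros: "\<And>x y. Im x > 0 \<Longrightarrow> Im y > 0 \<Longrightarrow> ps_eval P x y \<noteq> 0"
    and P00: "P (0,0) = 0"
    and coprime: "no_common_factor P (ps_bar P)"
    and q0: "\<And>j. j \<in> {1..vorder P} \<Longrightarrow> poly (q j) 0 = 0"
    and q'0: "\<And>j. j \<in> {1..vorder P} \<Longrightarrow> poly (pderiv (q j)) 0 > 0"
    and qdeg: "\<And>j. j \<in> {1..vorder P} \<Longrightarrow> degree (q j) < 2 * L j"
    and Bpoly: "poly2 B"
    and Beval: "\<And>x y. ps_eval B x y =
        (\<Prod>j\<in>{1..vorder P}. y + poly (map_poly complex_of_real (q j)) x + \<i> * x ^ (2 * L j))"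
    and bounded: "\<exists>\<epsilon>>0. \<exists>C. \<forall>x y::real. 0 < norm (x,y) \<and> norm (x,y) < \<epsilon> \<longrightarrow>
        norm (ps_eval P (of_real x) (of_real y) / ps_eval B (of_real x) (of_real y)) \<le> C \<and>
        norm (ps_eval B (of_real x) (of_real y) / ps_eval P (of_real x) (of_real y)) \<le> C"
  shows "2 * quot_dim (Ip 2 P) (ideal2 B (ps_bar B)) = quot_dim {c. ps_conv c} (ideal2 P (ps_bar P))"
proof -
  define M where "M = vorder P"
  \<comment> \<open>The factors are numbered from 1 in the theorem and from 0 in the locale, hence
    \<open>Suc j\<close>.\<close>
  define b where "b = (\<lambda>j. if j < M then fps_of_poly (- map_poly complex_of_real (q (Suc j)) - monom \<i> (2 * L (Suc j)))
      else fps_of_poly (- monom \<i> 2))"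
  define L' where "L' = (\<lambda>j. if j < M then L (Suc j) else 1)"
  interpret stable_factors b L'
    unfolding b_def L'_def
    by (rule stable_factors_of_polys) (use q0 qdeg in \<open>auto simp: M_def\<close>)
  have evB: "ev (to_ser B) x y = ev (Bn M) x y" for x y
  proof -
    have "ev (to_ser B) x y = (\<Prod>j\<in>{1..M}. y + poly (map_poly complex_of_real (q j)) x + \<i> * x ^ (2 * L j))"
      unfolding poly2_ps_eval[OF Bpoly, symmetric] Beval M_def ..
    also have "\<dots> = (\<Prod>k<M. y + poly (map_poly complex_of_real (q (Suc k))) x + \<i> * x ^ (2 * L (Suc k)))"
      by (simp add: prod.atLeast1_atMost_eq)
    also have "\<dots> = ev (Bn M) x y"
      unfolding ev_Bn by (intro prod.cong refl) (simp add: b_def poly_monom)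
    finally show ?thesis .
  qed
  \<comment> \<open>B is given by its values; equality of series follows from equality of values on
    a bidisc.\<close>
  have B: "to_ser B = Bn M"
    by (rule ev_eqD[of 1]) (auto intro: poly2_conv_on[OF Bpoly] conv_on_Bn evB)
  have nozeros': "\<And>x y. Im x > 0 \<Longrightarrow> Im y > 0 \<Longrightarrow> ev (to_ser P) x y \<noteq> 0"
    using nozeros unfolding poly2_ps_eval[OF Ppoly] .
  have Pnz: "P \<noteq> (\<lambda>_. 0)"
  proof
    assume "P = (\<lambda>_. 0)"
    thus False using nozeros[of \<i> \<i>] by (simp add: ps_eval_def case_prod_unfold)
  qed
  obtain \<epsilon> C where \<epsilon>: "\<epsilon> > 0" "\<And>x y::real. 0 < norm (x,y) \<Longrightarrow> norm (x,y) < \<epsilon> \<Longrightarrow>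
        norm (ev (to_ser P) (of_real x) (of_real y) / ev (to_ser B) (of_real x) (of_real y)) \<le> C \<and>
        norm (ev (to_ser B) (of_real x) (of_real y) / ev (to_ser P) (of_real x) (of_real y)) \<le> C"
    using bounded unfolding poly2_ps_eval[OF Ppoly] poly2_ps_eval[OF Bpoly] by blast
  have Bnz: "ev (to_ser B) (of_real x) (of_real y) \<noteq> 0" if "x \<noteq> 0" for x y :: real
    unfolding B ev_Bn using factor_nonzero[OF that] by simp
  obtain \<delta> where \<delta>: "\<delta> > 0" "\<And>x y::real. 0 < \<bar>x\<bar> \<Longrightarrow> \<bar>x\<bar> < \<delta> \<Longrightarrow> \<bar>y\<bar> < \<delta> \<Longrightarrow>
      ev (to_ser P) (of_real x) (of_real y) \<noteq> 0 \<and>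
      norm (ev (to_ser P) (of_real x) (of_real y)) \<le> C * norm (ev (to_ser B) (of_real x) (of_real y)) \<and>
      norm (ev (to_ser B) (of_real x) (of_real y)) \<le> C * norm (ev (to_ser P) (of_real x) (of_real y))"
    using comparable_nonzero[OF Ppoly Pnz Bpoly \<epsilon> Bnz] by blast
  define d where "d = (\<Sum>j<M. L' j + subdegree (lead j))"
  have dimP: "quot_dim {c. ps_conv c} (ideal2 P (ps_bar P)) = enat (2 * d)"
  proof (rule quot_dim_eq_codim)
    have img: "to_ser ` {c. ps_conv c} = cser" using to_ser_image[of "\<lambda>f. f \<in> cser"] by (simp add: ps_conv_iff)
    show "codim (to_ser ` {c. ps_conv c}) (to_ser ` ideal2 P (ps_bar P)) (2 * d)"
      unfolding img to_ser_ideal2 to_ser_ps_bar d_def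
      by (rule codim_idl_polynomial[OF Ppoly nozeros' Bpoly B \<delta>])
    show "subsp (to_ser ` ideal2 P (ps_bar P))" unfolding to_ser_ideal2 by (rule subsp_idl)
  qed
  \<comment> \<open>Square integrability of F / P depends on the modulus of P only up to bounded
    factors, and both denominators are nonzero on \<open>Sq \<delta>\<close>.\<close>
  have L2_iff: "L2 F (to_ser P) \<longleftrightarrow> L2 F (Bn M)" if F: "F \<in> cser" for F
  proof -
    have C0: "C \<ge> 0"
      using \<epsilon>(2)[of "\<epsilon> / 2" 0] \<epsilon>(1) by (auto intro: order_trans[OF norm_ge_zero])
    have r: "evr (to_ser P) z \<noteq> 0" "evr (Bn M) z \<noteq> 0"
      "norm (evr (to_ser P) z) \<le> C * norm (evr (Bn M) z)" "norm (evr (Bn M) z) \<le> C * norm (evr (to_ser P) z)"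
      if "z \<in> Sq \<delta>" for z
      using \<delta>(2)[of "fst z" "snd z"] Bnz[of "fst z" "snd z"] that unfolding B evr_def Sq_def by auto
    have quot: "norm (f / g) \<le> C * norm (f / h)" if "norm h \<le> C * norm g" "g \<noteq> 0" "h \<noteq> 0" for f g h :: complex
    proof -
      have "norm f * norm h \<le> norm f * (C * norm g)" using that by (intro mult_left_mono) auto
      thus ?thesis using that by (simp add: norm_divide field_simps)
    qed
    show ?thesis
    proof
      assume "L2 F (to_ser P)"
      thus "L2 F (Bn M)"
        by (rule L2_cmp[OF F poly2_cser[OF Ppoly] _ \<delta>(1), where K=C]) (intro quot r)
    next
      assume "L2 F (Bn M)"
      thus "L2 F (to_ser P)"
        by (rule L2_cmp[OF F cser_Bn _ \<delta>(1), where K=C]) (intro quot r)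
    qed
  qed
  have dimI: "quot_dim (Ip 2 P) (ideal2 B (ps_bar B)) = enat d"
  proof (rule quot_dim_eq_codim)
    have "Ip 2 P = {c. to_ser c \<in> cser \<and> L2 (to_ser c) (Bn M)}"
      unfolding Ip_def using Lp_loc_iff_L2[OF Ppoly] L2_iff by (auto simp: ps_conv_iff)
    hence img: "to_ser ` Ip 2 P = I2 (Bn M)"
      using to_ser_image[of "\<lambda>f. f \<in> cser \<and> L2 f (Bn M)"] by (simp add: I2_def)
    show "codim (to_ser ` Ip 2 P) (to_ser ` ideal2 B (ps_bar B)) d"
      unfolding img to_ser_ideal2 to_ser_ps_bar B d_def by (rule codim_I2_idl)
    show "subsp (to_ser ` ideal2 B (ps_bar B))" unfolding to_ser_ideal2 by (rule subsp_idl)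
  qed
  have "2 * enat d = enat (2 * d)" by (metis numeral_eq_enat times_enat_simps(1))
  thus ?thesis unfolding dimP dimI .
qed

end
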